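(* Let $F_I^\circ$ be an open face that is accessible for $g_\Sigma$, so that $M_I<2$. For every $p\in F_I^\circ$ there exist a relatively compact neighbourhood $V\Subset F_I^\circ$ of $p$ and constants $0<c\le C<\infty$ such that for all sufficiently close $z,z'\in V$ (i.e. for all $z,z'\in V$ with $d_{F_I}(z,z')<\eta$, for some $\eta>0$), $$c\,d_{F_I}(z,z')^{1-M_I/2}\le d_{\partial,\Sigma}(z,z')\le C\,d_{F_I}(z,z')^{1-M_I/2}.$$
   Context: Let $X$ be a compact smooth $n$-dimensional manifold with corners (locally modelled on $[0,\infty)^k\times\mathbb R^{n-k}$, $0\le k\le n$) whose boundary hypersurfaces $H_1,\dots,H_N$ are globally embedded, and let $X^\circ=X\setminus\partial X$. For each $i$ let $\rho_i:X\to[0,\infty)$ be a smooth boundary-defining function of $H_i$: $H_i=\rho_i^{-1}(0)$, $d\rho_i\neq0$ on $H_i$, and $\rho_i>0$ on $X\setminus H_i$. Let $g_0$ be a smooth Riemannian metric on $X$ (up to the boundary), and let $\alpha_1,\dots,\alpha_N\ge 0$. On $X^\circ$ put $g_\Sigma=\bigl(\sum_{i=1}^N\rho_i^{-\alpha_i}\bigr)g_0$, with Riemannian distance $d_{g_\Sigma}$. For $p\in X$, $I(p)=\{i: p\in H_i\}$; for nonempty $I\subseteq\{1,\dots,N\}$, the open face is $F_I^\circ=\{p\in X: I(p)=I\}$, a smooth manifold without boundary of codimension $|I|$ when nonempty, and $M_I=\max_{i\in I}\alpha_i$. A point $p\in\partial X$ is accessible for $g_\Sigma$ if there is a $d_{g_\Sigma}$-Cauchy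 sequence in $X^\circ$ converging to $p$ in the topology of $X$; an open face is accessible if all its points are; for a nonempty open face this is equivalent to $M_I<2$. $d_{F_I}$ is the Riemannian distance on $F_I^\circ$ induced by the restriction of $g_0$. For $z$ in an accessible open face, all sequences in $X^\circ$ converging to $z$ in the topology of $X$ are $d_{g_\Sigma}$-Cauchy and equivalent; $\overline z$ denotes the resulting point of the metric completion of $(X^\circ,d_{g_\Sigma})$. The induced boundary distance $d_{\partial,\Sigma}(z,z')$ is the distance in that completion between $\overline z$ and $\overline{z'}$. *)

theory Defs
  imports "HOL-Analysis.Analysis"
begin

section \<open>Smooth maps on subsets of Euclidean space\<close>

text \<open>\<^term>\<open>Ck_on k f W\<close> is only used for open \<open>W\<close> in finite dimension, where continuity of
  all iterated directional derivatives up to order \<open>k\<close> is the usual \<open>C\<^sup>k\<close> condition.\<close>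

primrec Ck_on ::
  "nat \<Rightarrow> ('e::real_normed_vector \<Rightarrow> 'f::real_normed_vector) \<Rightarrow> 'e set \<Rightarrow> bool" where
  "Ck_on 0 f W = continuous_on W f"
| "Ck_on (Suc k) f W =
     ((\<forall>x\<in>W. f differentiable (at x)) \<and> (\<forall>v. Ck_on k (\<lambda>x. frechet_derivative f (at x) v) W))"

text \<open>On a set that need not be open (here: a relatively open subset of
  \<open>[0,\<infinity>)\<^sup>k \<times> \<real>\<^sup>n\<^sup>-\<^sup>k\<close>), smooth means locally extendable to a smooth map on an open set.\<close>

definition smooth_map_on ::
  "('e::real_normed_vector \<Rightarrow> 'f::real_normed_vector) \<Rightarrow> 'e set \<Rightarrow> bool" where
  "smooth_map_on f S \<longleftrightarrow>
     (\<forall>x\<in>S. \<exists>W h. open W \<and> x \<in> W \<and> (\<forall>k. Ck_on k h W) \<and> (\<forall>y\<in>S \<inter> W. h y = f y))"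

section \<open>Manifolds with corners\<close>

text \<open>The dimension is \<open>n = DIM('e)\<close>. A chart takes values in the model corner cut out by a set
  of \<open>k\<close> coordinate directions (elements of \<^term>\<open>Basis\<close>); letting this set vary is
  \<open>[0,\<infinity>)\<^sup>k \<times> \<real>\<^sup>n\<^sup>-\<^sup>k\<close> up to a permutation of the coordinates.\<close>

record ('a, 'e) chart =
  chart_dom :: "'a set"
  chart_map :: "'a \<Rightarrow> 'e"
  chart_dirs :: "'e set"

definition model_corner :: "'e::euclidean_space set \<Rightarrow> 'e set" where
  "model_corner K = {x. \<forall>b\<in>K. 0 \<le> x \<bullet> b}"

definition chart_inv :: "('a, 'e) chart \<Rightarrow> 'e \<Rightarrow> 'a" where
  "chart_inv c = inv_into (chart_dom c) (chart_map c)"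

definition is_chart :: "'a topology \<Rightarrow> ('a, 'e::euclidean_space) chart \<Rightarrow> bool" where
  "is_chart X c \<longleftrightarrow>
     openin X (chart_dom c) \<and>
     chart_dirs c \<subseteq> Basis \<and>
     openin (top_of_set (model_corner (chart_dirs c))) (chart_map c ` chart_dom c) \<and>
     homeomorphic_map (subtopology X (chart_dom c)) (top_of_set (chart_map c ` chart_dom c))
       (chart_map c)"

definition smooth_manifold_with_corners ::
  "'a topology \<Rightarrow> ('a, 'e::euclidean_space) chart set \<Rightarrow> bool" where
  "smooth_manifold_with_corners X A \<longleftrightarrow>
     Hausdorff_space X \<and> second_countable X \<and>
     (\<forall>c\<in>A. is_chart X c) \<and>
     topspace X = (\<Union>c\<in>A. chart_dom c) \<and>
     (\<forall>c\<in>A. \<forall>d\<in>A. smooth_map_on (chart_map d \<circ> chart_inv c)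
        (chart_map c ` (chart_dom c \<inter> chart_dom d)))"

definition smooth_function :: "('a, 'e::euclidean_space) chart set \<Rightarrow> ('a \<Rightarrow> real) \<Rightarrow> bool" where
  "smooth_function A f \<longleftrightarrow>
     (\<forall>c\<in>A. smooth_map_on (f \<circ> chart_inv c) (chart_map c ` chart_dom c))"

subsection \<open>Boundary, boundary hypersurfaces, open faces\<close>

text \<open>The boundary coordinates vanishing at a point of the chart domain; their number (the depth
  of the point) does not depend on the chart.\<close>

definition active_dirs :: "('a, 'e::euclidean_space) chart \<Rightarrow> 'a \<Rightarrow> 'e set" where
  "active_dirs c p = {b \<in> chart_dirs c. chart_map c p \<bullet> b = 0}"

definition depth_stratum :: "('a, 'e::euclidean_space) chart set \<Rightarrow> nat \<Rightarrow> 'a set" where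
  "depth_stratum A k = {p. \<exists>c\<in>A. p \<in> chart_dom c \<and> card (active_dirs c p) = k}"

definition corner_boundary :: "('a, 'e::euclidean_space) chart set \<Rightarrow> 'a set" where
  "corner_boundary A = {p. \<exists>c\<in>A. p \<in> chart_dom c \<and> active_dirs c p \<noteq> {}}"

definition corner_interior :: "'a topology \<Rightarrow> ('a, 'e::euclidean_space) chart set \<Rightarrow> 'a set" where
  "corner_interior X A = topspace X - corner_boundary A"

definition boundary_hypersurfaces ::
  "'a topology \<Rightarrow> ('a, 'e::euclidean_space) chart set \<Rightarrow> 'a set set" where
  "boundary_hypersurfaces X A =
     (\<lambda>Q. X closure_of Q) ` connected_components_of (subtopology X (depth_stratum A 1))"

text \<open>No self-intersections: near each of its points the hypersurface is the zero set of a single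
  boundary coordinate.\<close>

definition embedded_hypersurface ::
  "'a topology \<Rightarrow> ('a, 'e::euclidean_space) chart set \<Rightarrow> 'a set \<Rightarrow> bool" where
  "embedded_hypersurface X A H \<longleftrightarrow>
     (\<forall>p\<in>H. \<exists>c\<in>A. p \<in> chart_dom c \<and>
        (\<exists>b\<in>active_dirs c p. \<exists>W. openin X W \<and> p \<in> W \<and> W \<subseteq> chart_dom c \<and>
           H \<inter> W = {q \<in> W. chart_map c q \<bullet> b = 0}))"

text \<open>The last clause is \<open>d\<rho> \<noteq> 0\<close> on \<open>H\<close>: the coordinate expression of \<open>\<rho>\<close> is differentiable
  within the chart image, with unique derivative since that set is relatively open in a corner.\<close>

definition boundary_defining_function ::
  "'a topology \<Rightarrow> ('a, 'e::euclidean_space) chart set \<Rightarrow> 'a set \<Rightarrow> ('a \<Rightarrow> real) \<Rightarrow> bool" where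
  "boundary_defining_function X A H \<rho> \<longleftrightarrow>
     smooth_function A \<rho> \<and>
     H = {p \<in> topspace X. \<rho> p = 0} \<and>
     (\<forall>p\<in>topspace X - H. 0 < \<rho> p) \<and>
     (\<forall>c\<in>A. \<forall>p\<in>H \<inter> chart_dom c.
        \<not> ((\<rho> \<circ> chart_inv c) has_derivative (\<lambda>v. 0))
            (at (chart_map c p) within chart_map c ` chart_dom c))"

definition open_face :: "'a topology \<Rightarrow> nat \<Rightarrow> (nat \<Rightarrow> 'a set) \<Rightarrow> nat set \<Rightarrow> 'a set" where
  "open_face X N H I = {p \<in> topspace X. {i \<in> {1..N}. p \<in> H i} = I}"

section \<open>Riemannian metrics and distances\<close>

text \<open>A tensor field is given by its coordinate expressions: \<^term>\<open>g c p v w\<close> is the metric at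
  \<open>p\<close> on the tangent vectors with components \<open>v\<close>, \<open>w\<close> in the chart \<open>c\<close>. The last clause is the
  transformation law.\<close>

type_synonym ('a, 'e) metric_tensor = "('a, 'e) chart \<Rightarrow> 'a \<Rightarrow> 'e \<Rightarrow> 'e \<Rightarrow> real"

definition smooth_riemannian_metric ::
  "('a, 'e::euclidean_space) chart set \<Rightarrow> ('a, 'e) metric_tensor \<Rightarrow> bool" where
  "smooth_riemannian_metric A g \<longleftrightarrow>
     (\<forall>c\<in>A. \<forall>p\<in>chart_dom c.
        bilinear (g c p) \<and> (\<forall>v w. g c p v w = g c p w v) \<and> (\<forall>v. v \<noteq> 0 \<longrightarrow> 0 < g c p v v)) \<and>
     (\<forall>c\<in>A. \<forall>v w. smooth_map_on (\<lambda>x. g c (chart_inv c x) v w) (chart_map c ` chart_dom c)) \<and>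
     (\<forall>c\<in>A. \<forall>d\<in>A. \<forall>p\<in>chart_dom c \<inter> chart_dom d. \<forall>D.
        ((chart_map d \<circ> chart_inv c) has_derivative D)
          (at (chart_map c p) within chart_map c ` (chart_dom c \<inter> chart_dom d)) \<longrightarrow>
        (\<forall>v w. g c p v w = g d p (D v) (D w)))"

definition sigma_metric ::
  "nat \<Rightarrow> (nat \<Rightarrow> 'a \<Rightarrow> real) \<Rightarrow> (nat \<Rightarrow> real) \<Rightarrow> ('a, 'e) metric_tensor \<Rightarrow> ('a, 'e) metric_tensor" where
  "sigma_metric N \<rho> \<alpha> g c p v w = (\<Sum>i=1..N. \<rho> i p powr (- \<alpha> i)) * g c p v w"

definition C1_curve_on ::
  "('a, 'e::euclidean_space) chart set \<Rightarrow> real set \<Rightarrow> (real \<Rightarrow> 'a) \<Rightarrow> bool" where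
  "C1_curve_on A J \<gamma> \<longleftrightarrow>
     (\<forall>c\<in>A. let T = {t \<in> J. \<gamma> t \<in> chart_dom c} in
        \<exists>D. (\<forall>t\<in>T. ((chart_map c \<circ> \<gamma>) has_vector_derivative D t) (at t within T)) \<and>
            continuous_on T D)"

text \<open>Unlike the library's \<^const>\<open>piecewise_C1_differentiable_on\<close>, the pieces are \<open>C\<^sup>1\<close> up to
  their end points.\<close>

definition piecewise_C1_curve ::
  "'a topology \<Rightarrow> ('a, 'e::euclidean_space) chart set \<Rightarrow> (real \<Rightarrow> 'a) \<Rightarrow> bool" where
  "piecewise_C1_curve X A \<gamma> \<longleftrightarrow>
     continuous_map (top_of_set {0..1}) X \<gamma> \<and>
     (\<exists>m (\<tau>::nat \<Rightarrow> real). \<tau> 0 = 0 \<and> \<tau> m = 1 \<and>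
        (\<forall>i<m. \<tau> i < \<tau> (Suc i) \<and> C1_curve_on A {\<tau> i..\<tau> (Suc i)} \<gamma>))"

definition chart_at :: "('a, 'e) chart set \<Rightarrow> 'a \<Rightarrow> ('a, 'e) chart" where
  "chart_at A p = (SOME c. c \<in> A \<and> p \<in> chart_dom c)"

text \<open>By the transformation law the choice of the chart is irrelevant; at the finitely many break
  points of a piecewise \<open>C\<^sup>1\<close> curve the value is arbitrary, which does not affect the length.\<close>

definition curve_speed ::
  "('a, 'e::euclidean_space) chart set \<Rightarrow> ('a, 'e) metric_tensor \<Rightarrow> (real \<Rightarrow> 'a) \<Rightarrow> real \<Rightarrow> real" where
  "curve_speed A g \<gamma> t =
     (let c = chart_at A (\<gamma> t);
          v = vector_derivative (chart_map c \<circ> \<gamma>) (at t within {0..1})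
      in sqrt (g c (\<gamma> t) v v))"

definition curve_length ::
  "('a, 'e::euclidean_space) chart set \<Rightarrow> ('a, 'e) metric_tensor \<Rightarrow> (real \<Rightarrow> 'a) \<Rightarrow> real" where
  "curve_length A g \<gamma> = integral {0..1} (curve_speed A g \<gamma>)"

text \<open>Distance in \<open>S\<close>, where \<open>S\<close> is \<open>X\<^sup>\<circ>\<close> or an open face, i.e. a submanifold without boundary
  carrying the restriction of \<open>g\<close>: a \<open>C\<^sup>1\<close> curve in the submanifold is a \<open>C\<^sup>1\<close> curve in \<open>X\<close>
  with values in \<open>S\<close>, of the same length. The value is \<open>\<infinity>\<close> if no curve in \<open>S\<close> joins the points.\<close>

definition riemannian_dist ::
  "'a topology \<Rightarrow> ('a, 'e::euclidean_space) chart set \<Rightarrow> ('a, 'e) metric_tensor \<Rightarrow> 'a set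
    \<Rightarrow> 'a \<Rightarrow> 'a \<Rightarrow> ennreal" where
  "riemannian_dist X A g S p q =
     (INF \<gamma> \<in> {\<gamma>. piecewise_C1_curve X A \<gamma> \<and> \<gamma> ` {0..1} \<subseteq> S \<and> \<gamma> 0 = p \<and> \<gamma> 1 = q}.
        ennreal (curve_length A g \<gamma>))"

section \<open>Metric completion\<close>

text \<open>The library's completion is for real-valued metrics; here distances may be infinite, as \<open>X\<close> is
  not assumed connected.\<close>

definition cauchy_seqs :: "'a set \<Rightarrow> ('a \<Rightarrow> 'a \<Rightarrow> ennreal) \<Rightarrow> (nat \<Rightarrow> 'a) set" where
  "cauchy_seqs S d =
     {x. range x \<subseteq> S \<and> (\<forall>\<epsilon>>0. \<exists>M. \<forall>m\<ge>M. \<forall>n\<ge>M. d (x m) (x n) < \<epsilon>)}"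

definition cauchy_equiv :: "'a set \<Rightarrow> ('a \<Rightarrow> 'a \<Rightarrow> ennreal) \<Rightarrow> ((nat \<Rightarrow> 'a) \<times> (nat \<Rightarrow> 'a)) set" where
  "cauchy_equiv S d =
     {(x, y). x \<in> cauchy_seqs S d \<and> y \<in> cauchy_seqs S d \<and> (\<lambda>n. d (x n) (y n)) \<longlonglongrightarrow> 0}"

definition metric_completion :: "'a set \<Rightarrow> ('a \<Rightarrow> 'a \<Rightarrow> ennreal) \<Rightarrow> (nat \<Rightarrow> 'a) set set" where
  "metric_completion S d = cauchy_seqs S d // cauchy_equiv S d"

text \<open>The limit does not depend on the chosen representatives.\<close>

definition completion_dist ::
  "('a \<Rightarrow> 'a \<Rightarrow> ennreal) \<Rightarrow> (nat \<Rightarrow> 'a) set \<Rightarrow> (nat \<Rightarrow> 'a) set \<Rightarrow> ennreal" where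
  "completion_dist d P Q = lim (\<lambda>n. d ((SOME x. x \<in> P) n) ((SOME y. y \<in> Q) n))"

definition accessible_point :: "'a topology \<Rightarrow> 'a set \<Rightarrow> ('a \<Rightarrow> 'a \<Rightarrow> ennreal) \<Rightarrow> 'a \<Rightarrow> bool" where
  "accessible_point X S d p \<longleftrightarrow> (\<exists>x\<in>cauchy_seqs S d. limitin X x p sequentially)"

definition completion_point ::
  "'a topology \<Rightarrow> 'a set \<Rightarrow> ('a \<Rightarrow> 'a \<Rightarrow> ennreal) \<Rightarrow> 'a \<Rightarrow> (nat \<Rightarrow> 'a) set" where
  "completion_point X S d z =
     (THE P. P \<in> metric_completion S d \<and>
        (\<forall>x. range x \<subseteq> S \<and> limitin X x z sequentially \<longrightarrow> x \<in> P))"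

definition boundary_dist ::
  "'a topology \<Rightarrow> 'a set \<Rightarrow> ('a \<Rightarrow> 'a \<Rightarrow> ennreal) \<Rightarrow> 'a \<Rightarrow> 'a \<Rightarrow> ennreal" where
  "boundary_dist X S d z z' =
     completion_dist d (completion_point X S d z) (completion_point X S d z')"

end

theory Submission
  imports Defs
begin

text \<open>Near \<open>p \<in> F\<^sub>I\<^sup>\<circ>\<close> take a chart in which the hypersurfaces through \<open>p\<close> are the coordinate
  hyperplanes \<open>x\<^sub>b = 0\<close>; each \<open>\<rho>\<^sub>i\<close>, \<open>i \<in> I\<close>, is comparable to its \<open>x\<^sub>b\<close>, and the other \<open>\<rho>\<^sub>i\<close> are bounded
  below. Put \<open>\<theta> = 1 - M\<^sub>I / 2\<close>.

  Upper bound: where all \<open>x\<^sub>b \<ge> s\<close>, lengths are stretched by at most a constant times \<open>s\<^bsup>-M/2\<^esup>\<close>. To join two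
  points at Euclidean distance \<open>s\<close>, rise by \<open>s\<close> along \<open>\<Sum>\<^sub>b b\<close>, cross, and descend; this costs
  \<open>O(\<integral>\<^sub>0\<^sup>s t\<^bsup>-M/2\<^esup> dt + s \<cdot> s\<^bsup>-M/2\<^esup>) = O(s\<^bsup>\<theta>\<^esup>)\<close>.

  Lower bound: in the ball of radius \<open>s\<close> about a point of the face, the coordinate with exponent \<open>M\<close> is
  at most \<open>s\<close>, so lengths are stretched by at least a constant times \<open>s\<^bsup>-M/2\<^esup>\<close>, and a curve leaving the ball
  has length at least a constant times \<open>s\<^bsup>\<theta>\<^esup>\<close>. The same estimate at \<open>p\<close> shows that accessibility forces
  \<open>M < 2\<close>.\<close>

section \<open>Charts\<close>

text \<open>Two gaps separate the definitions from estimates in coordinates. The hypersurfaces are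
  closures of components of the depth-one stratum, a global description that says nothing directly
  about the coordinates at \<open>p\<close>. The bridge is the piece of a coordinate hyperplane near
  \<open>p\<close> that lies on no other one: being convex, it falls into a single component, and
  every hypersurface through \<open>p\<close> contains such a piece. That depth is the same in all
  charts enters here. The other gap is that the boundary distance is a limit of distances inside the
  interior of X. The upper estimate is therefore proved for interior points, uniformly up to the
  face, and the exit estimate allows a start slightly off the centre of the ball, so that both
  survive the limit along explicit sequences rising from the face. All local constants are expressed
  through one radius \<open>r\<close>: each comparison holds with constants built from
  \<open>r\<close> and remains true when \<open>r\<close> shrinks, so finitely many of them can be
  met at once.\<close>

lemma smooth_map_onE:
  assumes "smooth_map_on f S" "x \<in> S"
  obtains W h h' where "open W" "x \<in> W" "\<And>y. y \<in> W \<Longrightarrow> (h has_derivative h' y) (at y)"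
    "\<And>v. continuous_on W (\<lambda>y. h' y v)" "\<And>y. y \<in> S \<Longrightarrow> y \<in> W \<Longrightarrow> h y = f y"
proof -
  obtain W h where W: "open W" "x \<in> W" "\<forall>k. Ck_on k h W" "\<forall>y\<in>S \<inter> W. h y = f y"
    using assms unfolding smooth_map_on_def by blast
  have "Ck_on (Suc 0) h W" using W by blast
  then have "(h has_derivative frechet_derivative h (at y)) (at y)" if "y \<in> W" for y
    using that by (auto simp: frechet_derivative_works)
  moreover have "continuous_on W (\<lambda>y. frechet_derivative h (at y) v)" for v
    using \<open>Ck_on (Suc 0) h W\<close> by simp
  ultimately show thesis using W that[of W h "\<lambda>y. frechet_derivative h (at y)"] by blast
qed

lemma smooth_map_on_has_derivative:
  assumes "smooth_map_on f S" "x \<in> S"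
  shows "\<exists>D. (f has_derivative D) (at x within S)"
proof -
  obtain W h h' where W: "open W" "x \<in> W" "\<And>y. y \<in> W \<Longrightarrow> (h has_derivative h' y) (at y)"
    "\<And>y. y \<in> S \<Longrightarrow> y \<in> W \<Longrightarrow> h y = f y"
    using smooth_map_onE[OF assms] by metis
  obtain e where e: "e > 0" "ball x e \<subseteq> W" using W open_contains_ball by metis
  have "(h has_derivative h' x) (at x within S)" using W has_derivative_at_withinI by blast
  then have "(f has_derivative h' x) (at x within S)"
    by (rule has_derivative_transform_within[OF _ e(1) assms(2)])
      (metis W(4) dist_commute e(2) mem_ball subsetD)
  then show ?thesis by blast
qed

lemma smooth_map_on_continuous:
  assumes "smooth_map_on f S" shows "continuous_on S f"
  using smooth_map_on_has_derivative[OF assms] has_derivative_continuous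
  unfolding continuous_on_eq_continuous_within by blast

lemma line_has_vector_derivative: "((\<lambda>t. y + t *\<^sub>R v) has_vector_derivative v) (at t within T)"
  unfolding has_vector_derivative_def by (auto intro!: derivative_eq_intros)

lemma has_vector_derivative_along_line:
  assumes "(h has_derivative h') (at (y + t *\<^sub>R v))"
  shows "((\<lambda>s. h (y + s *\<^sub>R v)) has_vector_derivative h' v) (at t)"
  using vector_derivative_diff_chain_within[OF line_has_vector_derivative has_derivative_at_withinI[OF assms], of UNIV]
  by (simp add: comp_def)

lemma closed_model_corner: "closed (model_corner K)"
proof -
  have "model_corner K = (\<Inter>b\<in>K. {x. 0 \<le> x \<bullet> b})" unfolding model_corner_def by auto
  then show ?thesis by (auto intro!: closed_INT closed_Collect_le continuous_intros)
qed

locale corner_manifold =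
  fixes X :: "'a topology" and A :: "('a, 'e::euclidean_space) chart set"
  assumes mfd: "smooth_manifold_with_corners X A"
begin

abbreviation img :: "('a, 'e) chart \<Rightarrow> 'e set" where "img c \<equiv> chart_map c ` chart_dom c"
abbreviation corner :: "('a, 'e) chart \<Rightarrow> 'e set" where "corner c \<equiv> model_corner (chart_dirs c)"
abbreviation curve :: "real set \<Rightarrow> (real \<Rightarrow> 'a) \<Rightarrow> bool" where
  "curve J \<gamma> \<equiv> continuous_map (top_of_set J) X \<gamma>"

lemma is_chart: "c \<in> A \<Longrightarrow> is_chart X c"
  using mfd unfolding smooth_manifold_with_corners_def by blast

lemma Hausdorff: "Hausdorff_space X"
  using mfd unfolding smooth_manifold_with_corners_def by blast

lemma openin_dom: "c \<in> A \<Longrightarrow> openin X (chart_dom c)"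
  using is_chart unfolding is_chart_def by blast

lemma dom_subset: "c \<in> A \<Longrightarrow> chart_dom c \<subseteq> topspace X"
  using openin_dom openin_subset by blast

lemma dirs_subset: "c \<in> A \<Longrightarrow> chart_dirs c \<subseteq> Basis"
  using is_chart unfolding is_chart_def by blast

lemma finite_dirs: "c \<in> A \<Longrightarrow> finite (chart_dirs c)"
  using dirs_subset finite_subset finite_Basis by blast

lemma active_dirs_subset: "c \<in> A \<Longrightarrow> active_dirs c p \<subseteq> Basis"
  using dirs_subset unfolding active_dirs_def by blast

lemma finite_active_dirs: "c \<in> A \<Longrightarrow> finite (active_dirs c p)"
  using active_dirs_subset finite_subset finite_Basis by blast

lemma ex_chart: "p \<in> topspace X \<Longrightarrow> \<exists>c\<in>A. p \<in> chart_dom c"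
  using mfd unfolding smooth_manifold_with_corners_def by auto

lemma chart_at: "p \<in> topspace X \<Longrightarrow> chart_at A p \<in> A \<and> p \<in> chart_dom (chart_at A p)"
  unfolding chart_at_def by (rule someI_ex) (use ex_chart in blast)

lemma homeo: "c \<in> A \<Longrightarrow> homeomorphic_map (subtopology X (chart_dom c))
    (top_of_set (img c)) (chart_map c)"
  using is_chart unfolding is_chart_def by blast

lemma topspace_dom: "c \<in> A \<Longrightarrow> topspace (subtopology X (chart_dom c)) = chart_dom c"
  using dom_subset by auto

lemma inj_chart: "c \<in> A \<Longrightarrow> inj_on (chart_map c) (chart_dom c)"
  using homeo[of c] topspace_dom[of c] unfolding homeomorphic_map_def by simp

lemma chart_inv_map [simp]: "c \<in> A \<Longrightarrow> p \<in> chart_dom c \<Longrightarrow> chart_inv c (chart_map c p) = p"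
  unfolding chart_inv_def by (simp add: inj_chart)

lemma map_chart_inv [simp]: "x \<in> img c \<Longrightarrow> chart_map c (chart_inv c x) = x"
  unfolding chart_inv_def by (simp add: f_inv_into_f)

lemma chart_inv_dom [simp]: "x \<in> img c \<Longrightarrow> chart_inv c x \<in> chart_dom c"
  unfolding chart_inv_def by (simp add: inv_into_into)

lemma continuous_chart: "c \<in> A \<Longrightarrow> continuous_map (subtopology X (chart_dom c)) euclidean (chart_map c)"
  using homeo homeomorphic_imp_continuous_map continuous_map_in_subtopology by blast

lemma continuous_chart_inv:
  assumes "c \<in> A" shows "continuous_map (top_of_set (img c)) X (chart_inv c)"
proof -
  obtain g where g: "homeomorphic_maps (subtopology X (chart_dom c))
    (top_of_set (img c)) (chart_map c) g"
    using homeo[OF assms] homeomorphic_map_maps by blast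
  then have cg: "continuous_map (top_of_set (img c)) X g"
    and gx: "\<And>x. x \<in> chart_dom c \<Longrightarrow> g (chart_map c x) = x"
    using topspace_dom[OF assms] unfolding homeomorphic_maps_def continuous_map_in_subtopology by auto
  show ?thesis
    by (rule continuous_map_eq[OF cg]) (use gx assms in auto)
qed

lemma openin_chart_vimage:
  assumes "c \<in> A" "open U" shows "openin X {q \<in> chart_dom c. chart_map c q \<in> U}"
proof -
  have "openin (subtopology X (chart_dom c)) {q \<in> topspace (subtopology X (chart_dom c)). chart_map c q \<in> U}"
    using openin_continuous_map_preimage[OF continuous_chart[OF assms(1)]] assms(2) by simp
  then show ?thesis
    unfolding topspace_dom[OF assms(1)] using openin_dom[OF assms(1)] by (simp add: openin_open_subtopology)
qed

lemma img_corner: "c \<in> A \<Longrightarrow> p \<in> chart_dom c \<Longrightarrow> chart_map c p \<in> corner c"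
  using is_chart[of c] openin_subset[of "top_of_set (corner c)" "img c"]
  unfolding is_chart_def by auto

lemma chart_cball:
  assumes "c \<in> A" "p \<in> chart_dom c"
  shows "\<exists>r>0. cball (chart_map c p) r \<inter> corner c \<subseteq> img c"
proof -
  have "openin (top_of_set (corner c)) (img c)"
    using is_chart[OF assms(1)] unfolding is_chart_def by blast
  then show ?thesis using assms(2) unfolding openin_contains_cball by auto
qed

text \<open>Since X is Hausdorff, compactness in coordinates gives closedness in X. This keeps a
  curve from leaving the chart domain before its coordinates reach the boundary of a compact
  ball.\<close>

lemma closedin_chart_inv:
  assumes "c \<in> A" "compact C" "C \<subseteq> img c"
  shows "compactin X (chart_inv c ` C)" "closedin X (chart_inv c ` C)"
proof -
  have "compactin (top_of_set (img c)) C"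
    using assms by (simp add: compactin_subtopology)
  then show "compactin X (chart_inv c ` C)"
    using image_compactin continuous_chart_inv[OF assms(1)] by blast
  then show "closedin X (chart_inv c ` C)" using Hausdorff compactin_imp_closedin by blast
qed

lemma curve_nbhd:
  assumes "curve J \<gamma>" "openin X U" "t \<in> J" "\<gamma> t \<in> U"
  shows "\<exists>e>0. \<forall>s\<in>J. dist s t < e \<longrightarrow> \<gamma> s \<in> U"
proof -
  have "openin (top_of_set J) {s \<in> J. \<gamma> s \<in> U}"
    using openin_continuous_map_preimage[OF assms(1,2)] by simp
  then show ?thesis using assms unfolding openin_euclidean_subtopology_iff by auto
qed

lemma curve_continuous:
  assumes "c \<in> A" "curve J \<gamma>" "T \<subseteq> J" "\<gamma> ` T \<subseteq> chart_dom c"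
  shows "continuous_on T (chart_map c \<circ> \<gamma>)"
proof -
  have "curve T \<gamma>"
    using continuous_map_from_subtopology_mono[OF assms(2,3)] .
  then have "continuous_map (top_of_set T) (subtopology X (chart_dom c)) \<gamma>"
    using assms(4) by (auto simp: continuous_map_in_subtopology)
  from continuous_map_compose[OF this continuous_chart[OF assms(1)]] show ?thesis by simp
qed

lemma transition_smooth:
  "c \<in> A \<Longrightarrow> d \<in> A \<Longrightarrow> smooth_map_on (chart_map d \<circ> chart_inv c)
        (chart_map c ` (chart_dom c \<inter> chart_dom d))"
  using mfd unfolding smooth_manifold_with_corners_def by blast

end

section \<open>Metric coefficients and invariance of the depth\<close>

locale corner_riemannian = corner_manifold X A
  for X :: "'a topology" and A :: "('a, 'e::euclidean_space) chart set" +
  fixes g :: "('a, 'e) metric_tensor"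
  assumes metric: "smooth_riemannian_metric A g"
begin

lemma metric_bilinear: "c \<in> A \<Longrightarrow> p \<in> chart_dom c \<Longrightarrow> bilinear (g c p)"
  and metric_pos: "c \<in> A \<Longrightarrow> p \<in> chart_dom c \<Longrightarrow> v \<noteq> 0 \<Longrightarrow> 0 < g c p v v"
  and metric_smooth: "c \<in> A \<Longrightarrow> smooth_map_on (\<lambda>x. g c (chart_inv c x) v u) (img c)"
  using metric unfolding smooth_riemannian_metric_def by blast+

lemma metric_nonneg: "c \<in> A \<Longrightarrow> p \<in> chart_dom c \<Longrightarrow> 0 \<le> g c p v v"
  using metric_pos[of c p v] bilinear_lzero[OF metric_bilinear] by (cases "v = 0") (auto simp: less_imp_le)

lemma metric_scale: "c \<in> A \<Longrightarrow> p \<in> chart_dom c \<Longrightarrow> g c p (k *\<^sub>R v) (k *\<^sub>R v) = k\<^sup>2 * g c p v v"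
  using bilinear_lmul[OF metric_bilinear] bilinear_rmul[OF metric_bilinear] by (simp add: power2_eq_square)

text \<open>Smoothness of the metric is assumed only for fixed vectors. Expanding in the basis turns
  it into joint continuity in the point and the vectors.\<close>

lemma metric_expand:
  assumes "c \<in> A" "p \<in> chart_dom c"
  shows "g c p v u = (\<Sum>(i,j)\<in>Basis \<times> Basis. (v \<bullet> i) * (u \<bullet> j) * g c p i j)"
proof -
  have "g c p v u = g c p (\<Sum>i\<in>Basis. (v \<bullet> i) *\<^sub>R i) (\<Sum>j\<in>Basis. (u \<bullet> j) *\<^sub>R j)"
    by (simp add: euclidean_representation)
  also have "\<dots> = (\<Sum>(i,j)\<in>Basis \<times> Basis. g c p ((v \<bullet> i) *\<^sub>R i) ((u \<bullet> j) *\<^sub>R j))"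
    by (rule bilinear_sum[OF metric_bilinear[OF assms]])
  also have "\<dots> = (\<Sum>(i,j)\<in>Basis \<times> Basis. (v \<bullet> i) * (u \<bullet> j) * g c p i j)"
    by (intro sum.cong) (auto simp: bilinear_lmul[OF metric_bilinear[OF assms]] bilinear_rmul[OF metric_bilinear[OF assms]])
  finally show ?thesis .
qed

text \<open>At boundary points derivatives are taken within the chart image. A smooth extension
  supplies one, and the transformation law covers any such derivative.\<close>

lemma transition_derivative:
  assumes "c \<in> A" "d \<in> A" "p \<in> chart_dom c" "p \<in> chart_dom d"
  obtains D where "((chart_map d \<circ> chart_inv c) has_derivative D)
          (at (chart_map c p) within chart_map c ` (chart_dom c \<inter> chart_dom d))"
    "\<And>v u. g c p v u = g d p (D v) (D u)"
proof -
  obtain D where D: "((chart_map d \<circ> chart_inv c) has_derivative D)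
          (at (chart_map c p) within chart_map c ` (chart_dom c \<inter> chart_dom d))"
    using smooth_map_on_has_derivative[OF transition_smooth[OF assms(1,2)]] assms(3,4) by blast
  moreover have "\<And>v u. g c p v u = g d p (D v) (D u)"
    using metric assms D unfolding smooth_riemannian_metric_def by blast
  ultimately show thesis using that by blast
qed

text \<open>The derivative of a transition map is injective by the transformation law of the positive definite
  metric, and it maps the largest linear subspace of the tangent cone at \<open>p\<close>, which has codimension
  \<^term>\<open>card (active_dirs c p)\<close>, into the corresponding subspace in the other chart.\<close>

lemma card_active_dirs_le:
  assumes c: "c \<in> A" and d: "d \<in> A" and pc: "p \<in> chart_dom c" and pd: "p \<in> chart_dom d"
  shows "card (active_dirs d p) \<le> card (active_dirs c p)"
proof -
  define W where "W = chart_map c ` (chart_dom c \<inter> chart_dom d)"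
  define \<psi> where "\<psi> = chart_map d \<circ> chart_inv c"
  define x where "x = chart_map c p"
  define L where "L = (\<lambda>K. {v::'e. \<forall>b\<in>K. v \<bullet> b = 0})"
  obtain D where D: "(\<psi> has_derivative D) (at x within W)"
    and Dg: "\<And>v u. g c p v u = g d p (D v) (D u)"
    using transition_derivative[OF assms] unfolding W_def \<psi>_def x_def by metis
  have lin: "linear D" using D has_derivative_linear by blast
  have inj: "inj D"
  proof (subst linear_injective_0[OF lin], intro allI impI)
    fix v assume "D v = 0"
    then have "g c p v v = 0" using Dg bilinear_lzero[OF metric_bilinear[OF d pd]] by simp
    then show "v = 0" using metric_pos[OF c pc, of v] by force
  qed
  have dimL: "dim (L K) = DIM('e) - card K" if "K \<subseteq> Basis" for K
  proof -
    have "L K = {v. \<forall>i\<in>Basis. i \<notin> Basis - K \<longrightarrow> v \<bullet> i = 0}" using that unfolding L_def by auto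
    then have "dim (L K) = card (Basis - K)" using dim_substandard[of "Basis - K"] by simp
    then show ?thesis using that by (simp add: card_Diff_subset finite_subset)
  qed
  have "D ` L (active_dirs c p) \<subseteq> L (active_dirs d p)"
  proof
    fix u assume "u \<in> D ` L (active_dirs c p)"
    then obtain v where v: "v \<in> L (active_dirs c p)" and u: "u = D v" by blast
    have "openin (top_of_set (corner c)) W"
    proof -
      have "openin (top_of_set (img c)) W"
      proof -
        have "openin (subtopology X (chart_dom c)) (chart_dom c \<inter> chart_dom d)"
          using openin_subtopology_Int2 openin_dom[OF d] by blast
        then show ?thesis unfolding W_def
          using homeomorphic_map_openness[OF homeo[OF c], of "chart_dom c \<inter> chart_dom d"]
          unfolding topspace_dom[OF c] by blast
      qed
      moreover have "openin (top_of_set (corner c)) (img c)"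
        using is_chart[OF c] unfolding is_chart_def by blast
      ultimately show ?thesis by (rule openin_trans)
    qed
    moreover have "x \<in> W" unfolding x_def W_def using pc pd by blast
    ultimately obtain r where r: "r > 0" "ball x r \<inter> corner c \<subseteq> W"
      unfolding openin_contains_ball by meson
    have pos: "x \<bullet> b > 0" if "b \<in> chart_dirs c - active_dirs c p" for b
      using that img_corner[OF c pc] unfolding active_dirs_def model_corner_def x_def by force
    have "\<forall>\<^sub>F t in at (0::real). \<forall>b\<in>chart_dirs c - active_dirs c p. (x + t *\<^sub>R v) \<bullet> b > 0"
    proof (subst eventually_ball_finite_distrib)
      show "finite (chart_dirs c - active_dirs c p)" using finite_dirs[OF c] by blast
      show "\<forall>b\<in>chart_dirs c - active_dirs c p. \<forall>\<^sub>F t in at 0. (x + t *\<^sub>R v) \<bullet> b > 0"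
      proof
        fix b assume b: "b \<in> chart_dirs c - active_dirs c p"
        have "((\<lambda>t. (x + t *\<^sub>R v) \<bullet> b) \<longlongrightarrow> (x + 0 *\<^sub>R v) \<bullet> b) (at (0::real))"
          by (intro tendsto_intros)
        then show "\<forall>\<^sub>F t in at 0. (x + t *\<^sub>R v) \<bullet> b > 0"
          using pos[OF b] by (intro order_tendstoD) auto
      qed
    qed
    moreover have "\<forall>\<^sub>F t in at (0::real). dist (x + t *\<^sub>R v) x < r"
    proof -
      have "((\<lambda>t. x + t *\<^sub>R v) \<longlongrightarrow> x + 0 *\<^sub>R v) (at (0::real))" by (intro tendsto_intros)
      then show ?thesis using r(1) by (simp add: tendsto_iff)
    qed
    \<comment> \<open>Points moved along \<open>v\<close> stay in \<open>W\<close> for small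
      \<open>t\<close> of both signs: the active coordinates remain zero and the other ones remain
      positive.\<close>
    ultimately have "\<forall>\<^sub>F t in at (0::real). x + t *\<^sub>R v \<in> W"
    proof eventually_elim
      case (elim t)
      have "x + t *\<^sub>R v \<in> corner c"
      proof (unfold model_corner_def, intro CollectI ballI)
        fix b assume b: "b \<in> chart_dirs c"
        show "0 \<le> (x + t *\<^sub>R v) \<bullet> b"
        proof (cases "b \<in> active_dirs c p")
          case True
          then have "v \<bullet> b = 0" "x \<bullet> b = 0" using v unfolding L_def active_dirs_def x_def by auto
          then show ?thesis by (simp add: inner_add_left)
        next
          case False
          then show ?thesis using elim(1) b less_imp_le by blast
        qed
      qed
      then show ?case using elim(2) r(2) by (auto simp: dist_commute)
    qed
    then obtain e where e: "e > 0" "\<And>t. t \<noteq> 0 \<Longrightarrow> dist t 0 < e \<Longrightarrow> x + t *\<^sub>R v \<in> W"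
      unfolding eventually_at by auto
    have inW: "x + t *\<^sub>R v \<in> W" if "t \<in> ball 0 e" for t
      using e(2)[of t] that \<open>x \<in> W\<close> by (cases "t = 0") auto
    have "(\<psi> has_derivative D) (at (x + 0 *\<^sub>R v) within (\<lambda>t. x + t *\<^sub>R v) ` ball 0 e)"
    proof -
      have "(\<lambda>t. x + t *\<^sub>R v) ` ball 0 e \<subseteq> W" using inW by blast
      from has_derivative_subset[OF D this] show ?thesis by simp
    qed
    from vector_derivative_diff_chain_within[OF line_has_vector_derivative this]
    have "((\<psi> \<circ> (\<lambda>t. x + t *\<^sub>R v)) has_vector_derivative D v) (at 0 within ball 0 e)" .
    moreover have at0: "at (0::real) within ball 0 e = at 0"
      using e(1) by (intro at_within_open) auto
    ultimately have der: "((\<psi> \<circ> (\<lambda>t. x + t *\<^sub>R v)) has_vector_derivative D v) (at 0)"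
      unfolding at0 by blast
    show "u \<in> L (active_dirs d p)"
    proof (unfold L_def, intro CollectI ballI)
      fix b assume b: "b \<in> active_dirs d p"
      have "((\<lambda>t. (\<psi> \<circ> (\<lambda>t. x + t *\<^sub>R v)) t \<bullet> b) has_vector_derivative D v \<bullet> b) (at 0)"
        using bounded_linear.has_vector_derivative[OF bounded_linear_inner_left der] .
      then have der': "((\<lambda>t. (\<psi> \<circ> (\<lambda>t. x + t *\<^sub>R v)) t \<bullet> b) has_real_derivative D v \<bullet> b) (at 0)"
        by (simp add: has_real_derivative_iff_has_vector_derivative)
      \<comment> \<open>Along the segment the coordinate \<open>b\<close> of the second chart is
        nonnegative, and it vanishes at \<open>t = 0\<close>. An interior minimum has zero
        derivative.\<close>
      have "D v \<bullet> b = 0"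
      proof (rule DERIV_local_min[OF der' e(1)], intro allI impI)
        fix t :: real assume t: "\<bar>0 - t\<bar> < e"
        then have "x + t *\<^sub>R v \<in> W" using inW by simp
        then obtain q where q: "q \<in> chart_dom c" "q \<in> chart_dom d" "x + t *\<^sub>R v = chart_map c q"
          unfolding W_def by blast
        have "0 \<le> chart_map d q \<bullet> b"
          using img_corner[OF d q(2)] b unfolding active_dirs_def model_corner_def by blast
        then have "0 \<le> \<psi> (x + t *\<^sub>R v) \<bullet> b" unfolding \<psi>_def using q c by simp
        moreover have "\<psi> x \<bullet> b = 0" unfolding \<psi>_def x_def using pc c b
          by (simp add: active_dirs_def)
        ultimately show "(\<psi> \<circ> (\<lambda>t. x + t *\<^sub>R v)) 0 \<bullet> b \<le> (\<psi> \<circ> (\<lambda>t. x + t *\<^sub>R v)) t \<bullet> b" by simp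
      qed
      then show "u \<bullet> b = 0" using u by simp
    qed
  qed
  then have "dim (D ` L (active_dirs c p)) \<le> dim (L (active_dirs d p))" using dim_subset by blast
  moreover have "dim (D ` L (active_dirs c p)) = dim (L (active_dirs c p))"
    using dim_image_eq[OF lin] inj inj_on_subset by blast
  ultimately have "DIM('e) - card (active_dirs c p) \<le> DIM('e) - card (active_dirs d p)"
    using dimL active_dirs_subset c d by metis
  \<comment> \<open>Subtraction of naturals truncates; these bounds allow the inequality between the
    dimensions to be turned into one between the cardinalities.\<close>
  moreover have "card (active_dirs d p) \<le> DIM('e)" "card (active_dirs c p) \<le> DIM('e)"
    using card_mono[OF finite_Basis active_dirs_subset] c d by blast+
  ultimately show ?thesis by linarith
qed

lemma card_active_dirs:
  "c \<in> A \<Longrightarrow> d \<in> A \<Longrightarrow> p \<in> chart_dom c \<Longrightarrow> p \<in> chart_dom d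
    \<Longrightarrow> card (active_dirs d p) = card (active_dirs c p)"
  by (simp add: card_active_dirs_le order_antisym)

text \<open>\<open>corner_boundary\<close> quantifies existentially over charts. Invariance of the
  depth lets any single chart around the point decide.\<close>

lemma interior_iff:
  assumes "c \<in> A" "p \<in> chart_dom c"
  shows "p \<in> corner_interior X A \<longleftrightarrow> (\<forall>b\<in>chart_dirs c. 0 < chart_map c p \<bullet> b)"
proof -
  have "active_dirs d p = {}" if "active_dirs c p = {}" "d \<in> A" "p \<in> chart_dom d" for d
  proof -
    have "card (active_dirs d p) = 0" using card_active_dirs[OF assms(1) that(2) assms(2) that(3)] that(1) by simp
    then show ?thesis using finite_active_dirs[OF that(2)] by simp
  qed
  then have "p \<in> corner_interior X A \<longleftrightarrow> active_dirs c p = {}"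
    using dom_subset assms unfolding corner_interior_def corner_boundary_def by blast
  also have "\<dots> \<longleftrightarrow> (\<forall>b\<in>chart_dirs c. 0 < chart_map c p \<bullet> b)"
    using img_corner[OF assms] unfolding active_dirs_def model_corner_def by (auto simp: less_le)
  finally show ?thesis .
qed

lemma depth_iff:
  assumes "c \<in> A" "p \<in> chart_dom c"
  shows "p \<in> depth_stratum A k \<longleftrightarrow> card (active_dirs c p) = k"
proof
  assume "p \<in> depth_stratum A k"
  then obtain d where d: "d \<in> A" "p \<in> chart_dom d" "card (active_dirs d p) = k"
    unfolding depth_stratum_def by blast
  show "card (active_dirs c p) = k" using card_active_dirs[OF assms(1) d(1) assms(2) d(2)] d(3) by simp
next
  assume "card (active_dirs c p) = k"
  then show "p \<in> depth_stratum A k" unfolding depth_stratum_def using assms by blast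
qed

end

section \<open>Piecewise smooth curves and conformal length metrics\<close>

text \<open>The partitions of \<open>piecewise_C1_curve\<close>, built from the left without indices
  and over any interval, which suits induction, gluing and reparametrization.\<close>

inductive pwC1 :: "('a, 'e::euclidean_space) chart set \<Rightarrow> (real \<Rightarrow> 'a) \<Rightarrow> real \<Rightarrow> real \<Rightarrow> bool"
  for A \<gamma> where
  single: "a < b \<Longrightarrow> C1_curve_on A {a..b} \<gamma> \<Longrightarrow> pwC1 A \<gamma> a b"
| snoc: "pwC1 A \<gamma> a b \<Longrightarrow> b < c \<Longrightarrow> C1_curve_on A {b..c} \<gamma> \<Longrightarrow> pwC1 A \<gamma> a c"

lemma pwC1_less: "pwC1 A \<gamma> a b \<Longrightarrow> a < b"
  by (induction rule: pwC1.induct) auto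

lemma pwC1_append: "pwC1 A \<gamma> b c \<Longrightarrow> pwC1 A \<gamma> a b \<Longrightarrow> pwC1 A \<gamma> a c"
  by (induction rule: pwC1.induct) (auto intro: pwC1.intros)

lemma pwC1_partition_imp:
  "\<forall>i<Suc m. \<tau> i < \<tau> (Suc i) \<and> C1_curve_on A {\<tau> i..\<tau> (Suc i)} \<gamma> \<Longrightarrow> pwC1 A \<gamma> (\<tau> 0) (\<tau> (Suc m))"
proof (induction m)
  case 0
  then show ?case by (auto intro: pwC1.single)
next
  case (Suc m)
  then have "pwC1 A \<gamma> (\<tau> 0) (\<tau> (Suc m))" by auto
  then show ?case using Suc.prems by (auto intro: pwC1.snoc)
qed

lemma pwC1_imp_partition:
  "pwC1 A \<gamma> a b \<Longrightarrow> \<exists>m (\<tau>::nat \<Rightarrow> real). \<tau> 0 = a \<and> \<tau> m = b \<and>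
        (\<forall>i<m. \<tau> i < \<tau> (Suc i) \<and> C1_curve_on A {\<tau> i..\<tau> (Suc i)} \<gamma>)"
proof (induction rule: pwC1.induct)
  case (single a b)
  then show ?case by (intro exI[of _ "Suc 0"] exI[of _ "\<lambda>i. if i = 0 then a else b"]) auto
next
  case (snoc a b c)
  then obtain m and \<tau> :: "nat \<Rightarrow> real" where *: "\<tau> 0 = a" "\<tau> m = b"
    "\<forall>i<m. \<tau> i < \<tau> (Suc i) \<and> C1_curve_on A {\<tau> i..\<tau> (Suc i)} \<gamma>" by blast
  show ?case
  proof (intro exI[of _ "Suc m"] exI[of _ "\<tau>(Suc m := c)"] conjI allI impI)
    fix i assume i: "i < Suc m"
    show "(\<tau>(Suc m := c)) i < (\<tau>(Suc m := c)) (Suc i)"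
      using * snoc.hyps i by (cases "i = m") auto
    show "C1_curve_on A {(\<tau>(Suc m := c)) i..(\<tau>(Suc m := c)) (Suc i)} \<gamma>"
      using * snoc.hyps i by (cases "i = m") auto
  qed (use * in auto)
qed

lemma piecewise_C1_curve_iff:
  "piecewise_C1_curve X A \<gamma> \<longleftrightarrow> continuous_map (top_of_set {0..1}) X \<gamma> \<and> pwC1 A \<gamma> 0 1"
proof
  assume *: "piecewise_C1_curve X A \<gamma>"
  then obtain m and \<tau> :: "nat \<Rightarrow> real" where \<tau>: "\<tau> 0 = 0" "\<tau> m = 1"
    "\<forall>i<m. \<tau> i < \<tau> (Suc i) \<and> C1_curve_on A {\<tau> i..\<tau> (Suc i)} \<gamma>"
    unfolding piecewise_C1_curve_def by blast
  \<comment> \<open>\<open>m = 0\<close> would give \<open>0 = 1\<close>, so the partition has at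
    least one piece.\<close>
  then obtain k where "m = Suc k" by (cases m) auto
  then have "pwC1 A \<gamma> 0 1" using pwC1_partition_imp[of k \<tau> A \<gamma>] \<tau> by simp
  then show "continuous_map (top_of_set {0..1}) X \<gamma> \<and> pwC1 A \<gamma> 0 1"
    using * unfolding piecewise_C1_curve_def by blast
next
  assume "continuous_map (top_of_set {0..1}) X \<gamma> \<and> pwC1 A \<gamma> 0 1"
  then show "piecewise_C1_curve X A \<gamma>"
    unfolding piecewise_C1_curve_def using pwC1_imp_partition by blast
qed

lemma C1_curve_onI:
  assumes "\<And>c T. c \<in> A \<Longrightarrow> T = {t \<in> J. \<gamma> t \<in> chart_dom c} \<Longrightarrow>
    \<exists>D. (\<forall>t\<in>T. ((chart_map c \<circ> \<gamma>) has_vector_derivative D t) (at t within T)) \<and> continuous_on T D"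
  shows "C1_curve_on A J \<gamma>"
  unfolding C1_curve_on_def Let_def using assms by blast

lemma C1_curve_on_cong:
  assumes "C1_curve_on A J \<gamma>" "\<And>t. t \<in> J \<Longrightarrow> \<gamma>' t = \<gamma> t"
  shows "C1_curve_on A J \<gamma>'"
proof (rule C1_curve_onI)
  fix c T assume "c \<in> A" and "T = {t \<in> J. \<gamma>' t \<in> chart_dom c}"
  then have T_def: "T = {t \<in> J. \<gamma> t \<in> chart_dom c}" using assms(2) by auto
  obtain D where D: "\<forall>t\<in>T. ((chart_map c \<circ> \<gamma>) has_vector_derivative D t) (at t within T)" "continuous_on T D"
    using assms(1) \<open>c \<in> A\<close> unfolding C1_curve_on_def Let_def T_def by blast
  have "((chart_map c \<circ> \<gamma>') has_vector_derivative D t) (at t within T)" if "t \<in> T" for t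
    by (rule has_vector_derivative_transform[OF that _ D(1)[rule_format, OF that]])
      (simp add: assms(2) T_def)
  then show "\<exists>D. (\<forall>t\<in>T. ((chart_map c \<circ> \<gamma>') has_vector_derivative D t) (at t within T)) \<and> continuous_on T D"
    using D(2) by blast
qed

lemma C1_curve_on_affine:
  assumes "C1_curve_on A J \<gamma>" "\<And>t. t \<in> J' \<Longrightarrow> k * t + m \<in> J"
  shows "C1_curve_on A J' (\<lambda>t. \<gamma> (k * t + m))"
proof (rule C1_curve_onI)
  fix c T' assume "c \<in> A" and T'_def: "T' = {t \<in> J'. \<gamma> (k * t + m) \<in> chart_dom c}"
  define T where "T = {t \<in> J. \<gamma> t \<in> chart_dom c}"
  obtain D where D: "\<forall>t\<in>T. ((chart_map c \<circ> \<gamma>) has_vector_derivative D t) (at t within T)" "continuous_on T D"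
    using assms(1) \<open>c \<in> A\<close> unfolding C1_curve_on_def Let_def T_def by blast
  have sub: "(\<lambda>t. k * t + m) ` T' \<subseteq> T" using assms(2) unfolding T_def T'_def by auto
  have "((chart_map c \<circ> (\<lambda>t. \<gamma> (k * t + m))) has_vector_derivative k *\<^sub>R D (k * t + m)) (at t within T')"
    if "t \<in> T'" for t
  proof -
    have "((\<lambda>t. k * t + m) has_vector_derivative k) (at t within T')"
      unfolding has_vector_derivative_def by (auto intro!: derivative_eq_intros)
    moreover have "((chart_map c \<circ> \<gamma>) has_vector_derivative D (k * t + m))
        (at (k * t + m) within (\<lambda>t. k * t + m) ` T')"
    proof (rule has_vector_derivative_within_subset[OF _ sub])
      have "k * t + m \<in> T" using sub that by blast
      then show "(chart_map c \<circ> \<gamma> has_vector_derivative D (k * t + m)) (at (k * t + m) within T)"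
        using D(1) by blast
    qed
    ultimately have "(((chart_map c \<circ> \<gamma>) \<circ> (\<lambda>t. k * t + m)) has_vector_derivative k *\<^sub>R D (k * t + m))
        (at t within T')"
      by (rule vector_diff_chain_within)
    then show ?thesis by (simp add: comp_def)
  qed
  moreover have "continuous_on T' (\<lambda>t. k *\<^sub>R D (k * t + m))"
    by (intro continuous_intros continuous_on_compose2[OF D(2)] sub)
  ultimately show "\<exists>D. (\<forall>t\<in>T'. ((chart_map c \<circ> (\<lambda>t. \<gamma> (k * t + m))) has_vector_derivative D t) (at t within T')) \<and>
      continuous_on T' D"
    by (intro exI[of _ "\<lambda>t. k *\<^sub>R D (k * t + m)"]) blast
qed

lemma pwC1_cong:
  "pwC1 A \<gamma> a b \<Longrightarrow> (\<And>t. t \<in> {a..b} \<Longrightarrow> \<gamma>' t = \<gamma> t) \<Longrightarrow> pwC1 A \<gamma>' a b"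
proof (induction rule: pwC1.induct)
  case (single a b)
  then show ?case by (auto intro!: pwC1.single intro: C1_curve_on_cong)
next
  case (snoc a b c)
  note ab = pwC1_less[OF snoc.hyps(1)]
  have "pwC1 A \<gamma>' a b" using snoc.IH snoc.prems snoc.hyps(2) by auto
  moreover have "C1_curve_on A {b..c} \<gamma>'"
    by (rule C1_curve_on_cong[OF snoc.hyps(3)]) (use snoc.prems ab in auto)
  ultimately show ?case using snoc.hyps(2) by (auto intro: pwC1.snoc)
qed

lemma C1_curve_on_affine_interval:
  assumes "C1_curve_on A {a..b} \<gamma>" "0 < k"
  shows "C1_curve_on A {(a - m) / k..(b - m) / k} (\<lambda>t. \<gamma> (k * t + m))"
proof (rule C1_curve_on_affine[OF assms(1)])
  fix t assume "t \<in> {(a - m) / k..(b - m) / k}"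
  then have "a - m \<le> t * k" "t * k \<le> b - m"
    using assms(2) by (simp_all add: pos_divide_le_eq pos_le_divide_eq)
  then show "k * t + m \<in> {a..b}" by (simp add: mult.commute)
qed

lemma pwC1_affine:
  "pwC1 A \<gamma> a b \<Longrightarrow> k > 0 \<Longrightarrow> pwC1 A (\<lambda>t. \<gamma> (k * t + m)) ((a - m) / k) ((b - m) / k)"
proof (induction rule: pwC1.induct)
  case (single a b)
  then show ?case
    by (intro pwC1.single C1_curve_on_affine_interval) (auto simp: divide_strict_right_mono)
next
  case (snoc a b c)
  show ?case
  proof (rule pwC1.snoc)
    show "pwC1 A (\<lambda>t. \<gamma> (k * t + m)) ((a - m) / k) ((b - m) / k)" using snoc by blast
    show "(b - m) / k < (c - m) / k" using snoc.hyps(2) snoc.prems by (simp add: divide_strict_right_mono)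
    show "C1_curve_on A {(b - m) / k..(c - m) / k} (\<lambda>t. \<gamma> (k * t + m))"
      using C1_curve_on_affine_interval[OF snoc.hyps(3) snoc.prems] .
  qed
qed

lemma pwC1_reflect:
  "pwC1 A \<gamma> a b \<Longrightarrow> pwC1 A (\<lambda>t. \<gamma> (- t)) (- b) (- a)"
proof (induction rule: pwC1.induct)
  case (single a b)
  then show ?case
    using C1_curve_on_affine[of A "{a..b}" \<gamma> "{-b..-a}" "-1" 0] by (auto intro: pwC1.single)
next
  case (snoc a b c)
  have "pwC1 A (\<lambda>t. \<gamma> (- t)) (- c) (- b)"
    using C1_curve_on_affine[of A "{b..c}" \<gamma> "{-c..-b}" "-1" 0] snoc.hyps by (auto intro: pwC1.single)
  then show ?case using pwC1_append snoc.IH by blast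
qed

lemma less_add_ennreal:
  assumes "x < top" "0 < e" shows "x < x + ennreal e"
proof -
  obtain r where r: "x = ennreal r" "0 \<le> r" using assms(1) by (cases x rule: ennreal_cases) auto
  have "ennreal r < ennreal (r + e)" using r(2) assms(2) by (simp add: ennreal_less_iff)
  then show ?thesis using r assms(2) by (simp add: ennreal_plus)
qed

text \<open>Unlike \<open>curve_speed\<close>, this takes the two-sided derivative, so it depends
  only on the germ of the curve and not on the parameter interval. The two agree inside
  \<open>{0<..<1}\<close>.\<close>

definition local_speed ::
  "('a, 'e::euclidean_space) chart set \<Rightarrow> ('a, 'e) metric_tensor \<Rightarrow> (real \<Rightarrow> 'a) \<Rightarrow> real \<Rightarrow> real" where
  "local_speed A g \<gamma> t =
     (let c = chart_at A (\<gamma> t); v = vector_derivative (chart_map c \<circ> \<gamma>) (at t)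
      in sqrt (g c (\<gamma> t) v v))"

lemma local_speed_cong:
  fixes A :: "('a, 'b::euclidean_space) chart set"
  assumes "open U" "t \<in> U" "\<And>s. s \<in> U \<Longrightarrow> \<gamma> s = \<gamma>' s"
  shows "local_speed A g \<gamma> t = local_speed A g \<gamma>' t"
proof -
  have "(f \<circ> \<gamma> has_vector_derivative v) (at t) \<longleftrightarrow> (f \<circ> \<gamma>' has_vector_derivative v) (at t)"
    for f :: "'a \<Rightarrow> 'b" and v
    using has_vector_derivative_transform_within_open[of "f \<circ> \<gamma>" v t U "f \<circ> \<gamma>'"]
      has_vector_derivative_transform_within_open[of "f \<circ> \<gamma>'" v t U "f \<circ> \<gamma>"] assms by auto
  then have "vector_derivative (f \<circ> \<gamma>) (at t) = vector_derivative (f \<circ> \<gamma>') (at t)" for f :: "'a \<Rightarrow> 'b"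
    unfolding vector_derivative_def by (simp only:)
  then show ?thesis using assms unfolding local_speed_def by simp
qed

context corner_manifold
begin

text \<open>Chart domains are open, so near an interior parameter the curve stays in the chart and
  the derivative within the restricted set is an ordinary one.\<close>

lemma C1_curve_on_derivative:
  assumes "C1_curve_on A {a..b} \<gamma>" "curve {a..b} \<gamma>" "c \<in> A"
    "t \<in> {a<..<b}" "\<gamma> t \<in> chart_dom c"
    and D: "((chart_map c \<circ> \<gamma>) has_vector_derivative v) (at t within {t \<in> {a..b}. \<gamma> t \<in> chart_dom c})"
  shows "((chart_map c \<circ> \<gamma>) has_vector_derivative v) (at t)"
proof -
  obtain e where e: "e > 0" "\<forall>s\<in>{a..b}. dist s t < e \<longrightarrow> \<gamma> s \<in> chart_dom c"
    using curve_nbhd[OF assms(2) openin_dom[OF assms(3)] _ assms(5)] assms(4)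
    by (meson atLeastAtMost_iff greaterThanLessThan_iff less_imp_le)
  define U where "U = ball t e \<inter> {a<..<b}"
  have U: "open U" "t \<in> U" using e assms(4) unfolding U_def by auto
  have "U \<subseteq> {t \<in> {a..b}. \<gamma> t \<in> chart_dom c}" using e(2) unfolding U_def by (auto simp: dist_commute)
  from has_vector_derivative_within_subset[OF D this]
  show ?thesis using at_within_open[OF U(2,1)] by simp
qed

text \<open>The exceptional set collects the inner break points of the partition. Being finite, it
  does not affect the integrals below.\<close>

lemma pwC1_differentiable:
  "pwC1 A \<gamma> a b \<Longrightarrow> curve {a..b} \<gamma> \<Longrightarrow>
   \<exists>B. finite B \<and> (\<forall>t\<in>{a<..<b} - B. \<forall>c\<in>A. \<gamma> t \<in> chart_dom c \<longrightarrow>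
      (\<exists>v. ((chart_map c \<circ> \<gamma>) has_vector_derivative v) (at t)))"
proof (induction rule: pwC1.induct)
  case (single a b)
  show ?case
  proof (intro exI[of _ "{}"] conjI ballI impI)
    fix t c assume t: "t \<in> {a<..<b} - {}" and c: "c \<in> A" "\<gamma> t \<in> chart_dom c"
    then obtain v where v: "((chart_map c \<circ> \<gamma>) has_vector_derivative v) (at t within {t \<in> {a..b}. \<gamma> t \<in> chart_dom c})"
      using single(2) unfolding C1_curve_on_def Let_def by fastforce
    show "\<exists>v. (chart_map c \<circ> \<gamma> has_vector_derivative v) (at t)"
      using C1_curve_on_derivative[OF single(2,3) c(1) _ c(2) v] t by blast
  qed simp
next
  case (snoc a b c)
  note ab = pwC1_less[OF snoc.hyps(1)]
  have "curve {a..b} \<gamma>"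
    by (rule continuous_map_from_subtopology_mono[OF snoc.prems]) (use snoc.hyps in auto)
  then obtain B where B: "finite B" "\<forall>t\<in>{a<..<b} - B. \<forall>c\<in>A. \<gamma> t \<in> chart_dom c \<longrightarrow>
      (\<exists>v. ((chart_map c \<circ> \<gamma>) has_vector_derivative v) (at t))" using snoc.IH by blast
  have cont: "curve {b..c} \<gamma>"
    by (rule continuous_map_from_subtopology_mono[OF snoc.prems]) (use ab in auto)
  show ?case
  proof (intro exI[of _ "insert b B"] conjI ballI impI)
    fix t d assume t: "t \<in> {a<..<c} - insert b B" and d: "d \<in> A" "\<gamma> t \<in> chart_dom d"
    show "\<exists>v. (chart_map d \<circ> \<gamma> has_vector_derivative v) (at t)"
    proof (cases "t < b")
      case True
      then show ?thesis using B(2) t d by auto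
    next
      case False
      then have t': "t \<in> {b<..<c}" using t by auto
      then obtain v where v: "((chart_map d \<circ> \<gamma>) has_vector_derivative v) (at t within {t \<in> {b..c}. \<gamma> t \<in> chart_dom d})"
        using snoc.hyps(3) d unfolding C1_curve_on_def Let_def by fastforce
      show ?thesis
        using C1_curve_on_derivative[OF snoc.hyps(3) cont d(1) t' d(2) v] by blast
    qed
  qed (use B in simp)
qed

end

text \<open>Used twice: with the singular weight on the interior of X, and with weight 1 on the open
  face. All length estimates are thus proved once for both distances.\<close>

locale corner_weighted = corner_riemannian X A g
  for X :: "'a topology" and A :: "('a, 'e::euclidean_space) chart set" and g +
  fixes w :: "'a \<Rightarrow> real" and S :: "'a set"
  assumes S_sub: "S \<subseteq> topspace X"
    and w_cont: "continuous_map (subtopology X S) euclideanreal w"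
    and w_nonneg: "q \<in> S \<Longrightarrow> 0 \<le> w q"
begin

definition G :: "('a, 'e) metric_tensor" where
  "G c p v u = w p * g c p v u"

abbreviation speed :: "(real \<Rightarrow> 'a) \<Rightarrow> real \<Rightarrow> real" where "speed \<equiv> local_speed A G"

text \<open>\<open>local_speed\<close> refers to an arbitrarily selected chart. The chain rule and
  the transformation law of the metric allow any chart around \<open>\<gamma> t\<close> to replace
  it.\<close>

lemma local_speed_eq:
  assumes cont: "curve {a..b} \<gamma>" and t: "t \<in> {a<..<b}"
    and c: "c \<in> A" "\<gamma> t \<in> chart_dom c"
    and v: "((chart_map c \<circ> \<gamma>) has_vector_derivative v) (at t)"
  shows "speed \<gamma> t = sqrt (w (\<gamma> t) * g c (\<gamma> t) v v)"
proof -
  define d where "d = chart_at A (\<gamma> t)"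
  have d: "d \<in> A" "\<gamma> t \<in> chart_dom d"
    using chart_at dom_subset c unfolding d_def by blast+
  obtain D where D: "((chart_map d \<circ> chart_inv c) has_derivative D)
          (at (chart_map c (\<gamma> t)) within chart_map c ` (chart_dom c \<inter> chart_dom d))"
    "\<And>v u. g c (\<gamma> t) v u = g d (\<gamma> t) (D v) (D u)"
    using transition_derivative[OF c(1) d(1) c(2) d(2)] by metis
  obtain e where e: "e > 0" "\<forall>s\<in>{a..b}. dist s t < e \<longrightarrow> \<gamma> s \<in> chart_dom c \<inter> chart_dom d"
    using curve_nbhd[OF cont openin_Int[OF openin_dom[OF c(1)] openin_dom[OF d(1)]], of t] t c d by auto
  define U where "U = ball t e \<inter> {a<..<b}"
  have U: "open U" "t \<in> U" using e t unfolding U_def by auto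
  have Udom: "\<gamma> s \<in> chart_dom c \<inter> chart_dom d" if "s \<in> U" for s
    using e(2) that unfolding U_def by (auto simp: dist_commute)
  have "((chart_map d \<circ> chart_inv c) has_derivative D) (at ((chart_map c \<circ> \<gamma>) t) within (chart_map c \<circ> \<gamma>) ` U)"
    using has_derivative_subset[OF D(1), of "(chart_map c \<circ> \<gamma>) ` U"] Udom by auto
  moreover have "((chart_map c \<circ> \<gamma>) has_vector_derivative v) (at t within U)"
    using v has_vector_derivative_at_within by blast
  ultimately have "((chart_map d \<circ> chart_inv c) \<circ> (chart_map c \<circ> \<gamma>) has_vector_derivative D v) (at t within U)"
    using vector_derivative_diff_chain_within by blast
  then have "((chart_map d \<circ> chart_inv c) \<circ> (chart_map c \<circ> \<gamma>) has_vector_derivative D v) (at t)"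
    using at_within_open[OF U(2,1)] by simp
  then have "(chart_map d \<circ> \<gamma> has_vector_derivative D v) (at t)"
    by (rule has_vector_derivative_transform_within_open[OF _ U]) (use Udom c(1) in auto)
  then have "vector_derivative (chart_map d \<circ> \<gamma>) (at t) = D v" by (rule vector_derivative_at)
  then show ?thesis unfolding local_speed_def d_def[symmetric] Let_def G_def D(2) by simp
qed

text \<open>The factor \<open>k\<close> may be negative, so this serves both rescaling and
  reversal.\<close>

lemma local_speed_affine:
  assumes cont: "curve {a..b} \<gamma>" and t: "k * t + m \<in> {a<..<b}"
    and cont': "curve {a'..b'} (\<lambda>t. \<gamma> (k * t + m))" and t': "t \<in> {a'<..<b'}"
    and c: "c \<in> A" "\<gamma> (k * t + m) \<in> chart_dom c"
    and v: "((chart_map c \<circ> \<gamma>) has_vector_derivative v) (at (k * t + m))"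
  shows "speed (\<lambda>t. \<gamma> (k * t + m)) t = \<bar>k\<bar> * speed \<gamma> (k * t + m)"
proof -
  have "((\<lambda>t. k * t + m) has_vector_derivative k) (at t)"
    unfolding has_vector_derivative_def by (auto intro!: derivative_eq_intros)
  then have "((chart_map c \<circ> \<gamma>) \<circ> (\<lambda>t. k * t + m) has_vector_derivative k *\<^sub>R v) (at t)"
    using v by (rule vector_diff_chain_at)
  then have v': "(chart_map c \<circ> (\<lambda>t. \<gamma> (k * t + m)) has_vector_derivative k *\<^sub>R v) (at t)" by (simp add: comp_def)
  have "speed (\<lambda>t. \<gamma> (k * t + m)) t = sqrt (k\<^sup>2 * (w (\<gamma> (k * t + m)) * g c (\<gamma> (k * t + m)) v v))"
    unfolding local_speed_eq[OF cont' t' c v'] metric_scale[OF c] by (simp add: mult_ac)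
  then show ?thesis unfolding local_speed_eq[OF cont t c v] by (simp add: real_sqrt_mult)
qed

lemma local_speed_nonneg:
  assumes "\<gamma> t \<in> S" shows "0 \<le> speed \<gamma> t"
proof -
  have "chart_at A (\<gamma> t) \<in> A" "\<gamma> t \<in> chart_dom (chart_at A (\<gamma> t))"
    using chart_at S_sub assms by blast+
  then show ?thesis unfolding local_speed_def Let_def G_def
    using metric_nonneg w_nonneg[OF assms] by simp
qed

text \<open>One chart need not contain the curve, but integrability is local. On a short subinterval
  a chart applies, and there the speed equals a continuous function off the end points.\<close>

lemma C1_speed_integrable:
  assumes C1: "C1_curve_on A {a..b} \<gamma>" and cont: "curve {a..b} \<gamma>"
    and S: "\<gamma> ` {a..b} \<subseteq> S"
  shows "speed \<gamma> integrable_on {a..b}"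
proof -
  have "speed \<gamma> integrable_on cbox a b"
  proof (rule integrable_on_little_subintervals, intro ballI)
    fix x assume "x \<in> cbox a b"
    then have x: "x \<in> {a..b}" by simp
    then have "\<gamma> x \<in> topspace X" using S S_sub by blast
    then obtain c where c: "c \<in> A" "\<gamma> x \<in> chart_dom c" using ex_chart by blast
    define T where "T = {t \<in> {a..b}. \<gamma> t \<in> chart_dom c}"
    obtain D where D: "\<forall>t\<in>T. ((chart_map c \<circ> \<gamma>) has_vector_derivative D t) (at t within T)" "continuous_on T D"
      using C1 c(1) unfolding C1_curve_on_def Let_def T_def by blast
    obtain e where e: "e > 0" "\<forall>s\<in>{a..b}. dist s x < e \<longrightarrow> \<gamma> s \<in> chart_dom c"
      using curve_nbhd[OF cont openin_dom[OF c(1)] x c(2)] by blast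
    show "\<exists>d>0. \<forall>u v. x \<in> cbox u v \<and> cbox u v \<subseteq> ball x d \<and> cbox u v \<subseteq> cbox a b \<longrightarrow>
        speed \<gamma> integrable_on cbox u v"
    proof (intro exI[of _ e] conjI allI impI, rule e(1))
      fix u v assume uv: "x \<in> cbox u v \<and> cbox u v \<subseteq> ball x e \<and> cbox u v \<subseteq> cbox a b"
      then have sub: "{u..v} \<subseteq> {a..b}" and uv': "u \<le> v" by auto
      have T: "{u..v} \<subseteq> T" unfolding T_def using uv e(2) by (auto simp: subset_iff dist_commute)
      then have dom: "\<gamma> ` {u..v} \<subseteq> chart_dom c" unfolding T_def by blast
      define k where "k = (\<lambda>t. sqrt (w (\<gamma> t) * g c (\<gamma> t) (D t) (D t)))"
      have "continuous_on {u..v} (\<lambda>t. w (\<gamma> t))"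
      proof -
        have "continuous_map (top_of_set {u..v}) (subtopology X S) \<gamma>"
          using continuous_map_from_subtopology_mono[OF cont sub] S sub
          by (auto simp: continuous_map_in_subtopology)
        from continuous_map_compose[OF this w_cont] show ?thesis by (simp add: comp_def)
      qed
      moreover have "continuous_on {u..v} (\<lambda>t. g c (\<gamma> t) i j)" for i j
      proof -
        have "continuous_on (img c) (\<lambda>x. g c (chart_inv c x) i j)"
          using smooth_map_on_continuous metric_smooth[OF c(1)] by blast
        then have "continuous_on {u..v} (\<lambda>t. g c (chart_inv c ((chart_map c \<circ> \<gamma>) t)) i j)"
          by (rule continuous_on_compose2[OF _ curve_continuous[OF c(1) cont sub dom]]) (use dom in auto)
        then show ?thesis
          by (rule continuous_on_eq) (use dom c(1) in \<open>auto simp: image_subset_iff\<close>)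
      qed
      moreover have "continuous_on {u..v} D" using D(2) T continuous_on_subset by blast
      ultimately have "continuous_on {u..v} (\<lambda>t. sqrt (w (\<gamma> t) *
          (\<Sum>(i,j)\<in>Basis \<times> Basis. (D t \<bullet> i) * (D t \<bullet> j) * g c (\<gamma> t) i j)))"
        unfolding split_def by (intro continuous_intros)
      then have "continuous_on {u..v} k" unfolding k_def
        by (rule continuous_on_eq) (use dom c(1) metric_expand in \<open>auto simp: image_subset_iff\<close>)
      then have "k integrable_on {u..v}" by (rule integrable_continuous_real)
      \<comment> \<open>\<open>u\<close> and \<open>v\<close> are left out because they may be ends
        of \<open>{a..b}\<close>, where only one-sided derivatives are known.\<close>
      moreover have "speed \<gamma> t = k t" if t: "t \<in> {u..v} - {u, v}" for t
      proof -
        have t': "t \<in> {a<..<b}" "\<gamma> t \<in> chart_dom c" "t \<in> T" using t sub dom T uv' by (auto simp: image_subset_iff)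
        have "((chart_map c \<circ> \<gamma>) has_vector_derivative D t) (at t)"
          using C1_curve_on_derivative[OF C1 cont c(1) t'(1,2)] D(1) t'(3) unfolding T_def by blast
        from local_speed_eq[OF cont t'(1) c(1) t'(2) this] show ?thesis unfolding k_def .
      qed
      ultimately have "speed \<gamma> integrable_on {u..v}"
        using integrable_spike_finite[of "{u, v}" "{u..v}"] by blast
      then show "speed \<gamma> integrable_on cbox u v" by simp
    qed
  qed
  then show ?thesis by simp
qed

lemma pwC1_speed_integrable:
  "pwC1 A \<gamma> a b \<Longrightarrow> curve {a..b} \<gamma> \<Longrightarrow> \<gamma> ` {a..b} \<subseteq> S
    \<Longrightarrow> speed \<gamma> integrable_on {a..b}"
proof (induction rule: pwC1.induct)
  case (single a b)
  then show ?case using C1_speed_integrable by blast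
next
  case (snoc a b c)
  note ab = pwC1_less[OF snoc.hyps(1)]
  have sub: "{a..b} \<subseteq> {a..c}" "{b..c} \<subseteq> {a..c}" using ab snoc.hyps(2) by auto
  have "speed \<gamma> integrable_on {a..b}"
    using snoc.IH continuous_map_from_subtopology_mono[OF snoc.prems(1) sub(1)] snoc.prems(2) sub(1) by blast
  moreover have "speed \<gamma> integrable_on {b..c}"
    using C1_speed_integrable[OF snoc.hyps(3) continuous_map_from_subtopology_mono[OF snoc.prems(1) sub(2)]]
      snoc.prems(2) sub(2) by blast
  ultimately show ?case
    using Henstock_Kurzweil_Integration.integrable_combine[of a b c "speed \<gamma>"] ab snoc.hyps(2) by simp
qed

text \<open>The length is carried along as a parameter, together with an arbitrary parameter
  interval, so that curves can be rescaled, reversed and glued before returning to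
  \<open>{0..1}\<close>.\<close>

definition admissible :: "(real \<Rightarrow> 'a) \<Rightarrow> real \<Rightarrow> real \<Rightarrow> real \<Rightarrow> bool" where
  "admissible \<gamma> a b L \<longleftrightarrow> curve {a..b} \<gamma> \<and> pwC1 A \<gamma> a b \<and> \<gamma> ` {a..b} \<subseteq> S
     \<and> (speed \<gamma> has_integral L) {a..b}"

definition dst :: "'a \<Rightarrow> 'a \<Rightarrow> ennreal" where
  "dst = riemannian_dist X A G S"

lemma admissible_less: "admissible \<gamma> a b L \<Longrightarrow> a < b"
  unfolding admissible_def using pwC1_less by blast

text \<open>\<open>curve_speed\<close> and \<open>local_speed\<close> can differ only at the two end
  points, and piecewise curves always have an integrable speed.\<close>

lemma admissible_curve:
  "piecewise_C1_curve X A \<gamma> \<and> \<gamma> ` {0..1} \<subseteq> S \<longleftrightarrow> admissible \<gamma> 0 1 (curve_length A G \<gamma>)"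
proof -
  have "curve_length A G \<gamma> = integral {0..1} (speed \<gamma>)"
    unfolding curve_length_def
  proof (rule integral_spike[of "{0, 1}"])
    fix t :: real assume "t \<in> {0..1} - {0, 1}"
    then have "0 < t" "t < 1" by auto
    then have at: "at t within {0..1} = at t" by (rule at_within_Icc_at)
    show "speed \<gamma> t = curve_speed A G \<gamma> t"
      unfolding local_speed_def curve_speed_def at ..
  qed simp
  then show ?thesis
    unfolding piecewise_C1_curve_iff admissible_def
    using pwC1_speed_integrable[of \<gamma> 0 1] integrable_integral[of "speed \<gamma>" "{0..1}"] by auto
qed

text \<open>The strict form of the infimum: near-optimal curves can be extracted from it, and it
  remains correct when no curve joins the points.\<close>

lemma dst_less_iff: "dst p q < x \<longleftrightarrow> (\<exists>\<gamma> L. admissible \<gamma> 0 1 L \<and> \<gamma> 0 = p \<and> \<gamma> 1 = q \<and> ennreal L < x)"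
proof -
  have "L = curve_length A G \<gamma>" if "admissible \<gamma> 0 1 L" for \<gamma> L
  proof -
    have "admissible \<gamma> 0 1 (curve_length A G \<gamma>)"
      using that admissible_curve piecewise_C1_curve_iff unfolding admissible_def by blast
    then show ?thesis using that has_integral_unique unfolding admissible_def by blast
  qed
  then show ?thesis unfolding dst_def riemannian_dist_def INF_less_iff
    using admissible_curve by blast
qed

text \<open>The factor \<open>k\<close> in the speed cancels the \<open>1 / k\<close> from the
  change of variables. Break points and end points form a finite set, which is discarded.\<close>

lemma admissible_affine:
  assumes "admissible \<gamma> a b L" "k > 0"
  shows "admissible (\<lambda>t. \<gamma> (k * t + m)) ((a - m) / k) ((b - m) / k) L"
proof -
  define J where "J = {(a - m) / k..(b - m) / k}"
  have cont: "curve {a..b} \<gamma>" and pw: "pwC1 A \<gamma> a b" and S: "\<gamma> ` {a..b} \<subseteq> S"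
    and L: "(speed \<gamma> has_integral L) {a..b}" using assms unfolding admissible_def by auto
  have le: "(x - m) / k \<le> t \<longleftrightarrow> x \<le> k * t + m" "t \<le> (x - m) / k \<longleftrightarrow> k * t + m \<le> x" for x t
    using assms(2) by (auto simp: pos_divide_le_eq pos_le_divide_eq mult.commute)
  have J: "t \<in> J \<longleftrightarrow> k * t + m \<in> {a..b}" for t unfolding J_def by (simp add: le)
  have cont': "curve J (\<lambda>t. \<gamma> (k * t + m))"
  proof -
    have "continuous_map (top_of_set J) (top_of_set {a..b}) (\<lambda>t. k * t + m)"
      unfolding continuous_map_in_subtopology using J by (auto intro!: continuous_intros)
    from continuous_map_compose[OF this cont] show ?thesis by (simp add: comp_def)
  qed
  obtain B where B: "finite B" "\<forall>t\<in>{a<..<b} - B. \<forall>c\<in>A. \<gamma> t \<in> chart_dom c \<longrightarrow>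
      (\<exists>v. ((chart_map c \<circ> \<gamma>) has_vector_derivative v) (at t))"
    using pwC1_differentiable[OF pw cont] by blast
  have "((\<lambda>t. speed \<gamma> (k * t + m)) has_integral L / k) J"
    using has_integral_affinity'[of "speed \<gamma>" L a b k m] L assms(2)
    unfolding J_def by (simp add: divide_inverse mult.commute)
  then have "((\<lambda>t. k * speed \<gamma> (k * t + m)) has_integral k * (L / k)) J"
    by (rule has_integral_mult_right)
  then have int: "((\<lambda>t. k * speed \<gamma> (k * t + m)) has_integral L) J" using assms(2) by simp
  have "(speed (\<lambda>t. \<gamma> (k * t + m)) has_integral L) J"
  proof (rule has_integral_spike_finite[OF _ _ int])
    show "finite ((\<lambda>t. k * t + m) -` (B \<union> {a, b}))"
      by (rule finite_vimageI) (use B assms(2) in \<open>auto simp: inj_on_def\<close>)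
    fix t assume t: "t \<in> J - (\<lambda>t. k * t + m) -` (B \<union> {a, b})"
    then have t1: "k * t + m \<in> {a<..<b} - B" using J by force
    then have t2: "t \<in> {(a - m) / k<..<(b - m) / k}"
      by (simp add: not_le[symmetric] le)
    have "\<gamma> (k * t + m) \<in> topspace X" using S_sub S t1 by (auto simp: image_subset_iff)
    then obtain c where c: "c \<in> A" "\<gamma> (k * t + m) \<in> chart_dom c" using ex_chart by blast
    then obtain v where v: "((chart_map c \<circ> \<gamma>) has_vector_derivative v) (at (k * t + m))" using B(2) t1 by blast
    show "speed (\<lambda>t. \<gamma> (k * t + m)) t = k * speed \<gamma> (k * t + m)"
      using local_speed_affine[OF cont _ cont'[unfolded J_def] t2 c v] t1 assms(2) by simp
  qed
  moreover have "(\<lambda>t. \<gamma> (k * t + m)) ` J \<subseteq> S" using S J by (auto simp: image_subset_iff)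
  ultimately show ?thesis unfolding admissible_def J_def[symmetric]
    using cont' pwC1_affine[OF pw assms(2)] by blast
qed

lemma admissible_reflect:
  assumes "admissible \<gamma> a b L"
  shows "admissible (\<lambda>t. \<gamma> (- t)) (- b) (- a) L"
proof -
  have cont: "curve {a..b} \<gamma>" and pw: "pwC1 A \<gamma> a b" and S: "\<gamma> ` {a..b} \<subseteq> S"
    and L: "(speed \<gamma> has_integral L) {a..b}" using assms unfolding admissible_def by auto
  have cont': "curve {-b..-a} (\<lambda>t. \<gamma> (- t))"
  proof -
    have "continuous_map (top_of_set {-b..-a}) (top_of_set {a..b}) uminus"
      unfolding continuous_map_in_subtopology by (auto intro!: continuous_intros)
    from continuous_map_compose[OF this cont] show ?thesis by (simp add: comp_def)
  qed
  obtain B where B: "finite B" "\<forall>t\<in>{a<..<b} - B. \<forall>c\<in>A. \<gamma> t \<in> chart_dom c \<longrightarrow>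
      (\<exists>v. ((chart_map c \<circ> \<gamma>) has_vector_derivative v) (at t))"
    using pwC1_differentiable[OF pw cont] by blast
  have int: "((\<lambda>t. speed \<gamma> (- t)) has_integral L) {-b..-a}" using L by simp
  have "(speed (\<lambda>t. \<gamma> (- t)) has_integral L) {-b..-a}"
  proof (rule has_integral_spike_finite[OF _ _ int])
    show "finite (uminus ` (B \<union> {a, b}))" using B by simp
    fix t assume t: "t \<in> {-b..-a} - uminus ` (B \<union> {a, b})"
    then have t1: "- t \<in> {a<..<b} - B"
      by (auto simp: image_iff less_le)
    then have t2: "t \<in> {-b<..<-a}" by auto
    have "\<gamma> (- t) \<in> topspace X" using S_sub S t1 by (auto simp: image_subset_iff)
    then obtain c where c: "c \<in> A" "\<gamma> (- t) \<in> chart_dom c" using ex_chart by blast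
    then obtain v where v: "((chart_map c \<circ> \<gamma>) has_vector_derivative v) (at (- t))" using B(2) t1 by blast
    show "speed (\<lambda>t. \<gamma> (- t)) t = speed \<gamma> (- t)"
      using local_speed_affine[of a b \<gamma> "-1" t 0 "-b" "-a" c v] cont cont' t1 t2 c v by simp
  qed
  moreover have "(\<lambda>t. \<gamma> (- t)) ` {-b..-a} \<subseteq> S" using S by (auto simp: image_subset_iff)
  ultimately show ?thesis unfolding admissible_def
    using cont' pwC1_reflect[OF pw] by blast
qed

text \<open>At the junction the two curves agree but their derivatives may not, so the speeds are
  compared only inside the two intervals.\<close>

lemma admissible_join:
  assumes 1: "admissible \<gamma>1 a b L1" and 2: "admissible \<gamma>2 b c L2" and eq: "\<gamma>1 b = \<gamma>2 b"
  shows "admissible (\<lambda>t. if t \<le> b then \<gamma>1 t else \<gamma>2 t) a c (L1 + L2)"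
proof -
  define \<gamma> where "\<gamma> = (\<lambda>t. if t \<le> b then \<gamma>1 t else \<gamma>2 t)"
  have ab: "a < b" and bc: "b < c" using 1 2 admissible_less by blast+
  have \<gamma>2: "\<gamma> t = \<gamma>2 t" if "t \<in> {b..c}" for t using that eq unfolding \<gamma>_def by (cases "t = b") auto
  have \<gamma>1: "\<gamma> t = \<gamma>1 t" if "t \<in> {a..b}" for t using that unfolding \<gamma>_def by auto
  have ac: "{a..c} = {a..b} \<union> {b..c}" using ab bc by auto
  have "curve {a..c} \<gamma>"
    unfolding \<gamma>_def
  proof (rule continuous_map_cases_le)
    have "{x \<in> {a..c}. x \<le> b} = {a..b}" "{x \<in> {a..c}. b \<le> x} = {b..c}" using ab bc by auto
    then show "continuous_map (subtopology (top_of_set {a..c}) {x \<in> topspace (top_of_set {a..c}). x \<le> b}) X \<gamma>1"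
      "continuous_map (subtopology (top_of_set {a..c}) {x \<in> topspace (top_of_set {a..c}). b \<le> x}) X \<gamma>2"
      using 1 2 ac unfolding admissible_def by (auto simp: subtopology_subtopology Int_absorb1)
  qed (use eq in \<open>auto intro!: continuous_intros\<close>)
  moreover have "pwC1 A \<gamma> a c"
  proof (rule pwC1_append)
    show "pwC1 A \<gamma> b c" using pwC1_cong \<gamma>2 2 unfolding admissible_def by blast
    show "pwC1 A \<gamma> a b" using pwC1_cong \<gamma>1 1 unfolding admissible_def by blast
  qed
  moreover have "\<gamma> ` {a..c} \<subseteq> S"
    unfolding ac using \<gamma>1 \<gamma>2 1 2 unfolding admissible_def by (auto simp: image_subset_iff)
  moreover have "(speed \<gamma> has_integral L1 + L2) {a..c}"
  proof (rule has_integral_combine[of a b])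
    have i1: "(speed \<gamma>1 has_integral L1) {a..b}" using 1 unfolding admissible_def by blast
    show "(speed \<gamma> has_integral L1) {a..b}"
    proof (rule has_integral_spike_finite[OF _ _ i1, of "{a, b}"])
      fix t assume "t \<in> {a..b} - {a, b}"
      then show "speed \<gamma> t = speed \<gamma>1 t"
        by (intro local_speed_cong[of "{a<..<b}"]) (auto simp: \<gamma>1)
    qed simp
    have i2: "(speed \<gamma>2 has_integral L2) {b..c}" using 2 unfolding admissible_def by blast
    show "(speed \<gamma> has_integral L2) {b..c}"
    proof (rule has_integral_spike_finite[OF _ _ i2, of "{b, c}"])
      fix t assume "t \<in> {b..c} - {b, c}"
      then show "speed \<gamma> t = speed \<gamma>2 t"
        by (intro local_speed_cong[of "{b<..<c}"]) (auto simp: \<gamma>2)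
    qed simp
  qed (use ab bc in auto)
  ultimately show ?thesis unfolding admissible_def \<gamma>_def[symmetric] by blast
qed

section \<open>The distance as an extended pseudometric\<close>

lemma admissible_nonneg:
  assumes "admissible \<gamma> a b L" shows "0 \<le> L"
  using assms local_speed_nonneg has_integral_nonneg[of "speed \<gamma>" L "{a..b}"]
  unfolding admissible_def by blast

lemma dst_le_admissible:
  assumes "admissible \<gamma> a b L" shows "dst (\<gamma> a) (\<gamma> b) \<le> ennreal L"
proof -
  have ab: "a < b" using admissible_less[OF assms] .
  have "admissible (\<lambda>t. \<gamma> ((b - a) * t + a)) 0 1 L"
    using admissible_affine[OF assms, of "b - a" a] ab by simp
  then have "dst (\<gamma> a) (\<gamma> b) < x" if "ennreal L < x" for x
    using that unfolding dst_less_iff by (intro exI[of _ "\<lambda>t. \<gamma> ((b - a) * t + a)"] exI[of _ L]) auto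
  then show ?thesis using not_le by blast
qed

lemma dst_sym: "dst p q = dst q p"
proof -
  have "dst q p \<le> dst p q" for p q
  proof (rule ccontr)
    assume "\<not> dst q p \<le> dst p q"
    then have "dst p q < dst q p" by simp
    then obtain \<gamma> L where *: "admissible \<gamma> 0 1 L" "\<gamma> 0 = p" "\<gamma> 1 = q" "ennreal L < dst q p"
      using dst_less_iff by blast
    have "dst q p \<le> ennreal L" using dst_le_admissible[OF admissible_reflect[OF *(1)]] *(2,3) by simp
    then show False using *(4) by simp
  qed
  then show ?thesis by (simp add: order_antisym)
qed

lemma dst_triangle: "dst p r \<le> dst p q + dst q r"
proof (rule ennreal_le_epsilon)
  fix e :: real assume fin: "dst p q + dst q r < top" and e: "0 < e"
  have "dst p q < dst p q + ennreal (e/2)" "dst q r < dst q r + ennreal (e/2)"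
    using fin e less_add_ennreal by auto
  then obtain \<gamma>1 L1 \<gamma>2 L2 where 1: "admissible \<gamma>1 0 1 L1" "\<gamma>1 0 = p" "\<gamma>1 1 = q" "ennreal L1 < dst p q + ennreal (e/2)"
    and 2: "admissible \<gamma>2 0 1 L2" "\<gamma>2 0 = q" "\<gamma>2 1 = r" "ennreal L2 < dst q r + ennreal (e/2)"
    unfolding dst_less_iff by blast
  have "admissible (\<lambda>t. \<gamma>2 (t - 1)) 1 2 L2" using admissible_affine[OF 2(1), of 1 "-1"] by simp
  then have "admissible (\<lambda>t. if t \<le> 1 then \<gamma>1 t else \<gamma>2 (t - 1)) 0 2 (L1 + L2)"
    using admissible_join[OF 1(1)] 1(3) 2(2) by simp
  from dst_le_admissible[OF this] have "dst p r \<le> ennreal (L1 + L2)" using 1 2 by simp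
  also have "\<dots> = ennreal L1 + ennreal L2" using admissible_nonneg 1(1) 2(1) by simp
  also have "\<dots> \<le> (dst p q + ennreal (e/2)) + (dst q r + ennreal (e/2))"
    using 1(4) 2(4) by (intro add_mono) auto
  also have "\<dots> = dst p q + dst q r + (ennreal (e/2) + ennreal (e/2))" by (simp add: algebra_simps)
  also have "ennreal (e/2) + ennreal (e/2) = ennreal e" using e by (simp flip: ennreal_plus)
  finally show "dst p r \<le> dst p q + dst q r + ennreal e" .
qed

section \<open>Lower and upper bounds for distances in a chart\<close>

text \<open>The coordinate displacement is the integral of the coordinate velocity, whose norm times
  \<open>\<kappa>\<close> is bounded by the speed. The curve is followed only up to
  \<open>T\<close>, which will be its first exit time.\<close>

lemma admissible_displacement:
  assumes adm: "admissible \<gamma> a b L" and T: "a \<le> T" "T \<le> b"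
    and c: "c \<in> A" and dom: "\<gamma> ` {a..T} \<subseteq> chart_dom c"
    and \<kappa>: "0 \<le> \<kappa>" "\<And>t v. t \<in> {a..T} \<Longrightarrow> \<kappa> * norm v \<le> sqrt (w (\<gamma> t) * g c (\<gamma> t) v v)"
  shows "\<kappa> * norm (chart_map c (\<gamma> T) - chart_map c (\<gamma> a)) \<le> L"
proof -
  have cont: "curve {a..b} \<gamma>" and pw: "pwC1 A \<gamma> a b" and S: "\<gamma> ` {a..b} \<subseteq> S"
    and L: "(speed \<gamma> has_integral L) {a..b}" using adm unfolding admissible_def by auto
  obtain B where B: "finite B" "\<forall>t\<in>{a<..<b} - B. \<forall>c\<in>A. \<gamma> t \<in> chart_dom c \<longrightarrow>
      (\<exists>v. ((chart_map c \<circ> \<gamma>) has_vector_derivative v) (at t))"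
    using pwC1_differentiable[OF pw cont] by blast
  \<comment> \<open>The value 0 at the finitely many bad parameters makes the norm bound below hold
    at every \<open>t\<close>.\<close>
  define f' where "f' = (\<lambda>t. if t \<in> {a<..<T} - B then vector_derivative (chart_map c \<circ> \<gamma>) (at t) else 0)"
  have der: "((chart_map c \<circ> \<gamma>) has_vector_derivative f' t) (at t)" if t: "t \<in> {a<..<T} - B" for t
  proof -
    have "t \<in> {a<..<b} - B" "\<gamma> t \<in> chart_dom c" using t T dom by (auto simp: image_subset_iff)
    then obtain v where "((chart_map c \<circ> \<gamma>) has_vector_derivative v) (at t)" using B(2) c by blast
    then show ?thesis unfolding f'_def using t vector_derivative_at by fastforce
  qed
  have sub: "{a..T} \<subseteq> {a..b}" using T by auto
  have "(f' has_integral ((chart_map c \<circ> \<gamma>) T - (chart_map c \<circ> \<gamma>) a)) {a..T}"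
    using fundamental_theorem_of_calculus_interior_strong[OF B(1) T(1) der] curve_continuous[OF c cont sub dom] by blast
  then have "((\<lambda>t. \<kappa> *\<^sub>R f' t) has_integral \<kappa> *\<^sub>R ((chart_map c \<circ> \<gamma>) T - (chart_map c \<circ> \<gamma>) a)) {a..T}"
    by (rule has_integral_cmul)
  moreover have int: "speed \<gamma> integrable_on {a..T}"
    using integrable_on_subinterval[OF _ sub] L by blast
  moreover have "norm (\<kappa> *\<^sub>R f' t) \<le> speed \<gamma> t" if t: "t \<in> {a..T}" for t
  proof (cases "t \<in> {a<..<T} - B")
    case True
    then have t': "t \<in> {a<..<b}" "\<gamma> t \<in> chart_dom c" using t T dom by (auto simp: image_subset_iff)
    show ?thesis using local_speed_eq[OF cont t'(1) c t'(2) der[OF True]] \<kappa>(2)[OF t] \<kappa>(1) by simp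
  next
    case False
    then have "f' t = 0" unfolding f'_def by (simp only: if_False)
    then show ?thesis using local_speed_nonneg[of \<gamma> t] S sub t by (auto simp: image_subset_iff)
  qed
  ultimately have "norm (\<kappa> *\<^sub>R ((chart_map c \<circ> \<gamma>) T - (chart_map c \<circ> \<gamma>) a)) \<le> integral {a..T} (speed \<gamma>)"
    using Henstock_Kurzweil_Integration.integral_norm_bound_integral[of "\<lambda>t. \<kappa> *\<^sub>R f' t" "{a..T}" "speed \<gamma>"]
    by (metis has_integral_integrable integral_unique)
  also have "\<dots> \<le> integral {a..b} (speed \<gamma>)"
    by (rule integral_subset_le[OF sub int])
      (use L S local_speed_nonneg in \<open>auto simp: image_subset_iff\<close>)
  also have "\<dots> = L" using L by (rule integral_unique)
  finally show ?thesis using \<kappa>(1) by simp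
qed

text \<open>A curve from \<open>q\<close> to \<open>q'\<close> has a first parameter
  \<open>T\<close> outside the open coordinate ball, and up to \<open>T\<close> it has moved by at
  least \<open>s - \<epsilon>\<close> in coordinates. The slack \<open>\<epsilon>\<close> is there
  because the centre \<open>y\<close> may correspond to a boundary point outside \<open>S\<close>,
  where the curve cannot start.\<close>

lemma dst_exit_bound:
  assumes c: "c \<in> A" and y: "cball y s \<inter> corner c \<subseteq> img c"
    and \<kappa>: "0 \<le> \<kappa>" "\<And>q v. q \<in> chart_dom c \<Longrightarrow> q \<in> S \<Longrightarrow> chart_map c q \<in> cball y s
        \<Longrightarrow> \<kappa> * norm v \<le> sqrt (w q * g c q v v)"
    and q: "q \<in> chart_dom c" "dist (chart_map c q) y \<le> \<epsilon>" "\<epsilon> < s"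
    and q': "\<not> (q' \<in> chart_dom c \<and> dist (chart_map c q') y < s)"
  shows "ennreal (\<kappa> * (s - \<epsilon>)) \<le> dst q q'"
proof (rule ccontr)
  assume "\<not> ?thesis"
  then obtain \<gamma> L where adm: "admissible \<gamma> 0 1 L" and ends: "\<gamma> 0 = q" "\<gamma> 1 = q'"
    and less: "ennreal L < ennreal (\<kappa> * (s - \<epsilon>))"
    using dst_less_iff not_le by metis
  have cont: "curve {0..1} \<gamma>" and S: "\<gamma> ` {0..1} \<subseteq> S"
    using adm unfolding admissible_def by auto
  define U where "U = {p \<in> chart_dom c. chart_map c p \<in> ball y s}"
  define C where "C = chart_inv c ` (cball y s \<inter> corner c)"
  have openU: "openin X U" unfolding U_def by (rule openin_chart_vimage[OF c]) simp
  have "compact (cball y s \<inter> corner c)" by (intro compact_Int_closed compact_cball closed_model_corner)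
  then have closedC: "closedin X C" unfolding C_def using closedin_chart_inv[OF c _ y] by blast
  have UC: "U \<subseteq> C"
  proof
    fix p assume "p \<in> U"
    then have "p \<in> chart_dom c" "chart_map c p \<in> cball y s \<inter> corner c"
      using img_corner[OF c] unfolding U_def by auto
    then show "p \<in> C" unfolding C_def using c by force
  qed
  have C: "p \<in> chart_dom c" "chart_map c p \<in> cball y s" if "p \<in> C" for p
    using that y unfolding C_def by (auto simp: subset_iff)
  define Z where "Z = {t \<in> {0..1}. \<gamma> t \<notin> U}"
  have "1 \<in> Z" unfolding Z_def U_def using ends q' by (auto simp: dist_commute)
  moreover have "closed Z"
  proof -
    have "openin (top_of_set {0..1}) {t \<in> {0..1}. \<gamma> t \<in> U}"
      using openin_continuous_map_preimage[OF cont openU] by simp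
    then have "closedin (top_of_set {0..1}) ({0..1} - {t \<in> {0..1}. \<gamma> t \<in> U})"
      using closedin_diff[OF closedin_topspace] by fastforce
    moreover have "{0..1} - {t \<in> {0..1}. \<gamma> t \<in> U} = Z" unfolding Z_def by auto
    ultimately show ?thesis using closedin_closed_trans[of "{0..1}" Z] by simp
  qed
  moreover have bdd: "bdd_below Z" unfolding Z_def by (rule bdd_belowI[of _ 0]) auto
  ultimately have TZ: "Inf Z \<in> Z" using closed_contains_Inf by blast
  define T where "T = Inf Z"
  have T: "T \<in> {0..1}" "\<gamma> T \<notin> U" using TZ unfolding T_def Z_def by auto
  have before: "\<gamma> t \<in> U" if "0 \<le> t" "t < T" for t
    using cInf_lower[OF _ bdd, of t] that T unfolding T_def Z_def by force
  have "\<gamma> 0 \<in> U" unfolding U_def using ends q by (auto simp: dist_commute)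
  then have T0: "0 < T" using T by (cases "T = 0") auto
  \<comment> \<open>Before \<open>T\<close> the curve lies in \<open>U\<close>, hence in the closed
    set \<open>C\<close>; so does its limit \<open>\<gamma> T\<close>. This puts the exit point in
    the chart domain, where its coordinates make sense.\<close>
  have TC: "\<gamma> T \<in> C"
  proof (rule ccontr)
    assume "\<gamma> T \<notin> C"
    then have "\<gamma> T \<in> topspace X - C" using S S_sub T(1) by (auto simp: image_subset_iff)
    then obtain e where e: "e > 0" "\<forall>s\<in>{0..1}. dist s T < e \<longrightarrow> \<gamma> s \<in> topspace X - C"
      using curve_nbhd[OF cont _ T(1)] closedC by blast
    define t where "t = max 0 (T - e/2)"
    have "t \<in> {0..1}" "dist t T < e" "0 \<le> t" "t < T" using e(1) T0 T(1) unfolding t_def by (auto simp: dist_real_def)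
    then show False using e(2) before UC by blast
  qed
  have inC: "\<gamma> t \<in> C" if "t \<in> {0..T}" for t using that before UC TC by (cases "t = T") auto
  have "\<kappa> * norm (chart_map c (\<gamma> T) - chart_map c (\<gamma> 0)) \<le> L"
  proof (rule admissible_displacement[OF adm _ _ c _ \<kappa>(1)])
    show "\<gamma> ` {0..T} \<subseteq> chart_dom c" using inC C by blast
    show "\<kappa> * norm v \<le> sqrt (w (\<gamma> t) * g c (\<gamma> t) v v)" if "t \<in> {0..T}" for t v
      using \<kappa>(2)[of "\<gamma> t" v] C[OF inC[OF that]] S that T(1) by (auto simp: image_subset_iff)
  qed (use T in auto)
  moreover have "s - \<epsilon> \<le> norm (chart_map c (\<gamma> T) - chart_map c (\<gamma> 0))"
  proof -
    have "s \<le> dist (chart_map c (\<gamma> T)) y" using T(2) C[OF TC] unfolding U_def by (auto simp: dist_commute)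
    also have "\<dots> \<le> dist (chart_map c (\<gamma> T)) (chart_map c (\<gamma> 0)) + dist (chart_map c q) y"
      using dist_triangle ends by metis
    finally show ?thesis using q(2) by (simp add: dist_norm)
  qed
  ultimately have "\<kappa> * (s - \<epsilon>) \<le> L" using \<kappa>(1) mult_left_mono order_trans by blast
  then show False using less ennreal_leI not_le by blast
qed

section \<open>Straight segments in coordinates\<close>

lemma segment_continuous:
  assumes c: "c \<in> A" and img: "\<And>t. t \<in> T \<Longrightarrow> y + t *\<^sub>R v \<in> img c"
  shows "curve T (\<lambda>t. chart_inv c (y + t *\<^sub>R v))"
proof -
  have "continuous_map (top_of_set T) (top_of_set (img c)) (\<lambda>t. y + t *\<^sub>R v)"
    unfolding continuous_map_in_subtopology using img by (auto intro!: continuous_intros)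
  from continuous_map_compose[OF this continuous_chart_inv[OF c]] show ?thesis by (simp add: comp_def)
qed

text \<open>The segment may run inside the boundary, where a transition map is only the restriction
  of a local smooth extension. The velocity computed from the extension near each \<open>t\<close>
  agrees with \<open>D\<close> by uniqueness of derivatives on a nondegenerate interval, so these
  local formulas give continuity of \<open>D\<close>.\<close>

lemma segment_C1:
  assumes c: "c \<in> A" and ab: "a < b"
    and img: "\<And>t. t \<in> {a..b} \<Longrightarrow> y + t *\<^sub>R v \<in> img c"
  shows "C1_curve_on A {a..b} (\<lambda>t. chart_inv c (y + t *\<^sub>R v))"
proof (rule C1_curve_onI)
  define \<gamma> where "\<gamma> = (\<lambda>t. chart_inv c (y + t *\<^sub>R v))"
  fix d T assume d: "d \<in> A" and "T = {t \<in> {a..b}. chart_inv c (y + t *\<^sub>R v) \<in> chart_dom d}"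
  then have T_def: "T = {t \<in> {a..b}. \<gamma> t \<in> chart_dom d}" unfolding \<gamma>_def by simp
  define f where "f = chart_map d \<circ> \<gamma>"
  define W where "W = chart_map c ` (chart_dom c \<inter> chart_dom d)"
  define D where "D = (\<lambda>t. vector_derivative f (at t within {a..b}))"
  have cont: "curve {a..b} \<gamma>"
    unfolding \<gamma>_def by (rule segment_continuous[OF c img])
  have TW: "y + t *\<^sub>R v \<in> W" if "t \<in> T" for t
  proof -
    have "\<gamma> t \<in> chart_dom c \<inter> chart_dom d" "y + t *\<^sub>R v = chart_map c (\<gamma> t)"
      using that img unfolding T_def \<gamma>_def by auto
    then show ?thesis unfolding W_def by blast
  qed
  have loc: "\<exists>e>0. \<exists>E. continuous_on (T \<inter> ball t e) E \<and>
      (\<forall>s\<in>T \<inter> ball t e. (f has_vector_derivative E s) (at s within {a..b}))" if t: "t \<in> T" for t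
  proof -
    obtain U h h' where U: "open U" "y + t *\<^sub>R v \<in> U" "\<And>z. z \<in> U \<Longrightarrow> (h has_derivative h' z) (at z)"
      "\<And>u. continuous_on U (\<lambda>z. h' z u)"
      "\<And>z. z \<in> W \<Longrightarrow> z \<in> U \<Longrightarrow> h z = (chart_map d \<circ> chart_inv c) z"
      using smooth_map_onE[OF transition_smooth[OF c d] TW[OF t, unfolded W_def]] unfolding W_def by metis
    have cl: "continuous_on UNIV (\<lambda>s. y + s *\<^sub>R v)" by (intro continuous_intros)
    have "open ((\<lambda>s. y + s *\<^sub>R v) -` U)" using open_vimage[OF U(1) cl] .
    then obtain e1 where e1: "e1 > 0" "ball t e1 \<subseteq> (\<lambda>s. y + s *\<^sub>R v) -` U"
      using U(2) open_contains_ball by (metis vimageI2)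
    have "t \<in> {a..b}" "\<gamma> t \<in> chart_dom d" using t unfolding T_def by auto
    then obtain e2 where e2: "e2 > 0" "\<forall>s\<in>{a..b}. dist s t < e2 \<longrightarrow> \<gamma> s \<in> chart_dom d"
      using curve_nbhd[OF cont openin_dom[OF d]] by blast
    define e where "e = min e1 e2"
    have e: "e > 0" "\<And>s. s \<in> ball t e \<Longrightarrow> y + s *\<^sub>R v \<in> U" "\<And>s. s \<in> {a..b} \<Longrightarrow> s \<in> ball t e \<Longrightarrow> s \<in> T"
      using e1 e2 unfolding e_def T_def by (auto simp: dist_commute subset_iff)
    show ?thesis
    proof (intro exI[of _ e] conjI exI[of _ "\<lambda>s. h' (y + s *\<^sub>R v) v"] ballI)
      show "continuous_on (T \<inter> ball t e) (\<lambda>s. h' (y + s *\<^sub>R v) v)"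
        by (rule continuous_on_compose2[OF U(4)]) (auto intro!: continuous_intros e(2))
      fix s assume s: "s \<in> T \<inter> ball t e"
      have "y + s *\<^sub>R v \<in> U" using e(2) s by blast
      from has_vector_derivative_along_line[OF U(3)[OF this]]
      have hd: "((\<lambda>s. h (y + s *\<^sub>R v)) has_vector_derivative h' (y + s *\<^sub>R v) v) (at s within {a..b})"
        by (rule has_vector_derivative_at_within)
      obtain r where r: "r > 0" "ball s r \<subseteq> ball t e"
        using s openE[OF open_ball, of s t e] by blast
      show "(f has_vector_derivative h' (y + s *\<^sub>R v) v) (at s within {a..b})"
      proof (rule has_vector_derivative_transform_within[OF hd r(1)])
        show "s \<in> {a..b}" using s unfolding T_def by blast
        fix x assume x: "x \<in> {a..b}" "dist x s < r"
        then have "x \<in> ball t e" using r(2) by (auto simp: dist_commute subset_iff)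
        then have "x \<in> T" "y + x *\<^sub>R v \<in> U" using e x by blast+
        then show "h (y + x *\<^sub>R v) = f x"
          using U(5) TW unfolding f_def \<gamma>_def by simp
      qed
    qed (use e in simp)
  qed
  have Duniq: "D s = v'" if "(f has_vector_derivative v') (at s within {a..b})" "s \<in> {a..b}" for s v'
    unfolding D_def using vector_derivative_within_cbox[of a b s f v'] that ab by simp
  have Tsub: "T \<subseteq> {a..b}" unfolding T_def by blast
  have "(f has_vector_derivative D t) (at t within T)" if t: "t \<in> T" for t
  proof -
    obtain e E where e: "e > 0" "\<forall>s\<in>T \<inter> ball t e. (f has_vector_derivative E s) (at s within {a..b})"
      using loc[OF t] by blast
    then have "(f has_vector_derivative E t) (at t within {a..b})" using t by auto
    moreover have "D t = E t" using Duniq calculation t unfolding T_def by blast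
    ultimately show ?thesis using has_vector_derivative_within_subset[OF _ Tsub] by metis
  qed
  moreover have "continuous_on T D"
    unfolding continuous_on_eq_continuous_within
  proof
    fix t assume t: "t \<in> T"
    obtain e E where e: "e > 0" "continuous_on (T \<inter> ball t e) E"
      "\<forall>s\<in>T \<inter> ball t e. (f has_vector_derivative E s) (at s within {a..b})"
      using loc[OF t] by blast
    have "continuous_on (T \<inter> ball t e) D"
    proof (rule continuous_on_eq[OF e(2)])
      fix s assume s: "s \<in> T \<inter> ball t e"
      then show "E s = D s" using Duniq[of "E s" s] e(3) unfolding T_def by auto
    qed
    then have "continuous (at t within T \<inter> ball t e) D"
      using t e(1) by (auto simp: continuous_on_eq_continuous_within)
    moreover have "at t within T \<inter> ball t e = at t within T"
      by (rule at_within_nhd[of _ "ball t e"]) (use e(1) in auto)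
    ultimately show "continuous (at t within T) D" by simp
  qed
  ultimately show "\<exists>D. (\<forall>t\<in>T. (chart_map d \<circ> (\<lambda>t. chart_inv c (y + t *\<^sub>R v)) has_vector_derivative D t) (at t within T))
      \<and> continuous_on T D"
    unfolding f_def \<gamma>_def by blast
qed

text \<open>The majorant is compared with the speed only in the open interval. It will be a multiple
  of \<open>t powr (- M / 2)\<close>, whose value at 0 is 0 by convention although the function is
  unbounded near 0 when M is positive.\<close>

lemma dst_segment_le:
  assumes c: "c \<in> A" and ab: "a < b"
    and img: "\<And>t. t \<in> {a..b} \<Longrightarrow> y + t *\<^sub>R v \<in> img c"
    and S: "\<And>t. t \<in> {a..b} \<Longrightarrow> chart_inv c (y + t *\<^sub>R v) \<in> S"
    and k: "(k has_integral B) {a..b}"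
      "\<And>t. t \<in> {a<..<b} \<Longrightarrow> sqrt (w (chart_inv c (y + t *\<^sub>R v)) * g c (chart_inv c (y + t *\<^sub>R v)) v v) \<le> k t"
  shows "dst (chart_inv c (y + a *\<^sub>R v)) (chart_inv c (y + b *\<^sub>R v)) \<le> ennreal B"
proof -
  define \<gamma> where "\<gamma> = (\<lambda>t. chart_inv c (y + t *\<^sub>R v))"
  have C1: "C1_curve_on A {a..b} \<gamma>" unfolding \<gamma>_def by (rule segment_C1[OF c ab img])
  have cont: "curve {a..b} \<gamma>"
    unfolding \<gamma>_def by (rule segment_continuous[OF c img])
  have SS: "\<gamma> ` {a..b} \<subseteq> S" using S unfolding \<gamma>_def by blast
  define L where "L = integral {a..b} (speed \<gamma>)"
  have L: "(speed \<gamma> has_integral L) {a..b}"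
    unfolding L_def by (rule integrable_integral[OF C1_speed_integrable[OF C1 cont SS]])
  have "admissible \<gamma> a b L"
    unfolding admissible_def using cont SS L pwC1.single[OF ab C1] by blast
  then have "dst (\<gamma> a) (\<gamma> b) \<le> ennreal L" by (rule dst_le_admissible)
  \<comment> \<open>The integrand is replaced by \<open>k\<close> at the two end points, where no
    bound is available.\<close>
  also have "L \<le> B"
  proof (rule has_integral_le[OF has_integral_spike_finite[OF _ _ L, of "{a, b}" "\<lambda>t. if t \<in> {a<..<b} then speed \<gamma> t else k t"] k(1)])
    fix t assume t: "t \<in> {a..b}"
    show "(if t \<in> {a<..<b} then speed \<gamma> t else k t) \<le> k t"
    proof (cases "t \<in> {a<..<b}")
      case True
      have dom: "\<gamma> t \<in> chart_dom c" unfolding \<gamma>_def using img[OF t] by simp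
      have "(chart_map c \<circ> \<gamma> has_vector_derivative v) (at t)"
        by (rule has_vector_derivative_transform_within_open[OF line_has_vector_derivative, of "{a<..<b}"])
          (use True img in \<open>auto simp: \<gamma>_def\<close>)
      from local_speed_eq[OF cont True c dom this] show ?thesis using k(2)[OF True] True unfolding \<gamma>_def by simp
    qed auto
  qed auto
  finally show ?thesis unfolding \<gamma>_def by (simp add: ennreal_leI)
qed

lemma dst_self:
  assumes "q \<in> S" shows "dst q q = 0"
proof -
  have "q \<in> topspace X" using assms S_sub by blast
  then obtain c where c: "c \<in> A" "q \<in> chart_dom c" using ex_chart by blast
  \<comment> \<open>A constant curve, written as a segment with direction 0.\<close>
  have "dst (chart_inv c (chart_map c q + 0 *\<^sub>R 0)) (chart_inv c (chart_map c q + 1 *\<^sub>R 0)) \<le> ennreal 0"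
  proof (rule dst_segment_le[OF c(1), of 0 1 _ _ "\<lambda>_. 0"])
    show "((\<lambda>_. 0) has_integral 0) {0..1::real}" by simp
  qed (use c assms bilinear_lzero[OF metric_bilinear[OF c]] in auto)
  then show ?thesis using c by simp
qed

end

section \<open>Boundary defining functions in charts\<close>

text \<open>The local estimates below hold for all small radii. Phrased with
  \<open>at_right 0\<close>, finitely many of them can be satisfied by one radius.\<close>

lemma eventually_small_radius:
  fixes P :: "real \<Rightarrow> bool"
  assumes "0 < r0" "\<And>r. 0 < r \<Longrightarrow> r \<le> r0 \<Longrightarrow> P r"
  shows "\<forall>\<^sub>F r in at_right 0. P r"
  unfolding eventually_at_right_field using assms by (intro exI[of _ r0]) auto

lemma one_sided_min_derivative_nonneg:
  fixes F :: "real \<Rightarrow> real"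
  assumes "(F has_real_derivative l) (at 0)" "0 < \<epsilon>" "\<And>t. 0 < t \<Longrightarrow> t < \<epsilon> \<Longrightarrow> F 0 \<le> F t"
  shows "0 \<le> l"
proof (rule ccontr)
  assume "\<not> 0 \<le> l"
  then obtain d where d: "d > 0" "\<forall>h>0. h < d \<longrightarrow> F (0 + h) < F 0"
    using DERIV_neg_dec_right[OF assms(1)] by auto
  define t where "t = min d \<epsilon> / 2"
  have "0 < t" "t < d" "t < \<epsilon>" using d(1) assms(2) unfolding t_def by auto
  then show False using d(2) assms(3)[of t] by force
qed

lemma sum_Basis_inner:
  fixes b :: "'e::euclidean_space"
  assumes "J \<subseteq> Basis" "b \<in> Basis"
  shows "(\<Sum>J) \<bullet> b = (if b \<in> J then 1 else 0)"
proof -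
  have fin: "finite J" using assms(1) finite_Basis finite_subset by blast
  have "(\<Sum>J) \<bullet> b = (\<Sum>i\<in>J. if i = b then 1 else 0)"
    unfolding inner_sum_left by (rule sum.cong) (use assms in \<open>auto simp: inner_Basis\<close>)
  then show ?thesis using fin by simp
qed

context corner_riemannian
begin

lemma active_dirs_iff: "b \<in> active_dirs c p \<longleftrightarrow> b \<in> chart_dirs c \<and> chart_map c p \<bullet> b = 0"
  unfolding active_dirs_def by simp

lemma eventually_chart_cball:
  assumes c: "c \<in> A" and p: "p \<in> chart_dom c"
  shows "\<forall>\<^sub>F r in at_right 0. cball (chart_map c p) r \<inter> corner c \<subseteq> img c"
proof -
  obtain r0 where r0: "r0 > 0" "cball (chart_map c p) r0 \<inter> corner c \<subseteq> img c"
    using chart_cball[OF assms] by blast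
  show ?thesis
  proof (rule eventually_small_radius[OF r0(1)])
    fix r assume "0 < r" "r \<le> r0"
    then have "cball (chart_map c p) r \<subseteq> cball (chart_map c p) r0" by (intro subset_cball) auto
    then show "cball (chart_map c p) r \<inter> corner c \<subseteq> img c"
      using r0(2) by blast
  qed
qed

lemma eventually_inactive_pos:
  assumes c: "c \<in> A" and p: "p \<in> chart_dom c"
  shows "\<forall>\<^sub>F r in at_right 0. \<forall>x\<in>cball (chart_map c p) r. \<forall>b\<in>chart_dirs c - active_dirs c p. 0 < x \<bullet> b"
proof -
  define U where "U = (\<Inter>b\<in>chart_dirs c - active_dirs c p. {x. 0 < x \<bullet> b})"
  have "open U" unfolding U_def
    using finite_dirs[OF c] by (intro open_INT) (auto intro!: open_Collect_less continuous_intros)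
  moreover have "chart_map c p \<in> U"
    using img_corner[OF assms] unfolding U_def active_dirs_def model_corner_def by (auto simp: less_le)
  ultimately obtain r0 where r0: "r0 > 0" "cball (chart_map c p) r0 \<subseteq> U"
    using open_contains_cball by blast
  show ?thesis
  proof (rule eventually_small_radius[OF r0(1)])
    fix r assume "0 < r" "r \<le> r0"
    then have "cball (chart_map c p) r \<subseteq> cball (chart_map c p) r0" by (intro subset_cball) auto
    then show "\<forall>x\<in>cball (chart_map c p) r. \<forall>b\<in>chart_dirs c - active_dirs c p. 0 < x \<bullet> b"
      using r0(2) unfolding U_def by blast
  qed
qed

text \<open>The constants come from the extrema of the quadratic form on the compact product of
  \<open>C\<close> and the unit sphere. The minimum is positive by definiteness, and homogeneity
  extends the bounds to all \<open>v\<close>.\<close>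

lemma metric_bounds_on_compact:
  assumes c: "c \<in> A" and C: "compact C" "C \<noteq> {}" "C \<subseteq> img c"
  obtains \<kappa> \<Lambda> where "0 < \<kappa>" "0 < \<Lambda>"
    "\<And>q v. q \<in> chart_dom c \<Longrightarrow> chart_map c q \<in> C \<Longrightarrow>
        \<kappa> * norm v \<le> sqrt (g c q v v) \<and> sqrt (g c q v v) \<le> \<Lambda> * norm v"
proof -
  define f where "f = (\<lambda>z::'e \<times> 'e. g c (chart_inv c (fst z)) (snd z) (snd z))"
  define Z where "Z = C \<times> sphere (0::'e) 1"
  have "compact Z" unfolding Z_def using C(1) by (intro compact_Times) auto
  moreover have "Z \<noteq> {}"
  proof -
    have "(SOME i. i \<in> Basis) \<in> sphere (0::'e) 1" by (simp add: SOME_Basis)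
    then show ?thesis unfolding Z_def using C(2) by blast
  qed
  moreover have "continuous_on Z f"
  proof -
    have "continuous_on Z (\<lambda>z. g c (chart_inv c (fst z)) i j)" for i j
      by (rule continuous_on_compose2[OF smooth_map_on_continuous[OF metric_smooth[OF c]]])
        (use C(3) in \<open>auto simp: Z_def intro!: continuous_intros\<close>)
    then have "continuous_on Z (\<lambda>z. \<Sum>(i,j)\<in>Basis \<times> Basis. (snd z \<bullet> i) * (snd z \<bullet> j) * g c (chart_inv c (fst z)) i j)"
      unfolding split_def by (intro continuous_intros)
    then show ?thesis
    proof (rule continuous_on_eq)
      fix z assume "z \<in> Z"
      then have "chart_inv c (fst z) \<in> chart_dom c" using C(3) unfolding Z_def by auto
      then show "(\<Sum>(i,j)\<in>Basis \<times> Basis. (snd z \<bullet> i) * (snd z \<bullet> j) * g c (chart_inv c (fst z)) i j) = f z"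
        unfolding f_def using metric_expand[OF c, of "chart_inv c (fst z)" "snd z" "snd z"] by simp
    qed
  qed
  ultimately obtain z1 z2 where z: "z1 \<in> Z" "\<forall>z\<in>Z. f z1 \<le> f z" "z2 \<in> Z" "\<forall>z\<in>Z. f z \<le> f z2"
    using continuous_attains_inf continuous_attains_sup by metis
  have pos: "0 < f z" if "z \<in> Z" for z
  proof -
    have "chart_inv c (fst z) \<in> chart_dom c" "snd z \<noteq> 0" using that C(3) unfolding Z_def by auto
    then show ?thesis unfolding f_def by (rule metric_pos[OF c])
  qed
  show thesis
  proof (rule that[of "sqrt (f z1)" "sqrt (f z2)"])
    fix q v assume q: "q \<in> chart_dom c" "chart_map c q \<in> C"
    show "sqrt (f z1) * norm v \<le> sqrt (g c q v v) \<and> sqrt (g c q v v) \<le> sqrt (f z2) * norm v"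
    proof (cases "v = 0")
      case True
      then show ?thesis using bilinear_lzero[OF metric_bilinear[OF c q(1)]] by simp
    next
      case False
      define u where "u = (1 / norm v) *\<^sub>R v"
      have u: "v = norm v *\<^sub>R u" "norm u = 1" unfolding u_def using False by auto
      have "(chart_map c q, u) \<in> Z" unfolding Z_def using q u by simp
      then have b: "f z1 \<le> g c q u u" "g c q u u \<le> f z2" using z(2,4) q c unfolding f_def by fastforce+
      have "g c q v v = (norm v)\<^sup>2 * g c q u u" using metric_scale[OF c q(1), of "norm v" u] u(1) by simp
      then have "sqrt (g c q v v) = norm v * sqrt (g c q u u)" by (simp add: real_sqrt_mult)
      then show ?thesis using b by (simp add: mult.commute mult_left_mono)
    qed
  qed (use pos z in auto)
qed

text \<open>With the constants replaced by \<open>r\<close> and \<open>1 / r\<close>, the bounds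
  weaken as \<open>r\<close> decreases, so one number can be both the radius and the
  constant.\<close>

lemma eventually_metric_bounds:
  assumes c: "c \<in> A" and p: "p \<in> chart_dom c"
  shows "\<forall>\<^sub>F r in at_right 0. \<forall>q\<in>chart_dom c. chart_map c q \<in> cball (chart_map c p) r \<longrightarrow>
     (\<forall>v. r * norm v \<le> sqrt (g c q v v) \<and> sqrt (g c q v v) \<le> norm v / r)"
proof -
  obtain r0 where r0: "r0 > 0" "cball (chart_map c p) r0 \<inter> corner c \<subseteq> img c"
    using chart_cball[OF assms] by blast
  have "compact (cball (chart_map c p) r0 \<inter> corner c)"
    by (intro compact_Int_closed compact_cball closed_model_corner)
  moreover have "cball (chart_map c p) r0 \<inter> corner c \<noteq> {}"
    using r0(1) img_corner[OF c p] centre_in_cball[of "chart_map c p" r0] by (metis IntI empty_iff less_imp_le)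
  ultimately obtain \<kappa> \<Lambda> where \<kappa>: "0 < \<kappa>" "0 < \<Lambda>"
    "\<And>q v. q \<in> chart_dom c \<Longrightarrow> chart_map c q \<in> cball (chart_map c p) r0 \<inter> corner c \<Longrightarrow>
        \<kappa> * norm v \<le> sqrt (g c q v v) \<and> sqrt (g c q v v) \<le> \<Lambda> * norm v"
    using metric_bounds_on_compact[OF c _ _ r0(2)] by metis
  have "0 < min r0 (min \<kappa> (1/\<Lambda>))" using r0 \<kappa> by simp
  then show ?thesis
  proof (rule eventually_small_radius, intro ballI impI allI)
    fix r q v assume r: "0 < r" "r \<le> min r0 (min \<kappa> (1/\<Lambda>))"
      and q: "q \<in> chart_dom c" "chart_map c q \<in> cball (chart_map c p) r"
    have "chart_map c q \<in> cball (chart_map c p) r0 \<inter> corner c"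
      using q r img_corner[OF c q(1)] by auto
    from \<kappa>(3)[OF q(1) this, of v] have *: "\<kappa> * norm v \<le> sqrt (g c q v v)" "sqrt (g c q v v) \<le> \<Lambda> * norm v" by auto
    have "r \<le> \<kappa>" "\<Lambda> \<le> 1 / r" using r \<kappa>(2) by (auto simp: field_simps)
    then have "r * norm v \<le> \<kappa> * norm v" "\<Lambda> * norm v \<le> (1 / r) * norm v"
      by (intro mult_right_mono; simp)+
    then show "r * norm v \<le> sqrt (g c q v v) \<and> sqrt (g c q v v) \<le> norm v / r" using * by auto
  qed
qed

text \<open>Since \<open>\<rho>\<close> vanishes on the facet \<open>x\<^sub>b = 0\<close>, its differential at \<open>p\<close> is a multiple of \<open>dx\<^sub>b\<close>; as it is
  nonzero, the mean value theorem in the direction \<open>b\<close> compares \<open>\<rho>\<close> with \<open>x\<^sub>b\<close>.\<close>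

lemma bdf_comparable:
  assumes bdf: "boundary_defining_function X A H \<rho>" and c: "c \<in> A" and p: "p \<in> chart_dom c"
    and b: "b \<in> active_dirs c p" and r: "0 < r"
    and facet: "\<And>q. q \<in> chart_dom c \<Longrightarrow> chart_map c q \<in> ball (chart_map c p) r \<Longrightarrow> chart_map c q \<bullet> b = 0 \<Longrightarrow>
      (\<forall>b'\<in>chart_dirs c - {b}. 0 < chart_map c q \<bullet> b') \<Longrightarrow> q \<in> H"
  shows "\<forall>\<^sub>F s in at_right 0. \<forall>q\<in>chart_dom c. chart_map c q \<in> cball (chart_map c p) s \<longrightarrow>
     s * (chart_map c q \<bullet> b) \<le> \<rho> q \<and> \<rho> q \<le> (chart_map c q \<bullet> b) / s"
proof -
  define x0 where "x0 = chart_map c p"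
  define K where "K = active_dirs c p"
  have smooth: "smooth_map_on (\<rho> \<circ> chart_inv c) (img c)" and H: "H = {p \<in> topspace X. \<rho> p = 0}"
    and Hpos: "\<forall>p\<in>topspace X - H. 0 < \<rho> p"
    and nz: "p \<in> H \<Longrightarrow> \<not> ((\<rho> \<circ> chart_inv c) has_derivative (\<lambda>v. 0)) (at x0 within img c)"
    using bdf c p unfolding boundary_defining_function_def smooth_function_def x0_def by blast+
  have \<rho>_nonneg: "0 \<le> \<rho> q" if "q \<in> chart_dom c" for q
    using that H Hpos dom_subset[OF c] by (cases "q \<in> H") (auto simp: less_imp_le subset_iff)
  have x0: "x0 \<in> img c" "x0 \<in> corner c" "x0 \<bullet> b = 0"
    using p img_corner[OF c p] b unfolding x0_def active_dirs_def by auto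
  have bB: "b \<in> Basis" and KB: "K \<subseteq> Basis" using b active_dirs_subset[OF c] unfolding K_def by auto
  have bb: "b \<bullet> b = 1" using bB by simp
  have Kx0: "x0 \<bullet> k = 0" if "k \<in> K" for k using that unfolding K_def active_dirs_def x0_def by simp
  have Kd: "K \<subseteq> chart_dirs c" unfolding K_def active_dirs_def by blast
  obtain U h h' where U: "open U" "x0 \<in> U" "\<And>y. y \<in> U \<Longrightarrow> (h has_derivative h' y) (at y)"
    "\<And>v. continuous_on U (\<lambda>y. h' y v)" "\<And>y. y \<in> img c \<Longrightarrow> y \<in> U \<Longrightarrow> h y = (\<rho> \<circ> chart_inv c) y"
    using smooth_map_onE[OF smooth x0(1)] by metis
  obtain rU where rU: "rU > 0" "cball x0 rU \<subseteq> U" using U(1,2) open_contains_cball by blast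
  have "\<forall>\<^sub>F s in at_right 0. cball x0 s \<inter> corner c \<subseteq> img c \<and> (\<forall>x\<in>cball x0 s. \<forall>b\<in>chart_dirs c - K. 0 < x \<bullet> b) \<and> s < r \<and> s < rU \<and> 0 < s"
    using eventually_chart_cball[OF c p] eventually_inactive_pos[OF c p] rU(1) r
    unfolding x0_def K_def by (intro eventually_conj) (auto intro: eventually_at_right_less simp: eventually_at_right_field)
  then obtain s where s: "cball x0 s \<inter> corner c \<subseteq> img c" "\<And>x b. x \<in> cball x0 s \<Longrightarrow> b \<in> chart_dirs c - K \<Longrightarrow> 0 < x \<bullet> b" "s < r" "s < rU" "0 < s"
    using eventually_happens'[OF trivial_limit_at_right_real] by (metis (no_types, lifting))
  have sU: "x \<in> U" if "x \<in> cball x0 s" for x using that rU(2) s(4) by auto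
  have inC: "x \<in> corner c" if "x \<in> cball x0 s" "\<forall>k\<in>K. 0 \<le> x \<bullet> k" for x
    using that s(2) unfolding model_corner_def by force
  have h_eq: "h (chart_map c q) = \<rho> q" if "q \<in> chart_dom c" "chart_map c q \<in> cball x0 s" for q
    using U(5)[of "chart_map c q"] that sU c by auto
  have h_nonneg: "0 \<le> h x" if "x \<in> cball x0 s" "\<forall>k\<in>K. 0 \<le> x \<bullet> k" for x
  proof -
    have "x \<in> img c" using inC[OF that] s(1) that(1) by blast
    then show ?thesis using h_eq \<rho>_nonneg that(1) by force
  qed
  have h_open_facet: "h x = 0" if "x \<in> cball x0 s" "x \<bullet> b = 0" "\<forall>k\<in>K - {b}. 0 < x \<bullet> k" for x
  proof -
    have "\<forall>k\<in>K. 0 \<le> x \<bullet> k" using that by (auto simp: less_imp_le) (metis DiffI empty_iff insert_iff less_imp_le order_refl)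
    then have "x \<in> img c" using inC that(1) s(1) by blast
    then obtain q where q: "q \<in> chart_dom c" "x = chart_map c q" by blast
    have "q \<in> H"
    proof (rule facet[OF q(1)])
      show "chart_map c q \<in> ball (chart_map c p) r" using that(1) s(3) q unfolding x0_def by auto
      show "chart_map c q \<bullet> b = 0" using that q by simp
      show "\<forall>b'\<in>chart_dirs c - {b}. 0 < chart_map c q \<bullet> b'" using that q s(2)[OF that(1)] by blast
    qed
    then have "\<rho> q = 0" using H by simp
    then show ?thesis using h_eq q that(1) by simp
  qed
  \<comment> \<open>Moving along \<open>e\<close> preserves \<open>x \<bullet> b = 0\<close> and
    makes every other active coordinate positive. So points of the closed facet are limits of points
    of the open one, and \<open>h\<close> vanishes there by continuity.\<close>
  define e where "e = \<Sum>(K - {b})"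
  have e: "e \<bullet> b = 0" "\<And>k. k \<in> K - {b} \<Longrightarrow> e \<bullet> k = 1" "\<And>k. k \<in> K \<Longrightarrow> 0 \<le> e \<bullet> k"
    unfolding e_def using sum_Basis_inner[of "K - {b}"] KB bB by (auto simp: subset_iff)
  have h_facet: "h x = 0" if "x \<in> ball x0 s" "x \<bullet> b = 0" "\<forall>k\<in>K. 0 \<le> x \<bullet> k" for x
  proof -
    have xt: "((\<lambda>t. x + t *\<^sub>R e) \<longlongrightarrow> x) (at_right 0)"
    proof -
      have "((\<lambda>t. x + t *\<^sub>R e) \<longlongrightarrow> x + 0 *\<^sub>R e) (at_right 0)" by (intro tendsto_intros)
      then show ?thesis by simp
    qed
    have "isCont h x" using has_derivative_continuous[OF U(3)] sU that(1) by force
    then have "((\<lambda>t. h (x + t *\<^sub>R e)) \<longlongrightarrow> h x) (at_right 0)"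
      using xt isCont_tendsto_compose by blast
    moreover have "\<forall>\<^sub>F t in at_right 0. h (x + t *\<^sub>R e) = 0"
    proof -
      have "\<forall>\<^sub>F t in at_right 0. x + t *\<^sub>R e \<in> ball x0 s"
        using topological_tendstoD[OF xt open_ball that(1)] .
      moreover have "\<forall>\<^sub>F t in at_right 0. (0::real) < t" by (simp add: eventually_at_right_less)
      ultimately show ?thesis
      proof eventually_elim
        case (elim t)
        show ?case
        proof (rule h_open_facet)
          show "\<forall>k\<in>K - {b}. 0 < (x + t *\<^sub>R e) \<bullet> k"
            using that(3) elim(2) e(2) by (auto simp: inner_add_left add_nonneg_pos)
        qed (use elim that e in \<open>auto simp: inner_add_left\<close>)
      qed
    qed
    then have "((\<lambda>t. h (x + t *\<^sub>R e)) \<longlongrightarrow> 0) (at_right 0)" by (simp add: tendsto_eventually)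
    ultimately show ?thesis using tendsto_unique[OF trivial_limit_at_right_real] by blast
  qed
  have hx0: "h x0 = 0" using h_facet[of x0] x0 s(5) Kx0 by auto
  have "p \<in> H" using h_eq[OF p] hx0 s(5) dom_subset[OF c] p H unfolding x0_def by auto
  have lin: "linear (h' x0)" using U(2,3) has_derivative_linear by blast
  have line: "((\<lambda>t. h (x0 + t *\<^sub>R u)) has_real_derivative h' x0 u) (at 0)" for u
    using has_vector_derivative_along_line[of h "h' x0" x0 0 u] U(2,3)
    by (simp add: has_real_derivative_iff_has_vector_derivative)
  have near: "\<exists>\<epsilon>>0. \<forall>t. 0 < t \<longrightarrow> t < \<epsilon> \<longrightarrow> x0 + t *\<^sub>R u \<in> ball x0 s" for u
  proof -
    have "((\<lambda>t. x0 + t *\<^sub>R u) \<longlongrightarrow> x0 + 0 *\<^sub>R u) (at_right 0)" by (intro tendsto_intros)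
    from topological_tendstoD[OF this open_ball, of x0 s] show ?thesis
      using s(5) by (auto simp: eventually_at_right_field)
  qed
  have h'b: "0 \<le> h' x0 b"
  proof -
    obtain \<epsilon> where \<epsilon>: "\<epsilon> > 0" "\<forall>t. 0 < t \<longrightarrow> t < \<epsilon> \<longrightarrow> x0 + t *\<^sub>R b \<in> ball x0 s" using near by blast
    show ?thesis
    proof (rule one_sided_min_derivative_nonneg[OF line \<epsilon>(1)])
      fix t assume t: "0 < t" "t < \<epsilon>"
      have "\<forall>k\<in>K. 0 \<le> (x0 + t *\<^sub>R b) \<bullet> k"
        using Kx0 t KB bB by (auto simp: inner_add_left inner_Basis subset_iff)
      then show "h (x0 + 0 *\<^sub>R b) \<le> h (x0 + t *\<^sub>R b)"
        using h_nonneg[of "x0 + t *\<^sub>R b"] \<epsilon>(2) t hx0 ball_subset_cball by force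
    qed
  qed
  \<comment> \<open>Along such \<open>u\<close> the segment remains in the facet, where
    \<open>h\<close> is 0. The one-sided argument applied to \<open>h\<close> and to its negative
    gives both signs.\<close>
  have h'0: "h' x0 u = 0" if u: "u \<bullet> b = 0" "\<forall>k\<in>K. 0 \<le> u \<bullet> k" for u
  proof -
    obtain \<epsilon> where \<epsilon>: "\<epsilon> > 0" "\<forall>t. 0 < t \<longrightarrow> t < \<epsilon> \<longrightarrow> x0 + t *\<^sub>R u \<in> ball x0 s" using near by blast
    have z: "h (x0 + t *\<^sub>R u) = 0" if "0 < t" "t < \<epsilon>" for t
      by (rule h_facet) (use \<epsilon>(2) that u x0 Kx0 in \<open>auto simp: inner_add_left\<close>)
    have "0 \<le> h' x0 u"
      by (rule one_sided_min_derivative_nonneg[OF line \<epsilon>(1)]) (use z hx0 in simp)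
    moreover have "0 \<le> - h' x0 u"
      by (rule one_sided_min_derivative_nonneg[OF DERIV_minus[OF line] \<epsilon>(1)]) (use z hx0 in simp)
    ultimately show ?thesis by simp
  qed
  have pos: "0 < h' x0 b"
  proof (rule ccontr)
    assume "\<not> 0 < h' x0 b"
    then have b0: "h' x0 b = 0" using h'b by simp
    have e0: "h' x0 e = 0" by (rule h'0) (use e in auto)
    have "h' x0 v = 0" for v
    proof -
      define T where "T = (\<Sum>k\<in>K. \<bar>v \<bullet> k\<bar>)"
      have finK: "finite K" using KB finite_Basis finite_subset by blast
      \<comment> \<open>Removing the \<open>b\<close> component and adding a large multiple of
        \<open>e\<close> makes \<open>u\<close> point into the facet. Since \<open>h' x0\<close>
        also annihilates \<open>b\<close> and \<open>e\<close>, it annihilates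
        \<open>v\<close>.\<close>
      define u where "u = v - (v \<bullet> b) *\<^sub>R b + T *\<^sub>R e"
      have "h' x0 u = 0"
      proof (rule h'0)
        show "u \<bullet> b = 0" unfolding u_def using e(1) bb by (simp add: inner_add_left inner_diff_left)
        show "\<forall>k\<in>K. 0 \<le> u \<bullet> k"
        proof
          fix k assume k: "k \<in> K"
          show "0 \<le> u \<bullet> k"
          proof (cases "k = b")
            case True then show ?thesis using \<open>u \<bullet> b = 0\<close> by simp
          next
            case False
            have "\<bar>v \<bullet> k\<bar> \<le> T" unfolding T_def using finK k by (intro member_le_sum) auto
            moreover have "b \<bullet> k = 0" using False KB k bB by (auto simp: inner_Basis subset_iff)
            ultimately show ?thesis unfolding u_def using e(2)[of k] k False
              by (simp add: inner_add_left inner_diff_left)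
          qed
        qed
      qed
      moreover have "v = u + (v \<bullet> b) *\<^sub>R b - T *\<^sub>R e" unfolding u_def by simp
      then have "h' x0 v = h' x0 u + (v \<bullet> b) * h' x0 b - T * h' x0 e"
        using linear_add[OF lin] linear_diff[OF lin] linear_scale[OF lin] by (metis real_scaleR_def)
      ultimately show ?thesis using b0 e0 by simp
    qed
    then have "h' x0 = (\<lambda>v. 0)" by blast
    then have "(h has_derivative (\<lambda>v. 0)) (at x0 within img c)"
      using U(2,3) has_derivative_at_withinI by metis
    then have "((\<rho> \<circ> chart_inv c) has_derivative (\<lambda>v. 0)) (at x0 within img c)"
      by (rule has_derivative_transform_within[OF _ s(5) x0(1)]) (use U(5) sU in \<open>auto simp: dist_commute\<close>)
    then show False using nz[OF \<open>p \<in> H\<close>] by blast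
  qed
  define l where "l = h' x0 b"
  define O' where "O' = {x \<in> U. l / 2 < h' x b \<and> h' x b < 2 * l}"
  have "open O'"
  proof -
    have "O' = (\<lambda>y. h' y b) -` {l/2<..<2 * l} \<inter> U" unfolding O'_def by auto
    then show ?thesis using continuous_open_vimage U(1,4) continuous_on_open_vimage[OF U(1)] by (metis open_greaterThanLessThan)
  qed
  moreover have "x0 \<in> O'" unfolding O'_def l_def using U(2) pos by auto
  ultimately obtain rO where rO: "rO > 0" "cball x0 rO \<subseteq> O'" using open_contains_cball by blast
  \<comment> \<open>\<open>s / 2\<close> keeps points in the range of \<open>h_facet\<close>,
    \<open>rO\<close> keeps the derivative in direction \<open>b\<close> between
    \<open>l / 2\<close> and \<open>2 * l\<close>, and the last two entries turn these constants
    into \<open>t\<close> and \<open>1 / t\<close>.\<close>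
  have "0 < min (s/2) (min rO (min (l/2) (1 / (2 * l))))" using s(5) rO pos unfolding l_def by simp
  then show ?thesis
  proof (rule eventually_small_radius, intro ballI impI)
    fix t q assume t: "0 < t" "t \<le> min (s/2) (min rO (min (l/2) (1 / (2 * l))))"
      and q: "q \<in> chart_dom c" "chart_map c q \<in> cball (chart_map c p) t"
    define x where "x = chart_map c q"
    define y where "y = x \<bullet> b"
    \<comment> \<open>The foot of the perpendicular to the hyperplane of \<open>b\<close>. As
      \<open>x0\<close> lies in that hyperplane, \<open>x'\<close> is no farther from
      \<open>x0\<close> than \<open>x\<close> is.\<close>
    define x' where "x' = x - y *\<^sub>R b"
    have xt: "x \<in> cball x0 t" using q unfolding x_def x0_def by simp
    have xC: "0 \<le> x \<bullet> k" if "k \<in> K" for k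
      using img_corner[OF c q(1)] that Kd unfolding x_def model_corner_def by blast
    have y0: "0 \<le> y" unfolding y_def using xC b unfolding K_def by blast
    have x't: "x' \<in> cball x0 t"
    proof -
      have "norm (u - (u \<bullet> b) *\<^sub>R b) \<le> norm u" for u
      proof -
        have "(u - (u \<bullet> b) *\<^sub>R b) \<bullet> (u - (u \<bullet> b) *\<^sub>R b) = u \<bullet> u - (u \<bullet> b) * (u \<bullet> b)"
          using bb by (simp add: inner_diff_left inner_diff_right inner_commute)
        then show ?thesis unfolding norm_le by simp
      qed
      moreover have "x' - x0 = (x - x0) - ((x - x0) \<bullet> b) *\<^sub>R b"
        unfolding x'_def y_def using x0(3) by (simp add: inner_diff_left)
      ultimately have "norm (x' - x0) \<le> norm (x - x0)" by metis
      then show ?thesis using xt by (simp add: dist_norm norm_minus_commute)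
    qed
    have hx': "h x' = 0"
    proof (rule h_facet)
      show "x' \<in> ball x0 s" using x't t s(5) by auto
      show "x' \<bullet> b = 0" unfolding x'_def y_def using bb by (simp add: inner_diff_left)
      show "\<forall>k\<in>K. 0 \<le> x' \<bullet> k"
        using xC KB bB unfolding x'_def y_def by (auto simp: inner_diff_left inner_Basis subset_iff)
    qed
    have hx: "h x = \<rho> q" using h_eq[OF q(1)] xt t s(5) unfolding x_def by auto
    have "l / 2 * y \<le> h x \<and> h x \<le> 2 * l * y"
    proof (cases "y = 0")
      case True
      then have "x = x'" unfolding x'_def by simp
      then show ?thesis using hx' True by simp
    next
      case False
      then have yp: "0 < y" using y0 by simp
      have seg: "x' + z *\<^sub>R b \<in> cball x0 t" if "0 \<le> z" "z \<le> y" for z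
      proof -
        have "x' + z *\<^sub>R b = (1 - z / y) *\<^sub>R x' + (z / y) *\<^sub>R x"
          unfolding x'_def using yp by (simp add: algebra_simps)
        then show ?thesis using convexD[OF convex_cball x't xt, of "1 - z/y" "z/y"] that yp by simp
      qed
      have O: "x' + z *\<^sub>R b \<in> O'" if "0 \<le> z" "z \<le> y" for z using seg[OF that] rO(2) t by auto
      have "\<exists>z>0. z < y \<and> h (x' + y *\<^sub>R b) - h (x' + 0 *\<^sub>R b) = (y - 0) * h' (x' + z *\<^sub>R b) b"
      proof (rule MVT2[OF yp])
        fix z :: real assume z: "0 \<le> z" "z \<le> y"
        have "x' + z *\<^sub>R b \<in> U" using O[OF z] unfolding O'_def by blast
        from has_vector_derivative_along_line[OF U(3)[OF this]]
        show "((\<lambda>z. h (x' + z *\<^sub>R b)) has_real_derivative h' (x' + z *\<^sub>R b) b) (at z)"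
          by (simp add: has_real_derivative_iff_has_vector_derivative)
      qed
      then obtain z where z: "0 < z" "z < y" "h (x' + y *\<^sub>R b) - h x' = y * h' (x' + z *\<^sub>R b) b" by auto
      have "h x = y * h' (x' + z *\<^sub>R b) b" using z(3) hx' unfolding x'_def by simp
      moreover have "l / 2 \<le> h' (x' + z *\<^sub>R b) b" "h' (x' + z *\<^sub>R b) b \<le> 2 * l"
        using O[of z] z unfolding O'_def by auto
      ultimately show ?thesis using mult_left_mono[OF _ y0] by (metis mult.commute)
    qed
    moreover have "t * y \<le> l / 2 * y" using t y0 by (intro mult_right_mono) auto
    moreover have "2 * l * y \<le> (1 / t) * y"
      using t y0 pos unfolding l_def[symmetric] by (intro mult_right_mono) (auto simp: field_simps)
    ultimately show "t * (chart_map c q \<bullet> b) \<le> \<rho> q \<and> \<rho> q \<le> (chart_map c q \<bullet> b) / t"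
      using hx unfolding y_def x_def by auto
  qed
qed

end

section \<open>Distances between completion points\<close>

lemma ennreal_small_gap:
  fixes L y :: ennreal
  assumes "L < y"
  shows "\<exists>\<epsilon>>0. L + ennreal \<epsilon> + ennreal \<epsilon> \<le> y"
proof -
  obtain l where l: "L = ennreal l" "0 \<le> l" using assms by (cases L rule: ennreal_cases) auto
  show ?thesis
  proof (cases y rule: ennreal_cases)
    case (real y')
    then have "l < y'" using assms l by (simp add: ennreal_less_iff)
    define \<epsilon> where "\<epsilon> = (y' - l) / 2"
    have "0 < \<epsilon>" "y' = l + \<epsilon> + \<epsilon>" using \<open>l < y'\<close> unfolding \<epsilon>_def by (auto simp: field_simps)
    then have "L + ennreal \<epsilon> + ennreal \<epsilon> = y" using l real by (simp flip: ennreal_plus)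
    then show ?thesis using \<open>0 < \<epsilon>\<close> by (intro exI[of _ \<epsilon>]) simp
  qed (auto intro!: exI[of _ 1])
qed

text \<open>The Cauchy condition is stated additively because values may be infinite. The limit
  inferior always exists in \<open>ennreal\<close> and turns out to be the limit.\<close>

lemma ennreal_Cauchy_convergent:
  fixes a :: "nat \<Rightarrow> ennreal"
  assumes "\<And>\<epsilon>. 0 < \<epsilon> \<Longrightarrow> \<exists>M. \<forall>n\<ge>M. \<forall>m\<ge>M. a n \<le> a m + ennreal \<epsilon>"
  shows "convergent a"
proof -
  define L where "L = Liminf sequentially a"
  have "a \<longlonglongrightarrow> L"
  proof (rule order_tendstoI)
    fix y assume "y < L"
    then show "\<forall>\<^sub>F n in sequentially. y < a n" unfolding L_def by (rule less_LiminfD)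
  next
    fix y assume "L < y"
    then obtain \<epsilon> where \<epsilon>: "0 < \<epsilon>" "L + ennreal \<epsilon> + ennreal \<epsilon> \<le> y" using ennreal_small_gap by blast
    obtain M where M: "\<forall>n\<ge>M. \<forall>m\<ge>M. a n \<le> a m + ennreal \<epsilon>" using assms[OF \<epsilon>(1)] by blast
    have "L < top" using \<open>L < y\<close> top.not_eq_extremum by fastforce
    then have "L < L + ennreal \<epsilon>" using less_add_ennreal \<epsilon>(1) by blast
    \<comment> \<open>Values below \<open>L + \<epsilon>\<close> recur beyond every index, since
      otherwise the limit inferior would be at least \<open>L + \<epsilon>\<close>.\<close>
    then have "\<not> (\<forall>\<^sub>F n in sequentially. L + ennreal \<epsilon> \<le> a n)"
      using Liminf_bounded[of "L + ennreal \<epsilon>" a sequentially] unfolding L_def by auto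
    then obtain m where m: "m \<ge> M" "a m < L + ennreal \<epsilon>"
      unfolding eventually_sequentially by (meson not_le)
    have "a n < y" if "n \<ge> M" for n
    proof -
      have "a n \<le> a m + ennreal \<epsilon>" using M m(1) that by blast
      also have "\<dots> < L + ennreal \<epsilon> + ennreal \<epsilon>"
        using m(2) by (simp add: ennreal_add_left_cancel_less add.commute)
      also have "\<dots> \<le> y" by (rule \<epsilon>(2))
      finally show ?thesis .
    qed
    then show "\<forall>\<^sub>F n in sequentially. a n < y" unfolding eventually_sequentially by blast
  qed
  then show ?thesis unfolding convergent_def by blast
qed

locale ennreal_dist =
  fixes d :: "'a \<Rightarrow> 'a \<Rightarrow> ennreal" and S :: "'a set"
  assumes d_sym: "d p q = d q p" and d_triangle: "d p r \<le> d p q + d q r"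
begin

lemma equiv_cauchy_equiv: "equiv (cauchy_seqs S d) (cauchy_equiv S d)"
proof (rule equivI)
  show "cauchy_equiv S d \<subseteq> cauchy_seqs S d \<times> cauchy_seqs S d" unfolding cauchy_equiv_def by blast
  show "refl_on (cauchy_seqs S d) (cauchy_equiv S d)"
  proof (unfold refl_on_def, rule ballI)
    fix x assume x: "x \<in> cauchy_seqs S d"
    \<comment> \<open>This is the Cauchy condition with \<open>m = n\<close>: the axioms on
      \<open>d\<close> do not make it vanish on the diagonal, and the Riemannian distance is
      infinite there outside \<open>S\<close>.\<close>
    have "(\<lambda>n. d (x n) (x n)) \<longlonglongrightarrow> 0"
    proof (rule order_tendstoI)
      fix y :: ennreal assume "0 < y"
      then obtain M where "\<forall>m\<ge>M. \<forall>n\<ge>M. d (x m) (x n) < y" using x unfolding cauchy_seqs_def by blast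
      then show "\<forall>\<^sub>F n in sequentially. d (x n) (x n) < y" unfolding eventually_sequentially by blast
    qed auto
    then show "(x, x) \<in> cauchy_equiv S d" using x unfolding cauchy_equiv_def by blast
  qed
  show "sym (cauchy_equiv S d)" unfolding cauchy_equiv_def using d_sym by (auto intro!: symI)
  show "trans (cauchy_equiv S d)"
  proof (rule transI)
    fix x y z assume xy: "(x, y) \<in> cauchy_equiv S d" and yz: "(y, z) \<in> cauchy_equiv S d"
    have "(\<lambda>n. d (x n) (y n) + d (y n) (z n)) \<longlonglongrightarrow> 0 + 0"
      using xy yz unfolding cauchy_equiv_def by (intro tendsto_add) auto
    then have "(\<lambda>n. d (x n) (y n) + d (y n) (z n)) \<longlonglongrightarrow> 0" by simp
    then have "(\<lambda>n. d (x n) (z n)) \<longlonglongrightarrow> 0"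
      by (rule tendsto_sandwich[rotated 3]) (auto simp: d_triangle)
    then show "(x, z) \<in> cauchy_equiv S d" using xy yz unfolding cauchy_equiv_def by auto
  qed
qed

text \<open>This makes the definite description in \<^const>\<open>completion_point\<close> satisfiable.\<close>

definition consistent_at :: "'a topology \<Rightarrow> 'a \<Rightarrow> bool" where
  "consistent_at X z \<longleftrightarrow> (\<forall>x y. range x \<subseteq> S \<longrightarrow> limitin X x z sequentially \<longrightarrow>
     range y \<subseteq> S \<longrightarrow> limitin X y z sequentially \<longrightarrow> (x, y) \<in> cauchy_equiv S d)"

text \<open>The sequence \<open>u\<close> pins the class down, as two classes containing it
  coincide. \<open>consistent_at\<close> puts every other sequence converging to \<open>z\<close>
  into the same class.\<close>

lemma completion_point:
  assumes "consistent_at X z" "range u \<subseteq> S" "limitin X u z sequentially"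
  shows "completion_point X S d z \<in> metric_completion S d" "u \<in> completion_point X S d z"
proof -
  note eq = equiv_cauchy_equiv
  have uu: "(u, u) \<in> cauchy_equiv S d" using assms unfolding consistent_at_def by blast
  then have u: "u \<in> cauchy_seqs S d" unfolding cauchy_equiv_def by blast
  have "\<exists>!P. P \<in> metric_completion S d \<and> (\<forall>x. range x \<subseteq> S \<and> limitin X x z sequentially \<longrightarrow> x \<in> P)"
  proof (rule ex1I)
    show "cauchy_equiv S d `` {u} \<in> metric_completion S d \<and>
      (\<forall>x. range x \<subseteq> S \<and> limitin X x z sequentially \<longrightarrow> x \<in> cauchy_equiv S d `` {u})"
      using u assms unfolding metric_completion_def consistent_at_def by (auto intro: quotientI)
    fix P assume "P \<in> metric_completion S d \<and> (\<forall>x. range x \<subseteq> S \<and> limitin X x z sequentially \<longrightarrow> x \<in> P)"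
    then have P: "P \<in> cauchy_seqs S d // cauchy_equiv S d" "u \<in> P"
      using assms(2,3) unfolding metric_completion_def by auto
    show "P = cauchy_equiv S d `` {u}"
      by (rule quotient_eqI[OF eq P(1) quotientI[OF u] P(2) _ uu]) (use uu in blast)
  qed
  from theI'[OF this] show "completion_point X S d z \<in> metric_completion S d" "u \<in> completion_point X S d z"
    unfolding completion_point_def using assms(2,3) by blast+
qed

lemma cauchy_dist_convergent:
  assumes x: "x \<in> cauchy_seqs S d" and y: "y \<in> cauchy_seqs S d"
  shows "convergent (\<lambda>n. d (x n) (y n))"
proof (rule ennreal_Cauchy_convergent)
  fix \<epsilon> :: real assume \<epsilon>: "0 < \<epsilon>"
  then have e2: "0 < ennreal (\<epsilon>/2)" by simp
  obtain M1 where M1: "\<forall>m\<ge>M1. \<forall>n\<ge>M1. d (x m) (x n) < ennreal (\<epsilon>/2)" using x e2 unfolding cauchy_seqs_def by blast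
  obtain M2 where M2: "\<forall>m\<ge>M2. \<forall>n\<ge>M2. d (y m) (y n) < ennreal (\<epsilon>/2)" using y e2 unfolding cauchy_seqs_def by blast
  show "\<exists>M. \<forall>n\<ge>M. \<forall>m\<ge>M. d (x n) (y n) \<le> d (x m) (y m) + ennreal \<epsilon>"
  proof (intro exI[of _ "max M1 M2"] allI impI)
    fix n m assume nm: "max M1 M2 \<le> n" "max M1 M2 \<le> m"
    have "d (x n) (y n) \<le> d (x n) (x m) + (d (x m) (y m) + d (y m) (y n))"
      using d_triangle[of "x n" "y n" "x m"] d_triangle[of "x m" "y n" "y m"] add_left_mono order_trans by blast
    also have "\<dots> \<le> ennreal (\<epsilon>/2) + (d (x m) (y m) + ennreal (\<epsilon>/2))"
      using M1 M2 nm by (intro add_mono) (auto intro: less_imp_le)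
    also have "\<dots> = d (x m) (y m) + (ennreal (\<epsilon>/2) + ennreal (\<epsilon>/2))" by (simp add: algebra_simps)
    also have "ennreal (\<epsilon>/2) + ennreal (\<epsilon>/2) = ennreal \<epsilon>" using \<epsilon> by (simp flip: ennreal_plus)
    finally show "d (x n) (y n) \<le> d (x m) (y m) + ennreal \<epsilon>" .
  qed
qed

text \<open>Only one inequality, from the detour through \<open>u\<close> and \<open>v\<close>;
  exchanging the two pairs gives equality, so limits of distances depend only on the
  classes.\<close>

lemma cauchy_equiv_lim_le:
  assumes xu: "(x, u) \<in> cauchy_equiv S d" and yv: "(y, v) \<in> cauchy_equiv S d"
    and L: "(\<lambda>n. d (x n) (y n)) \<longlonglongrightarrow> L" and L': "(\<lambda>n. d (u n) (v n)) \<longlonglongrightarrow> L'"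
  shows "L \<le> L'"
proof -
  have "(\<lambda>n. d (x n) (u n) + (d (u n) (v n) + d (y n) (v n))) \<longlonglongrightarrow> 0 + (L' + 0)"
    using xu yv L' unfolding cauchy_equiv_def by (intro tendsto_add) auto
  then have lim: "(\<lambda>n. d (x n) (u n) + (d (u n) (v n) + d (y n) (v n))) \<longlonglongrightarrow> L'" by simp
  have "d (x n) (y n) \<le> d (x n) (u n) + (d (u n) (v n) + d (y n) (v n))" for n
    using d_triangle[of "x n" "y n" "u n"] d_triangle[of "u n" "y n" "v n"] add_left_mono order_trans d_sym[of "v n" "y n"]
    by metis
  then show ?thesis using LIMSEQ_le[OF L lim] by blast
qed

text \<open>\<open>completion_dist\<close> evaluates on representatives selected by
  \<open>SOME\<close>, of which only the class is known. Any sequences converging to the two points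
  may be substituted, in particular explicit ones.\<close>

lemma boundary_dist_lim:
  assumes z: "consistent_at X z" "range u \<subseteq> S" "limitin X u z sequentially"
    and z': "consistent_at X z'" "range v \<subseteq> S" "limitin X v z' sequentially"
  shows "(\<lambda>n. d (u n) (v n)) \<longlonglongrightarrow> boundary_dist X S d z z'"
proof -
  note eq = equiv_cauchy_equiv
  define P where "P = completion_point X S d z"
  define Q where "Q = completion_point X S d z'"
  define x where "x = (SOME x. x \<in> P)"
  define y where "y = (SOME y. y \<in> Q)"
  have u: "u \<in> P" "P \<in> metric_completion S d" using completion_point[OF z] unfolding P_def by auto
  have v: "v \<in> Q" "Q \<in> metric_completion S d" using completion_point[OF z'] unfolding Q_def by auto
  have "x \<in> P" unfolding x_def using u(1) by (rule someI[of "\<lambda>x. x \<in> P"])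
  have "y \<in> Q" unfolding y_def using v(1) by (rule someI[of "\<lambda>y. y \<in> Q"])
  have xu: "(x, u) \<in> cauchy_equiv S d" "(u, x) \<in> cauchy_equiv S d"
    using in_quotient_imp_in_rel[OF eq, of P] u \<open>x \<in> P\<close> unfolding metric_completion_def by auto
  have yv: "(y, v) \<in> cauchy_equiv S d" "(v, y) \<in> cauchy_equiv S d"
    using in_quotient_imp_in_rel[OF eq, of Q] v \<open>y \<in> Q\<close> unfolding metric_completion_def by auto
  have c: "x \<in> cauchy_seqs S d" "u \<in> cauchy_seqs S d" "y \<in> cauchy_seqs S d" "v \<in> cauchy_seqs S d"
    using xu yv unfolding cauchy_equiv_def by auto
  obtain L where L: "(\<lambda>n. d (x n) (y n)) \<longlonglongrightarrow> L"
    using cauchy_dist_convergent[OF c(1,3)] unfolding convergent_def by blast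
  obtain L' where L': "(\<lambda>n. d (u n) (v n)) \<longlonglongrightarrow> L'"
    using cauchy_dist_convergent[OF c(2,4)] unfolding convergent_def by blast
  have "L = L'"
    using cauchy_equiv_lim_le[OF xu(1) yv(1) L L'] cauchy_equiv_lim_le[OF xu(2) yv(2) L' L] by simp
  moreover have "boundary_dist X S d z z' = L"
    unfolding boundary_dist_def completion_dist_def P_def[symmetric] Q_def[symmetric]
      x_def[symmetric] y_def[symmetric] using limI[OF L] .
  ultimately show ?thesis using L' by simp
qed

end

section \<open>Boundary hypersurfaces in charts\<close>

locale corner_faces = corner_riemannian X A g
  for X :: "'a topology" and A :: "('a, 'e::euclidean_space) chart set" and g +
  fixes N :: nat and H :: "nat \<Rightarrow> 'a set" and \<rho> :: "nat \<Rightarrow> 'a \<Rightarrow> real"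
  assumes hyps: "bij_betw H {1..N} (boundary_hypersurfaces X A)"
    and embedded: "i \<in> {1..N} \<Longrightarrow> embedded_hypersurface X A (H i)"
    and bdf: "i \<in> {1..N} \<Longrightarrow> boundary_defining_function X A (H i) (\<rho> i)"
begin

lemma H_iff: "i \<in> {1..N} \<Longrightarrow> p \<in> topspace X \<Longrightarrow> p \<in> H i \<longleftrightarrow> \<rho> i p = 0"
  and \<rho>_smooth: "i \<in> {1..N} \<Longrightarrow> smooth_function A (\<rho> i)"
  using bdf unfolding boundary_defining_function_def by blast+

lemma \<rho>_pos: "i \<in> {1..N} \<Longrightarrow> p \<in> topspace X \<Longrightarrow> p \<notin> H i \<Longrightarrow> 0 < \<rho> i p"
  using bdf unfolding boundary_defining_function_def by blast

lemma \<rho>_nonneg: "i \<in> {1..N} \<Longrightarrow> p \<in> topspace X \<Longrightarrow> 0 \<le> \<rho> i p"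
  using \<rho>_pos[of i p] H_iff[of i p] by (cases "p \<in> H i") auto

lemma \<rho>_continuous:
  assumes i: "i \<in> {1..N}" shows "continuous_map X euclideanreal (\<rho> i)"
  unfolding continuous_map_def
proof (intro conjI allI impI)
  fix V :: "real set" assume "openin euclidean V"
  then have V: "open V" by simp
  show "openin X {x \<in> topspace X. \<rho> i x \<in> V}"
  proof (subst openin_subopen, rule ballI)
    fix p assume p: "p \<in> {x \<in> topspace X. \<rho> i x \<in> V}"
    then obtain c where c: "c \<in> A" "p \<in> chart_dom c" using ex_chart by blast
    have "continuous_on (img c) (\<rho> i \<circ> chart_inv c)"
      using smooth_map_on_continuous \<rho>_smooth[OF i] c unfolding smooth_function_def by blast
    then obtain U where U: "open U"
      "U \<inter> img c = (\<rho> i \<circ> chart_inv c) -` V \<inter> img c"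
      using V unfolding continuous_on_open_invariant by blast
    have U': "\<rho> i q \<in> V \<longleftrightarrow> chart_map c q \<in> U" if "q \<in> chart_dom c" for q
    proof -
      have "chart_map c q \<in> U \<inter> img c \<longleftrightarrow>
          chart_map c q \<in> (\<rho> i \<circ> chart_inv c) -` V \<inter> img c" using U(2) by blast
      then show ?thesis using that c(1) by simp
    qed
    show "\<exists>T. openin X T \<and> p \<in> T \<and> T \<subseteq> {x \<in> topspace X. \<rho> i x \<in> V}"
      using openin_chart_vimage[OF c(1) U(1)] U' c p dom_subset[OF c(1)]
      by (intro exI[of _ "{q \<in> chart_dom c. chart_map c q \<in> U}"]) auto
  qed
qed auto

text \<open>Embeddedness makes some boundary coordinate vanish at each point of \<open>H i\<close>,
  so \<open>H i\<close> lies in the boundary.\<close>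

lemma \<rho>_pos_interior:
  assumes "i \<in> {1..N}" "p \<in> corner_interior X A" shows "0 < \<rho> i p"
proof -
  have "p \<notin> H i"
    using embedded[OF assms(1)] assms(2) unfolding embedded_hypersurface_def corner_interior_def corner_boundary_def by blast
  then show ?thesis using \<rho>_pos assms unfolding corner_interior_def by blast
qed

text \<open>For an active direction \<open>b\<close> this is a piece of the depth-one stratum near
  \<open>p\<close>, the local building block of the hypersurfaces.\<close>

definition facet :: "('a, 'e) chart \<Rightarrow> 'a \<Rightarrow> real \<Rightarrow> 'e \<Rightarrow> 'a set" where
  "facet c p r b = {q \<in> chart_dom c. chart_map c q \<in> ball (chart_map c p) r \<and> chart_map c q \<bullet> b = 0 \<and>
     (\<forall>b'\<in>chart_dirs c - {b}. 0 < chart_map c q \<bullet> b')}"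

text \<open>In coordinates the set is an intersection of a ball, a hyperplane and half-spaces, hence
  convex.\<close>

lemma facet_connected:
  assumes c: "c \<in> A" and p: "p \<in> chart_dom c" and b: "b \<in> active_dirs c p"
    and r: "cball (chart_map c p) r \<inter> corner c \<subseteq> img c"
  shows "connectedin (subtopology X (depth_stratum A 1)) (facet c p r b)"
proof -
  define P where "P = ball (chart_map c p) r \<inter> {x. b \<bullet> x = 0} \<inter> (\<Inter>b'\<in>chart_dirs c - {b}. {x. b' \<bullet> x > 0})"
  have P: "x \<in> P \<longleftrightarrow> x \<in> ball (chart_map c p) r \<and> x \<bullet> b = 0 \<and> (\<forall>b'\<in>chart_dirs c - {b}. 0 < x \<bullet> b')" for x
    unfolding P_def by (auto simp: inner_commute)
  have "convex P" unfolding P_def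
    by (intro convex_Int convex_ball convex_hyperplane convex_INT) (auto intro: convex_halfspace_gt)
  then have conn: "connected P" by (rule convex_connected)
  have Pimg: "P \<subseteq> img c"
  proof
    fix x assume x: "x \<in> P"
    then have "x \<in> corner c" unfolding P model_corner_def
      by (auto simp: less_imp_le) (metis DiffI empty_iff insert_iff less_imp_le order_refl)
    then show "x \<in> img c" using x r ball_subset_cball unfolding P by blast
  qed
  have "facet c p r b = chart_inv c ` P"
  proof
    show "facet c p r b \<subseteq> chart_inv c ` P"
    proof
      fix q assume "q \<in> facet c p r b"
      then have "q \<in> chart_dom c" "chart_map c q \<in> P" unfolding P facet_def by auto
      then show "q \<in> chart_inv c ` P" using c by (metis chart_inv_map image_eqI)
    qed
    show "chart_inv c ` P \<subseteq> facet c p r b"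
    proof
      fix q assume "q \<in> chart_inv c ` P"
      then obtain x where x: "x \<in> P" "q = chart_inv c x" by blast
      then have "x \<in> img c" using Pimg by blast
      then have "q \<in> chart_dom c" "chart_map c q = x" using x(2) by simp_all
      then show "q \<in> facet c p r b" using x(1) unfolding P facet_def by auto
    qed
  qed
  moreover have "connectedin (top_of_set (img c)) P"
    using conn Pimg by (simp add: connectedin_subtopology)
  ultimately have "connectedin X (facet c p r b)"
    using connectedin_continuous_map_image[OF continuous_chart_inv[OF c]] by metis
  moreover have "facet c p r b \<subseteq> depth_stratum A 1"
  proof
    fix q assume q: "q \<in> facet c p r b"
    then have "active_dirs c q = {b}" using b unfolding facet_def active_dirs_def by force
    then show "q \<in> depth_stratum A 1" using depth_iff[OF c, of q 1] q unfolding facet_def by simp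
  qed
  ultimately show ?thesis by (simp add: connectedin_subtopology)
qed

text \<open>A connected piece of the depth-one stratum lies in one component, and the closure of
  that component is a hypersurface, which \<open>H\<close> enumerates.\<close>

lemma facet_subset_hypersurface:
  assumes c: "c \<in> A" and p: "p \<in> chart_dom c" and b: "b \<in> active_dirs c p"
    and r: "cball (chart_map c p) r \<inter> corner c \<subseteq> img c"
    and ne: "facet c p r b \<noteq> {}"
  obtains i where "i \<in> {1..N}" "facet c p r b \<subseteq> H i"
proof -
  define D where "D = subtopology X (depth_stratum A 1)"
  have conn: "connectedin D (facet c p r b)" unfolding D_def by (rule facet_connected[OF c p b r])
  then have "facet c p r b \<subseteq> topspace D" by (rule connectedin_subset_topspace)
  then have "D \<noteq> trivial_topology" using ne by auto
  then obtain Q where Q: "Q \<in> connected_components_of D" "facet c p r b \<subseteq> Q"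
    using exists_connected_component_of_superset[OF conn] by blast
  have "X closure_of Q \<in> H ` {1..N}"
    using Q(1) hyps unfolding bij_betw_def boundary_hypersurfaces_def D_def by blast
  then obtain i where i: "i \<in> {1..N}" "X closure_of Q = H i" by auto
  have "Q \<subseteq> topspace D" using Q(1) by (rule connected_components_of_subset)
  then have "Q \<subseteq> X closure_of Q" unfolding D_def by (intro closure_of_subset) auto
  then show thesis using that i Q(2) by blast
qed

text \<open>As \<open>p\<close> is in the closure of the component \<open>Q\<close>, some point of
  \<open>Q\<close> lies in the small ball. Having depth one, it has a single vanishing coordinate,
  which must be active at \<open>p\<close>, and the whole connected facet of that coordinate then
  belongs to \<open>Q\<close>.\<close>

lemma hypersurface_contains_facet:
  assumes c: "c \<in> A" and p: "p \<in> chart_dom c" and i: "i \<in> {1..N}" and pH: "p \<in> H i" and r0: "0 < r"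
    and r: "cball (chart_map c p) r \<inter> corner c \<subseteq> img c"
    and pos: "\<forall>x\<in>cball (chart_map c p) r. \<forall>b\<in>chart_dirs c - active_dirs c p. 0 < x \<bullet> b"
  obtains b where "b \<in> active_dirs c p" "facet c p r b \<subseteq> H i"
proof -
  define D where "D = subtopology X (depth_stratum A 1)"
  have "H i \<in> boundary_hypersurfaces X A" using hyps i unfolding bij_betw_def by blast
  then obtain Q where Q: "Q \<in> connected_components_of D" "H i = X closure_of Q"
    unfolding boundary_hypersurfaces_def D_def by blast
  have QD: "Q \<subseteq> topspace D" using Q(1) by (rule connected_components_of_subset)
  define U where "U = {q \<in> chart_dom c. chart_map c q \<in> ball (chart_map c p) r}"
  have "openin X U" unfolding U_def by (rule openin_chart_vimage[OF c]) simp
  moreover have "p \<in> U" unfolding U_def using p r0 by simp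
  ultimately obtain q where q: "q \<in> Q" "q \<in> U" using pH unfolding Q(2) in_closure_of by blast
  have qd: "q \<in> chart_dom c" "chart_map c q \<in> ball (chart_map c p) r" using q(2) unfolding U_def by auto
  have "q \<in> depth_stratum A 1" using q(1) QD unfolding D_def by auto
  then have "card (active_dirs c q) = 1" using depth_iff[OF c qd(1)] by blast
  then obtain b where b: "active_dirs c q = {b}" by (meson card_1_singletonE)
  then have bq: "b \<in> chart_dirs c" "chart_map c q \<bullet> b = 0" unfolding active_dirs_def by auto
  have bK: "b \<in> active_dirs c p"
  proof (rule ccontr)
    assume "b \<notin> active_dirs c p"
    then have "0 < chart_map c q \<bullet> b" using pos bq(1) qd(2) ball_subset_cball by blast
    then show False using bq(2) by simp
  qed
  have "q \<in> facet c p r b"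
    unfolding facet_def
  proof (intro CollectI conjI ballI)
    fix b' assume b': "b' \<in> chart_dirs c - {b}"
    then have "chart_map c q \<bullet> b' \<noteq> 0" using b unfolding active_dirs_def by blast
    then show "0 < chart_map c q \<bullet> b'" using img_corner[OF c qd(1)] b' unfolding model_corner_def by force
  qed (use qd bq in auto)
  then have "facet c p r b \<subseteq> Q"
    using connected_components_of_maximal[OF Q(1) facet_connected[OF c p bK r, folded D_def]] q(1)
    unfolding disjnt_def by blast
  moreover have "Q \<subseteq> X closure_of Q" using QD unfolding D_def by (intro closure_of_subset) auto
  ultimately show thesis using that bK Q(2) by blast
qed

definition comparable :: "('a, 'e) chart \<Rightarrow> 'a \<Rightarrow> nat \<Rightarrow> 'e \<Rightarrow> real \<Rightarrow> bool" where
  "comparable c p i b s \<longleftrightarrow> (\<forall>q\<in>chart_dom c. chart_map c q \<in> cball (chart_map c p) s \<longrightarrow>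
     s * (chart_map c q \<bullet> b) \<le> \<rho> i q \<and> \<rho> i q \<le> (chart_map c q \<bullet> b) / s)"

lemma facet_comparable:
  assumes "c \<in> A" "p \<in> chart_dom c" "b \<in> active_dirs c p" "0 < r" "i \<in> {1..N}" "facet c p r b \<subseteq> H i"
  shows "\<forall>\<^sub>F s in at_right 0. comparable c p i b s"
  unfolding comparable_def
  by (rule bdf_comparable[OF bdf[OF assms(5)] assms(1-4)]) (use assms(6) in \<open>auto simp: facet_def\<close>)

lemma facet_nonempty:
  assumes c: "c \<in> A" and p: "p \<in> chart_dom c" and b: "b \<in> active_dirs c p" and r0: "0 < r"
    and r: "cball (chart_map c p) r \<inter> corner c \<subseteq> img c"
    and pos: "\<forall>x\<in>cball (chart_map c p) r. \<forall>b\<in>chart_dirs c - active_dirs c p. 0 < x \<bullet> b"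
  shows "facet c p r b \<noteq> {}"
proof -
  define e where "e = \<Sum>(active_dirs c p - {b})"
  \<comment> \<open>Half the radius leaves strict room, and \<open>1 + norm e\<close> avoids a
    division by zero when \<open>e = 0\<close>, that is, when \<open>b\<close> is the only active
    direction.\<close>
  define t where "t = r / 2 / (1 + norm e)"
  have ne: "0 < 1 + norm e" using norm_ge_zero[of e] by linarith
  have t: "0 < t" unfolding t_def using r0 ne by simp
  have "norm (t *\<^sub>R e) < r"
  proof -
    have "norm (t *\<^sub>R e) = t * norm e" using t by simp
    also have "\<dots> \<le> t * (1 + norm e)" using t by simp
    also have "\<dots> = r / 2" using nonzero_divide_eq_eq[of "1 + norm e" "r / 2" t] ne unfolding t_def by simp
    finally show ?thesis using r0 by simp
  qed
  define x where "x = chart_map c p + t *\<^sub>R e"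
  have xb: "x \<in> ball (chart_map c p) r" unfolding x_def using \<open>norm (t *\<^sub>R e) < r\<close> by (simp add: dist_norm)
  have BB: "active_dirs c p - {b} \<subseteq> Basis" "b \<in> Basis" using active_dirs_subset[OF c] b by auto
  have x0: "x \<bullet> b = 0" unfolding x_def e_def using b sum_Basis_inner[OF BB] by (simp add: inner_add_left active_dirs_iff)
  have xp: "0 < x \<bullet> b'" if b': "b' \<in> chart_dirs c - {b}" for b'
  proof (cases "b' \<in> active_dirs c p")
    case True
    then have "b' \<in> Basis" using active_dirs_subset[OF c] by blast
    then have "e \<bullet> b' = 1" unfolding e_def using sum_Basis_inner[OF BB(1)] True b' by auto
    then show ?thesis unfolding x_def using t True by (simp add: inner_add_left active_dirs_iff)
  next
    case False
    then show ?thesis using pos b' xb ball_subset_cball by blast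
  qed
  have "x \<in> corner c" unfolding model_corner_def
    using x0 xp by (auto simp: less_imp_le) (metis DiffI empty_iff insert_iff less_imp_le order_refl)
  then have "x \<in> img c" using r xb ball_subset_cball by blast
  then have "chart_inv c x \<in> facet c p r b" unfolding facet_def using xb x0 xp by simp
  then show ?thesis by blast
qed

text \<open>The number \<open>r\<close> is at once the radius of a coordinate ball and the constant
  of every comparison in it. The two clauses with \<open>comparable\<close> match hypersurfaces
  through \<open>p\<close> with active directions, one from each side.\<close>

definition adapted_radius :: "('a, 'e) chart \<Rightarrow> 'a \<Rightarrow> real \<Rightarrow> bool" where
  "adapted_radius c p r \<longleftrightarrow> (0 < r \<and> r \<le> 1) \<and>
      cball (chart_map c p) r \<inter> corner c \<subseteq> img c \<and>
      (\<forall>x\<in>cball (chart_map c p) r. \<forall>b\<in>chart_dirs c - active_dirs c p. 0 < x \<bullet> b) \<and>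
      (\<forall>q\<in>chart_dom c. chart_map c q \<in> cball (chart_map c p) r \<longrightarrow>
         (\<forall>v. r * norm v \<le> sqrt (g c q v v) \<and> sqrt (g c q v v) \<le> norm v / r)) \<and>
      (\<forall>i\<in>{i\<in>{1..N}. p \<in> H i}. \<exists>b\<in>active_dirs c p. comparable c p i b r) \<and>
      (\<forall>b\<in>active_dirs c p. \<exists>i\<in>{1..N}. p \<in> H i \<and> comparable c p i b r) \<and>
      (\<forall>i\<in>{i\<in>{1..N}. p \<notin> H i}. \<forall>q\<in>chart_dom c. chart_map c q \<in> cball (chart_map c p) r \<longrightarrow> r \<le> \<rho> i q)"

lemma adapted_radius_exists:
  assumes c: "c \<in> A" and p: "p \<in> chart_dom c"
  shows "\<exists>r. adapted_radius c p r"
proof -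
  have pX: "p \<in> topspace X" using dom_subset[OF c] p by blast
  have "\<forall>\<^sub>F s in at_right 0. cball (chart_map c p) s \<inter> corner c \<subseteq> img c
      \<and> (\<forall>x\<in>cball (chart_map c p) s. \<forall>b\<in>chart_dirs c - active_dirs c p. 0 < x \<bullet> b) \<and> 0 < s"
    by (intro eventually_conj eventually_chart_cball[OF c p] eventually_inactive_pos[OF c p] eventually_at_right_less)
  then obtain s where s: "cball (chart_map c p) s \<inter> corner c \<subseteq> img c"
    "\<forall>x\<in>cball (chart_map c p) s. \<forall>b\<in>chart_dirs c - active_dirs c p. 0 < x \<bullet> b" "0 < s"
    using eventually_happens'[OF trivial_limit_at_right_real] by blast
  have 1: "\<forall>\<^sub>F r in at_right 0. \<exists>b\<in>active_dirs c p. comparable c p i b r" if i: "i \<in> {1..N}" "p \<in> H i" for i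
  proof -
    obtain b where b: "b \<in> active_dirs c p" "facet c p s b \<subseteq> H i"
      using hypersurface_contains_facet[OF c p i s(3,1,2)] by blast
    show ?thesis using facet_comparable[OF c p b(1) s(3) i(1) b(2)] by eventually_elim (use b in blast)
  qed
  have 2: "\<forall>\<^sub>F r in at_right 0. \<exists>i\<in>{1..N}. p \<in> H i \<and> comparable c p i b r" if b: "b \<in> active_dirs c p" for b
  proof -
    obtain i where i: "i \<in> {1..N}" "facet c p s b \<subseteq> H i"
      using facet_subset_hypersurface[OF c p b s(1) facet_nonempty[OF c p b s(3,1,2)]] by blast
    have ev: "\<forall>\<^sub>F r in at_right 0. comparable c p i b r \<and> 0 < r"
      using facet_comparable[OF c p b s(3) i] eventually_at_right_less by (rule eventually_conj)
    then show ?thesis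
    proof eventually_elim
      case (elim r)
      \<comment> \<open>At \<open>q = p\<close> the coordinate \<open>b\<close> is 0, so
        comparability forces \<open>\<rho> i p = 0\<close>. Thus the hypersurface found from the
        facet passes through \<open>p\<close>.\<close>
      then have "\<rho> i p \<le> (chart_map c p \<bullet> b) / r" using p unfolding comparable_def by simp
      then have "\<rho> i p = 0" using b \<rho>_nonneg[OF i(1) pX] unfolding active_dirs_iff by simp
      then show ?case using H_iff[OF i(1) pX] elim i(1) by blast
    qed
  qed
  have 3: "\<forall>\<^sub>F r in at_right 0. \<forall>q\<in>chart_dom c. chart_map c q \<in> cball (chart_map c p) r \<longrightarrow> r \<le> \<rho> i q"
    if i: "i \<in> {1..N}" "p \<notin> H i" for i
  proof -
    have "continuous_on (img c) (\<rho> i \<circ> chart_inv c)"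
      using smooth_map_on_continuous \<rho>_smooth[OF i(1)] c unfolding smooth_function_def by blast
    then obtain \<delta> where \<delta>: "\<delta> > 0" "\<forall>x\<in>img c. dist x (chart_map c p) < \<delta> \<longrightarrow>
        dist ((\<rho> i \<circ> chart_inv c) x) ((\<rho> i \<circ> chart_inv c) (chart_map c p)) < \<rho> i p / 2"
      using p \<rho>_pos[OF i(1) pX i(2)] unfolding continuous_on_iff by (metis half_gt_zero image_eqI)
    have "0 < min (\<delta>/2) (\<rho> i p / 2)" using \<delta>(1) \<rho>_pos[OF i(1) pX i(2)] by simp
    then show ?thesis
    proof (rule eventually_small_radius, intro ballI impI)
      fix r q assume r: "0 < r" "r \<le> min (\<delta>/2) (\<rho> i p / 2)"
        and q: "q \<in> chart_dom c" "chart_map c q \<in> cball (chart_map c p) r"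
      have "dist (chart_map c q) (chart_map c p) < \<delta>" using q(2) r \<delta>(1) by (auto simp: dist_commute)
      then have "dist (\<rho> i q) (\<rho> i p) < \<rho> i p / 2" using \<delta>(2) q(1) c p by force
      moreover have "r \<le> \<rho> i p / 2" using r by simp
      ultimately show "r \<le> \<rho> i q" unfolding dist_real_def by linarith
    qed
  qed
  have e1: "\<forall>\<^sub>F r in at_right (0::real). 0 < r \<and> r \<le> 1"
    unfolding eventually_at_right_field by (intro exI[of _ 1]) auto
  have e5: "\<forall>\<^sub>F r in at_right 0. \<forall>i\<in>{i\<in>{1..N}. p \<in> H i}. \<exists>b\<in>active_dirs c p. comparable c p i b r"
    by (rule eventually_ball_finite) (use 1 in auto)
  have e6: "\<forall>\<^sub>F r in at_right 0. \<forall>b\<in>active_dirs c p. \<exists>i\<in>{1..N}. p \<in> H i \<and> comparable c p i b r"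
    by (rule eventually_ball_finite[OF finite_active_dirs[OF c]]) (use 2 in blast)
  have e7: "\<forall>\<^sub>F r in at_right 0. \<forall>i\<in>{i\<in>{1..N}. p \<notin> H i}. \<forall>q\<in>chart_dom c. chart_map c q \<in> cball (chart_map c p) r \<longrightarrow> r \<le> \<rho> i q"
    by (rule eventually_ball_finite) (use 3 in auto)
  have "\<forall>\<^sub>F r in at_right 0. adapted_radius c p r" unfolding adapted_radius_def
    by (intro eventually_conj[OF e1] eventually_conj[OF eventually_chart_cball[OF c p]]
      eventually_conj[OF eventually_inactive_pos[OF c p]] eventually_conj[OF eventually_metric_bounds[OF c p]]
      eventually_conj[OF e5] eventually_conj[OF e6 e7])
  from eventually_happens'[OF trivial_limit_at_right_real this] show ?thesis .
qed

end

section \<open>The weighted metric near an open face\<close>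

locale sigma_faces = corner_faces X A g N H \<rho>
  for X :: "'a topology" and A :: "('a, 'e::euclidean_space) chart set" and g N H \<rho> +
  fixes \<alpha> :: "nat \<Rightarrow> real" and I :: "nat set"
  assumes \<alpha>_nonneg: "i \<in> {1..N} \<Longrightarrow> 0 \<le> \<alpha> i"
    and I_ne: "I \<noteq> {}" and I_sub: "I \<subseteq> {1..N}"
begin

definition weight :: "'a \<Rightarrow> real" where
  "weight q = (\<Sum>i=1..N. \<rho> i q powr (- \<alpha> i))"

definition M :: real where "M = Max (\<alpha> ` I)"

lemma M_ge: "i \<in> I \<Longrightarrow> \<alpha> i \<le> M"
  unfolding M_def using I_sub finite_subset by (intro Max_ge) auto

lemma M_attained: "\<exists>i\<in>I. \<alpha> i = M"
proof -
  have "finite I" using I_sub finite_subset by blast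
  then have "M \<in> \<alpha> ` I" unfolding M_def using I_ne by (intro Max_in) auto
  then show ?thesis by auto
qed

lemma M_nonneg: "0 \<le> M"
  using M_attained \<alpha>_nonneg I_sub by (metis subsetD)

lemma weight_nonneg: "0 \<le> weight q"
  unfolding weight_def by (simp add: sum_nonneg)

text \<open>Continuity of the weight rests on positivity of every \<open>\<rho> i\<close> on the
  interior, where the powers have positive bases.\<close>

sublocale Sg: corner_weighted X A g weight "corner_interior X A"
proof
  show "corner_interior X A \<subseteq> topspace X" unfolding corner_interior_def by blast
  show "continuous_map (subtopology X (corner_interior X A)) euclideanreal weight"
    unfolding weight_def
  proof (intro continuous_map_sum)
    fix i assume i: "i \<in> {1..N}"
    have "continuous_map (subtopology X (corner_interior X A)) (top_of_set {0<..}) (\<rho> i)"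
      using continuous_map_from_subtopology[OF \<rho>_continuous[OF i]] \<rho>_pos_interior[OF i]
      by (auto simp: continuous_map_in_subtopology)
    moreover have "continuous_map (top_of_set {0<..}) euclideanreal (\<lambda>x. x powr (- \<alpha> i))"
      by (auto intro!: continuous_intros)
    ultimately show "continuous_map (subtopology X (corner_interior X A)) euclideanreal (\<lambda>q. \<rho> i q powr (- \<alpha> i))"
      using continuous_map_compose[of _ _ "\<rho> i" _ "\<lambda>x. x powr (- \<alpha> i)"] by (simp add: comp_def)
  qed simp
  show "0 \<le> weight q" for q by (rule weight_nonneg)
qed

sublocale Fc: corner_weighted X A g "\<lambda>_. 1" "open_face X N H I"
  by unfold_locales (auto simp: open_face_def)

lemma Sg_dst: "Sg.dst = riemannian_dist X A (sigma_metric N \<rho> \<alpha> g) (corner_interior X A)"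
proof -
  have "Sg.G = sigma_metric N \<rho> \<alpha> g"
    by (intro ext) (simp add: Sg.G_def sigma_metric_def weight_def)
  then show ?thesis unfolding Sg.dst_def by simp
qed

lemma Fc_dst: "Fc.dst = riemannian_dist X A g (open_face X N H I)"
proof -
  have "Fc.G = g" by (intro ext) (simp add: Fc.G_def)
  then show ?thesis unfolding Fc.dst_def by simp
qed

sublocale D: ennreal_dist Sg.dst "corner_interior X A"
  by unfold_locales (rule Sg.dst_sym, rule Sg.dst_triangle)

end

locale sigma_local = sigma_faces X A g N H \<rho> \<alpha> I
  for X :: "'a topology" and A :: "('a, 'e::euclidean_space) chart set" and g N H \<rho> \<alpha> I +
  fixes c :: "('a, 'e) chart" and p :: 'a and r :: real
  assumes c: "c \<in> A" and p: "p \<in> chart_dom c" and pF: "p \<in> open_face X N H I"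
    and adapted: "adapted_radius c p r"
begin

abbreviation Xint :: "'a set" where "Xint \<equiv> corner_interior X A"
abbreviation F :: "'a set" where "F \<equiv> open_face X N H I"
abbreviation bdist :: "'a \<Rightarrow> 'a \<Rightarrow> ennreal" where "bdist \<equiv> boundary_dist X Xint Sg.dst"

abbreviation \<phi> :: "'a \<Rightarrow> 'e" where "\<phi> \<equiv> chart_map c"

definition x0 :: 'e where "x0 = \<phi> p"
definition K :: "'e set" where "K = active_dirs c p"
definition e :: 'e where "e = \<Sum>K"
definition \<theta> :: real where "\<theta> = 1 - M / 2"

lemma r0: "0 < r" and r1: "r \<le> 1"
  and chart_r: "cball x0 r \<inter> corner c \<subseteq> img c"
  and inactive: "x \<in> cball x0 r \<Longrightarrow> b \<in> chart_dirs c - K \<Longrightarrow> 0 < x \<bullet> b"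
  and metric_r: "q \<in> chart_dom c \<Longrightarrow> \<phi> q \<in> cball x0 r \<Longrightarrow>
    r * norm v \<le> sqrt (g c q v v) \<and> sqrt (g c q v v) \<le> norm v / r"
  and hypersurface_dir: "i \<in> {1..N} \<Longrightarrow> p \<in> H i \<Longrightarrow> \<exists>b\<in>K. comparable c p i b r"
  and dir_hypersurface: "b \<in> K \<Longrightarrow> \<exists>i\<in>{1..N}. p \<in> H i \<and> comparable c p i b r"
  and far: "i \<in> {1..N} \<Longrightarrow> p \<notin> H i \<Longrightarrow> q \<in> chart_dom c \<Longrightarrow> \<phi> q \<in> cball x0 r \<Longrightarrow> r \<le> \<rho> i q"
  using adapted unfolding adapted_radius_def x0_def K_def by (blast, blast, blast, blast, blast, blast, blast, blast)

section \<open>The interior, the face and the weight in coordinates near p\<close>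

lemma I_iff: "i \<in> I \<longleftrightarrow> i \<in> {1..N} \<and> p \<in> H i"
  using pF unfolding open_face_def by blast

lemma K_Basis: "K \<subseteq> Basis"
  unfolding K_def by (rule active_dirs_subset[OF c])

lemma x0_K: "b \<in> K \<Longrightarrow> x0 \<bullet> b = 0"
  unfolding K_def x0_def active_dirs_iff by blast

lemma e_K: "b \<in> K \<Longrightarrow> e \<bullet> b = 1"
  unfolding e_def using sum_Basis_inner[OF K_Basis] K_Basis by auto

lemma inner_le_dist:
  assumes "b \<in> K" "y \<bullet> b = 0" shows "x \<bullet> b \<le> dist x y"
proof -
  have "x \<bullet> b = (x - y) \<bullet> b" using assms(2) by (simp add: inner_diff_left)
  also have "\<dots> \<le> norm (x - y)" using Basis_le_norm[of b "x - y"] K_Basis assms(1) by auto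
  finally show ?thesis by (simp add: dist_norm)
qed

lemma coord_nonneg: "q \<in> chart_dom c \<Longrightarrow> b \<in> K \<Longrightarrow> 0 \<le> \<phi> q \<bullet> b"
  using img_corner[OF c] unfolding K_def model_corner_def active_dirs_iff by blast

lemma img_iff:
  assumes "x \<in> cball x0 r" "\<forall>b\<in>K. 0 \<le> x \<bullet> b" shows "x \<in> img c"
proof -
  have "x \<in> corner c"
    unfolding model_corner_def using assms inactive[of x] less_imp_le by blast
  then show ?thesis using chart_r assms(1) by blast
qed

lemma interior_local:
  assumes "q \<in> chart_dom c" "\<phi> q \<in> cball x0 r"
  shows "q \<in> Xint \<longleftrightarrow> (\<forall>b\<in>K. 0 < \<phi> q \<bullet> b)"
proof -
  have "0 < \<phi> q \<bullet> b" if "b \<in> chart_dirs c" "b \<notin> K" for b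
    using inactive[of "\<phi> q" b] assms(2) that by blast
  moreover have "K \<subseteq> chart_dirs c" unfolding K_def active_dirs_def by blast
  ultimately show ?thesis using interior_iff[OF c assms(1)] by blast
qed

lemma comparableD:
  assumes "comparable c p i b r" "q \<in> chart_dom c" "\<phi> q \<in> cball x0 r"
  shows "r * (\<phi> q \<bullet> b) \<le> \<rho> i q" "\<rho> i q \<le> (\<phi> q \<bullet> b) / r"
  using assms unfolding comparable_def x0_def by blast+

text \<open>Comparability converts membership in hypersurfaces into vanishing of coordinates: each
  active direction has an index in \<open>I\<close>, each index in \<open>I\<close> has an active
  direction, and the remaining hypersurfaces miss the ball.\<close>

lemma face_local:
  assumes q: "q \<in> chart_dom c" "\<phi> q \<in> cball x0 r"
  shows "q \<in> F \<longleftrightarrow> (\<forall>b\<in>K. \<phi> q \<bullet> b = 0)"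
proof
  have qX: "q \<in> topspace X" using dom_subset[OF c] q by blast
  {
    assume "q \<in> F"
    then have qI: "i \<in> I \<Longrightarrow> q \<in> H i" for i unfolding open_face_def by blast
    show "\<forall>b\<in>K. \<phi> q \<bullet> b = 0"
    proof
      fix b assume b: "b \<in> K"
      then obtain i where i: "i \<in> {1..N}" "p \<in> H i" "comparable c p i b r"
        using dir_hypersurface by blast
      then have "\<rho> i q = 0" using qI I_iff H_iff[OF i(1) qX] by blast
      then have "r * (\<phi> q \<bullet> b) \<le> 0" using comparableD(1)[OF i(3) q] by simp
      then show "\<phi> q \<bullet> b = 0" using r0 coord_nonneg[OF q(1) b] by (simp add: mult_le_0_iff)
    qed
  }
  assume K0: "\<forall>b\<in>K. \<phi> q \<bullet> b = 0"
  have "q \<in> H i \<longleftrightarrow> i \<in> I" if i: "i \<in> {1..N}" for i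
  proof
    assume "i \<in> I"
    then obtain b where b: "b \<in> K" "comparable c p i b r" using hypersurface_dir I_iff by blast
    then have "\<rho> i q \<le> 0" using comparableD(2)[OF b(2) q] K0 by simp
    then show "q \<in> H i" using \<rho>_nonneg[OF i qX] H_iff[OF i qX] by simp
  next
    assume "q \<in> H i"
    then have "\<rho> i q = 0" using H_iff[OF i qX] by simp
    then have "p \<in> H i" using far[OF i _ q(1)] q(2) r0 by force
    then show "i \<in> I" using I_iff i by blast
  qed
  then show "q \<in> F" unfolding open_face_def using qX I_sub by blast
qed

definition \<Lambda> :: real where "\<Lambda> = (\<Sum>i=1..N. r powr (- \<alpha> i))"

lemma \<Lambda>_nonneg: "0 \<le> \<Lambda>"
  unfolding \<Lambda>_def by (simp add: sum_nonneg)

text \<open>A summand with index in \<open>I\<close> is at most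
  \<open>(r * s) powr (- \<alpha> i)\<close>, and \<open>s \<le> 1\<close> allows
  \<open>\<alpha> i\<close> to be replaced by \<open>M\<close> in the power of \<open>s\<close>. The
  others are bounded by their summand of \<open>\<Lambda>\<close>, and \<open>s powr (- M)\<close>
  is at least 1.\<close>

lemma weight_upper:
  assumes q: "q \<in> chart_dom c" "\<phi> q \<in> cball x0 r" and s: "0 < s" "s \<le> 1" "\<forall>b\<in>K. s \<le> \<phi> q \<bullet> b"
  shows "weight q \<le> \<Lambda> * s powr (- M)"
proof -
  have "\<rho> i q powr (- \<alpha> i) \<le> r powr (- \<alpha> i) * s powr (- M)" if i: "i \<in> {1..N}" for i
  proof (cases "i \<in> I")
    case True
    then obtain b where b: "b \<in> K" "comparable c p i b r" using hypersurface_dir I_iff by blast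
    have "r * s \<le> r * (\<phi> q \<bullet> b)" using s(3) b(1) r0 by simp
    also have "\<dots> \<le> \<rho> i q" by (rule comparableD(1)[OF b(2) q])
    finally have "\<rho> i q powr (- \<alpha> i) \<le> (r * s) powr (- \<alpha> i)"
      using \<alpha>_nonneg[OF i] r0 s(1) by (intro powr_mono2') auto
    also have "\<dots> = r powr (- \<alpha> i) * s powr (- \<alpha> i)" using r0 s(1) by (simp add: powr_mult)
    also have "\<dots> \<le> r powr (- \<alpha> i) * s powr (- M)"
      using M_ge[OF True] s by (intro mult_left_mono powr_mono') auto
    finally show ?thesis .
  next
    case False
    then have "r \<le> \<rho> i q" using far[OF i _ q(1)] I_iff i q(2) by blast
    then have "\<rho> i q powr (- \<alpha> i) \<le> r powr (- \<alpha> i)"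
      using \<alpha>_nonneg[OF i] r0 by (intro powr_mono2') auto
    also have "\<dots> \<le> r powr (- \<alpha> i) * s powr (- M)"
    proof -
      have "s powr 0 \<le> s powr (- M)" using M_nonneg s by (intro powr_mono') auto
      then have "1 \<le> s powr (- M)" using s by simp
      then show ?thesis using mult_left_mono[of 1 "s powr (- M)" "r powr (- \<alpha> i)"] by simp
    qed
    finally show ?thesis .
  qed
  then show ?thesis unfolding weight_def \<Lambda>_def sum_distrib_right by (rule sum_mono)
qed

text \<open>The direction belongs to an index with exponent \<open>M\<close>, whose summand alone
  bounds the weight from below. It is chosen before \<open>q\<close> and \<open>s\<close>, so it
  serves a whole curve. The factor \<open>r powr M\<close> comes from
  \<open>\<rho> i q \<le> s / r\<close>.\<close>

lemma worst_dir:
  obtains b where "b \<in> K"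
    "\<And>q s. q \<in> Xint \<Longrightarrow> q \<in> chart_dom c \<Longrightarrow> \<phi> q \<in> cball x0 r \<Longrightarrow> \<phi> q \<bullet> b \<le> s
      \<Longrightarrow> r powr M * s powr (- M) \<le> weight q"
proof -
  obtain i where i: "i \<in> I" "\<alpha> i = M" using M_attained by blast
  then obtain b where b: "b \<in> K" "comparable c p i b r" using hypersurface_dir I_iff by blast
  have iN: "i \<in> {1..N}" using i I_sub by blast
  show thesis
  proof (rule that[OF b(1)])
    fix q s assume q: "q \<in> Xint" "q \<in> chart_dom c" "\<phi> q \<in> cball x0 r" "\<phi> q \<bullet> b \<le> s"
    have pos: "0 < \<rho> i q" by (rule \<rho>_pos_interior[OF iN q(1)])
    have "\<rho> i q \<le> (\<phi> q \<bullet> b) / r" by (rule comparableD(2)[OF b(2) q(2,3)])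
    also have "\<dots> \<le> s / r" using q(4) r0 by (simp add: divide_right_mono)
    finally have le: "\<rho> i q \<le> s / r" .
    then have s: "0 < s" using pos r0 by (smt (verit) divide_nonpos_pos)
    have "r powr M * s powr (- M) = (s / r) powr (- M)"
      using r0 s by (simp add: powr_divide powr_minus field_simps)
    also have "\<dots> \<le> \<rho> i q powr (- \<alpha> i)" unfolding i(2) using M_nonneg pos le by (intro powr_mono2') auto
    also have "\<dots> \<le> weight q" unfolding weight_def using iN by (intro member_le_sum) auto
    finally show "r powr M * s powr (- M) \<le> weight q" .
  qed
qed

text \<open>The square root of the lower bound on the weight contributes
  \<open>r powr (M / 2)\<close>, the lower bound on the smooth metric the other factor
  \<open>r\<close>.\<close>

definition \<kappa> :: real where "\<kappa> = r powr (M / 2) * r"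

lemma \<kappa>_pos: "0 < \<kappa>"
  unfolding \<kappa>_def using r0 by simp

text \<open>All points of \<open>X\<^sup>\<circ>\<close> with coordinates in the ball of radius \<open>s\<close> about the face point \<open>y\<close> lie
  within \<open>s\<close> of the hypersurface with the largest exponent, so leaving the ball is expensive.\<close>

lemma Sg_exit:
  assumes y: "cball y s \<subseteq> cball x0 r" "\<forall>b\<in>K. y \<bullet> b = 0"
    and q: "q \<in> chart_dom c" "dist (\<phi> q) y \<le> \<epsilon>" "\<epsilon> < s"
    and q': "\<not> (q' \<in> chart_dom c \<and> dist (\<phi> q') y < s)"
  shows "ennreal (\<kappa> * s powr (- M / 2) * (s - \<epsilon>)) \<le> Sg.dst q q'"
proof -
  obtain b where b: "b \<in> K"
    "\<And>q s. q \<in> Xint \<Longrightarrow> q \<in> chart_dom c \<Longrightarrow> \<phi> q \<in> cball x0 r \<Longrightarrow> \<phi> q \<bullet> b \<le> s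
      \<Longrightarrow> r powr M * s powr (- M) \<le> weight q" using worst_dir by blast
  show ?thesis
  proof (rule Sg.dst_exit_bound[OF c _ _ _ q q'])
    show "cball y s \<inter> corner c \<subseteq> img c"
      using y(1) chart_r by blast
    show "0 \<le> \<kappa> * s powr (- M / 2)" using \<kappa>_pos by simp
    fix q v assume qq: "q \<in> chart_dom c" "q \<in> Xint" "\<phi> q \<in> cball y s"
    have qx: "\<phi> q \<in> cball x0 r" using qq(3) y(1) by blast
    have "\<phi> q \<bullet> b \<le> s"
      using inner_le_dist[OF b(1), of y "\<phi> q"] y(2) b(1) qq(3) by (auto simp: dist_commute)
    then have "r powr M * s powr (- M) \<le> weight q" using b(2) qq(1,2) qx by blast
    then have "sqrt (r powr M * s powr (- M)) \<le> sqrt (weight q)" by simp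
    moreover have "sqrt (r powr M * s powr (- M)) = r powr (M / 2) * s powr (- M / 2)"
      by (simp add: real_sqrt_mult powr_half_sqrt[symmetric] powr_powr)
    moreover have "r * norm v \<le> sqrt (g c q v v)" using metric_r qq(1) qx by blast
    ultimately have "(r powr (M / 2) * s powr (- M / 2)) * (r * norm v) \<le> sqrt (weight q) * sqrt (g c q v v)"
      using r0 weight_nonneg by (intro mult_mono) auto
    then show "\<kappa> * s powr (- M / 2) * norm v \<le> sqrt (weight q * g c q v v)"
      unfolding \<kappa>_def by (simp add: real_sqrt_mult mult_ac)
  qed
qed

section \<open>Accessibility and the threshold M = 2\<close>

lemma chart_nbhd_eventually:
  assumes x: "limitin X x z sequentially" and z: "z \<in> chart_dom c" and \<delta>: "0 < \<delta>"
  shows "\<forall>\<^sub>F n in sequentially. x n \<in> chart_dom c \<and> dist (\<phi> (x n)) (\<phi> z) < \<delta>"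
proof -
  have "openin X {q \<in> chart_dom c. \<phi> q \<in> ball (\<phi> z) \<delta>}"
    by (rule openin_chart_vimage[OF c]) simp
  moreover have "z \<in> {q \<in> chart_dom c. \<phi> q \<in> ball (\<phi> z) \<delta>}" using z \<delta> by simp
  ultimately have "\<forall>\<^sub>F n in sequentially. x n \<in> {q \<in> chart_dom c. \<phi> q \<in> ball (\<phi> z) \<delta>}"
    using x unfolding limitin_def by blast
  then show ?thesis by eventually_elim (auto simp: dist_commute)
qed

lemma K_ne: "K \<noteq> {}"
proof -
  obtain i where "i \<in> I" using I_ne by blast
  then have "\<exists>b\<in>K. comparable c p i b r" using hypersurface_dir[of i] I_iff by simp
  then show ?thesis by blast
qed

text \<open>If \<open>M \<ge> 2\<close>, then by the exit bound the points of \<open>X\<^sup>\<circ>\<close> close to \<open>p\<close> keep a fixed distance from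
  any given point.\<close>

lemma accessible_imp_M_less:
  assumes "accessible_point X (Xint) Sg.dst p"
  shows "M < 2"
proof (rule ccontr)
  assume "\<not> M < 2"
  then have M2: "2 \<le> M" by simp
  obtain x where x: "x \<in> cauchy_seqs (Xint) Sg.dst" "limitin X x p sequentially"
    using assms unfolding accessible_point_def by blast
  have "0 < ennreal (\<kappa> / 2)" using \<kappa>_pos by simp
  then obtain m0 where m0: "\<forall>m\<ge>m0. \<forall>n\<ge>m0. Sg.dst (x m) (x n) < ennreal (\<kappa> / 2)"
    using x(1) unfolding cauchy_seqs_def by blast
  have "\<forall>\<^sub>F m in sequentially. (x m \<in> chart_dom c \<and> dist (\<phi> (x m)) (\<phi> p) < r) \<and> m0 \<le> m"
    by (intro eventually_conj chart_nbhd_eventually[OF x(2) p r0] eventually_ge_at_top)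
  then obtain m where m: "x m \<in> chart_dom c" "dist (\<phi> (x m)) x0 < r" "m0 \<le> m"
    using eventually_happens'[OF sequentially_bot] unfolding x0_def by blast
  \<comment> \<open>\<open>x m\<close> is in the interior, so \<open>s\<close> is positive: a fixed
    scale that later terms of the sequence must undercut.\<close>
  define s where "s = dist (\<phi> (x m)) x0"
  have s: "0 < s" "s \<le> 1"
  proof -
    obtain b where b: "b \<in> K" using K_ne by blast
    have "x m \<in> Xint" using x(1) unfolding cauchy_seqs_def by blast
    then have "0 < \<phi> (x m) \<bullet> b" using interior_local[OF m(1)] m(2) b by (auto simp: dist_commute)
    then show "0 < s" unfolding s_def using x0_K[OF b] by auto
    show "s \<le> 1" using m(2) r1 unfolding s_def by simp
  qed
  have "\<forall>\<^sub>F n in sequentially. (x n \<in> chart_dom c \<and> dist (\<phi> (x n)) (\<phi> p) < s / 2) \<and> m0 \<le> n"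
    using s by (intro eventually_conj chart_nbhd_eventually[OF x(2) p] eventually_ge_at_top) auto
  then obtain n where n: "x n \<in> chart_dom c" "dist (\<phi> (x n)) x0 < s / 2" "m0 \<le> n"
    using eventually_happens'[OF sequentially_bot] unfolding x0_def by blast
  have "ennreal (\<kappa> * s powr (- M / 2) * (s - s / 2)) \<le> Sg.dst (x n) (x m)"
  proof (rule Sg_exit)
    show "cball x0 s \<subseteq> cball x0 r" using m(2) unfolding s_def by (intro subset_cball) simp
    show "\<forall>b\<in>K. x0 \<bullet> b = 0" using x0_K by blast
  qed (use n s in \<open>auto simp: s_def\<close>)
  \<comment> \<open>Crossing from radius \<open>s / 2\<close> to \<open>s\<close> costs
    \<open>\<kappa> / 2 * s powr (1 - M / 2)\<close>. For \<open>M \<ge> 2\<close> and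
    \<open>s \<le> 1\<close> the power is at least 1, so the cost does not shrink with
    \<open>s\<close>.\<close>
  moreover have "\<kappa> / 2 \<le> \<kappa> * s powr (- M / 2) * (s - s / 2)"
  proof -
    have "s powr 0 \<le> s powr (1 - M / 2)" using s M2 by (intro powr_mono') auto
    then have "1 \<le> s powr (- M / 2) * s" using s powr_add[of s 1 "- M / 2"] by (simp add: mult.commute)
    then have "\<kappa> / 2 * 1 \<le> \<kappa> / 2 * (s powr (- M / 2) * s)" using \<kappa>_pos by (intro mult_left_mono) auto
    then show ?thesis by (simp add: algebra_simps)
  qed
  ultimately have "ennreal (\<kappa> / 2) \<le> Sg.dst (x n) (x m)" using ennreal_leI order_trans by blast
  then show False using m0 m(3) n(3) not_le by blast
qed

text \<open>Two points of the ball of radius \<open>R\<close> are at most \<open>2 * R\<close>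
  apart, so they will be raised by at most \<open>2 * R\<close> along \<open>e\<close>. The
  denominator keeps the raised points in the ball of radius \<open>r\<close>.\<close>

definition R :: real where "R = r / (2 * (1 + 2 * norm e))"

lemma R: "0 < R" "2 * R \<le> r" "R + 2 * R * norm e \<le> r"
proof -
  have ne: "0 < 1 + 2 * norm e" using norm_ge_zero[of e] by linarith
  have R1: "R * (1 + 2 * norm e) = r / 2" unfolding R_def using ne by (simp add: field_simps)
  show "0 < R" unfolding R_def using ne r0 by simp
  then have "0 \<le> R * (2 * norm e)" by simp
  then show "2 * R \<le> r" "R + 2 * R * norm e \<le> r" using R1 r0 by (auto simp: algebra_simps)
qed

text \<open>\<open>sqrt \<Lambda>\<close> comes from the weight, \<open>1 / r\<close> from the
  smooth metric.\<close>

definition B :: real where "B = sqrt \<Lambda> / r"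

lemma B_nonneg: "0 \<le> B"
  unfolding B_def using \<Lambda>_nonneg r0 by simp

section \<open>Upper bound between interior points\<close>

lemma speed_upper:
  assumes q: "q \<in> chart_dom c" "\<phi> q \<in> cball x0 r" and t: "0 < t" "t \<le> 1" "\<forall>b\<in>K. t \<le> \<phi> q \<bullet> b"
  shows "sqrt (weight q * g c q v v) \<le> B * t powr (- M / 2) * norm v"
proof -
  have "sqrt (weight q) \<le> sqrt (\<Lambda> * t powr (- M))" using weight_upper[OF q t] by simp
  also have "\<dots> = sqrt \<Lambda> * t powr (- M / 2)"
    by (simp add: real_sqrt_mult powr_half_sqrt[symmetric] powr_powr)
  finally have "sqrt (weight q) \<le> sqrt \<Lambda> * t powr (- M / 2)" .
  moreover have "sqrt (g c q v v) \<le> norm v / r" using metric_r q by blast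
  ultimately have "sqrt (weight q) * sqrt (g c q v v) \<le> (sqrt \<Lambda> * t powr (- M / 2)) * (norm v / r)"
    using weight_nonneg metric_nonneg[OF c q(1)] \<Lambda>_nonneg by (intro mult_mono) auto
  then show ?thesis unfolding B_def by (simp add: real_sqrt_mult)
qed

lemma interior_point:
  assumes "x \<in> cball x0 r" "\<forall>b\<in>K. 0 < x \<bullet> b"
  shows "x \<in> img c" "chart_inv c x \<in> Xint"
proof -
  show img: "x \<in> img c" by (rule img_iff) (use assms less_imp_le in blast)+
  then show "chart_inv c x \<in> Xint"
    using interior_local[of "chart_inv c x"] assms by simp
qed

lemma shift_cball:
  assumes "x \<in> cball x0 R" "0 \<le> t" "t \<le> 2 * R" shows "x + t *\<^sub>R e \<in> cball x0 r"
proof -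
  have "dist x0 (x + t *\<^sub>R e) \<le> dist x0 x + dist x (x + t *\<^sub>R e)" by (rule dist_triangle)
  also have "dist x (x + t *\<^sub>R e) = t * norm e" using assms(2) by (simp add: dist_norm)
  also have "\<dots> \<le> 2 * R * norm e" using assms(3) by (intro mult_right_mono) auto
  finally show ?thesis using assms(1) R(3) by simp
qed

lemma shift_inner: "b \<in> K \<Longrightarrow> (x + t *\<^sub>R e) \<bullet> b = x \<bullet> b + t"
  by (simp add: inner_add_left e_K)

text \<open>At height \<open>t\<close> above \<open>x\<close> every active coordinate is at least
  \<open>t\<close>, however close \<open>x\<close> is to the boundary. The resulting bound on the
  speed is integrable down to 0 because \<open>M < 2\<close>, which is the source of the factor
  \<open>1 / \<theta>\<close>.\<close>

lemma vertical_bound: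
  assumes M: "M < 2" and x: "x \<in> cball x0 R" "\<forall>b\<in>K. 0 < x \<bullet> b" and s: "0 < s" "s \<le> 2 * R"
  shows "Sg.dst (chart_inv c x) (chart_inv c (x + s *\<^sub>R e)) \<le> ennreal (B * norm e / \<theta> * s powr \<theta>)"
proof -
  have pt: "x + t *\<^sub>R e \<in> cball x0 r" "\<forall>b\<in>K. 0 < (x + t *\<^sub>R e) \<bullet> b" if "t \<in> {0..s}" for t
    using shift_cball[OF x(1), of t] that s x(2) by (auto simp: shift_inner add_pos_nonneg)
  have "Sg.dst (chart_inv c (x + 0 *\<^sub>R e)) (chart_inv c (x + s *\<^sub>R e))
      \<le> ennreal ((B * norm e) * (s powr (- M / 2 + 1) / (- M / 2 + 1)))"
  proof (rule Sg.dst_segment_le[OF c s(1)])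
    fix t assume t: "t \<in> {0..s}"
    show "x + t *\<^sub>R e \<in> img c" "chart_inv c (x + t *\<^sub>R e) \<in> Xint"
      using interior_point[OF pt[OF t]] by auto
  next
    show "((\<lambda>t. (B * norm e) * t powr (- M / 2)) has_integral (B * norm e) * (s powr (- M / 2 + 1) / (- M / 2 + 1))) {0..s}"
      using M s by (intro has_integral_mult_right has_integral_powr_from_0) auto
  next
    fix t assume t: "t \<in> {0<..<s}"
    then have t': "t \<in> {0..s}" by simp
    have img: "x + t *\<^sub>R e \<in> img c" by (rule interior_point[OF pt[OF t']])
    have "sqrt (weight (chart_inv c (x + t *\<^sub>R e)) * g c (chart_inv c (x + t *\<^sub>R e)) e e) \<le> B * t powr (- M / 2) * norm e"
    proof (rule speed_upper)
      show "t \<le> 1" using t s R r1 by auto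
      show "\<forall>b\<in>K. t \<le> \<phi> (chart_inv c (x + t *\<^sub>R e)) \<bullet> b"
        using img x(2) by (auto simp: shift_inner less_imp_le)
    qed (use t img pt[OF t'] in auto)
    then show "sqrt (weight (chart_inv c (x + t *\<^sub>R e)) * g c (chart_inv c (x + t *\<^sub>R e)) e e) \<le> B * norm e * t powr (- M / 2)"
      by (simp add: mult_ac)
  qed
  moreover have "- M / 2 + 1 = \<theta>" unfolding \<theta>_def by simp
  ultimately show ?thesis by simp
qed

lemma horizontal_bound:
  assumes x: "x \<in> cball x0 R" "\<forall>b\<in>K. 0 < x \<bullet> b" and x': "x' \<in> cball x0 R" "\<forall>b\<in>K. 0 < x' \<bullet> b"
    and s: "0 < s" "s \<le> 2 * R"
  shows "Sg.dst (chart_inv c (x + s *\<^sub>R e)) (chart_inv c (x' + s *\<^sub>R e)) \<le> ennreal (B * s powr (- M / 2) * dist x x')"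
proof -
  define y where "y = x + s *\<^sub>R e"
  have y: "y + t *\<^sub>R (x' - x) = (1 - t) *\<^sub>R x + t *\<^sub>R x' + s *\<^sub>R e" for t
    unfolding y_def by (simp add: algebra_simps)
  have cb: "(1 - t) *\<^sub>R x + t *\<^sub>R x' \<in> cball x0 R" if "t \<in> {0..1}" for t
    using convexD[OF convex_cball x(1) x'(1), of "1 - t" t] that by simp
  have pt: "y + t *\<^sub>R (x' - x) \<in> cball x0 r" "\<forall>b\<in>K. s < (y + t *\<^sub>R (x' - x)) \<bullet> b" if t: "t \<in> {0..1}" for t
  proof -
    show "y + t *\<^sub>R (x' - x) \<in> cball x0 r" unfolding y using shift_cball[OF cb[OF t]] s by simp
    show "\<forall>b\<in>K. s < (y + t *\<^sub>R (x' - x)) \<bullet> b"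
    proof
      fix b assume b: "b \<in> K"
      \<comment> \<open>At \<open>t = 0\<close> only the first summand is positive; for other
        \<open>t\<close> the second one is.\<close>
      have "0 < (1 - t) * (x \<bullet> b) + t * (x' \<bullet> b)"
        using x(2) x'(2) b t by (cases "t = 0") (auto intro: add_nonneg_pos simp: less_imp_le)
      then show "s < (y + t *\<^sub>R (x' - x)) \<bullet> b" unfolding y using b by (simp add: e_K inner_add_left)
    qed
  qed
  have pos: "\<forall>b\<in>K. 0 < (y + t *\<^sub>R (x' - x)) \<bullet> b" if "t \<in> {0..1}" for t
    using pt(2)[OF that] s(1) by force
  have "Sg.dst (chart_inv c (y + 0 *\<^sub>R (x' - x))) (chart_inv c (y + 1 *\<^sub>R (x' - x)))
      \<le> ennreal (B * s powr (- M / 2) * norm (x' - x))"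
  proof (rule Sg.dst_segment_le[OF c, of 0 1 _ _ "\<lambda>_. B * s powr (- M / 2) * norm (x' - x)"])
    fix t :: real assume t: "t \<in> {0..1}"
    show "y + t *\<^sub>R (x' - x) \<in> img c" "chart_inv c (y + t *\<^sub>R (x' - x)) \<in> Xint"
      using interior_point[OF pt(1)[OF t] pos[OF t]] by auto
  next
    show "((\<lambda>_. B * s powr (- M / 2) * norm (x' - x)) has_integral B * s powr (- M / 2) * norm (x' - x)) {0..1::real}"
      using has_integral_const_real[of "B * s powr (- M / 2) * norm (x' - x)" 0 1] by simp
  next
    fix t :: real assume "t \<in> {0<..<1}"
    then have t: "t \<in> {0..1}" by simp
    have img: "y + t *\<^sub>R (x' - x) \<in> img c" by (rule interior_point[OF pt(1)[OF t] pos[OF t]])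
    show "sqrt (weight (chart_inv c (y + t *\<^sub>R (x' - x))) * g c (chart_inv c (y + t *\<^sub>R (x' - x))) (x' - x) (x' - x))
        \<le> B * s powr (- M / 2) * norm (x' - x)"
    proof (rule speed_upper)
      show "s \<le> 1" using s R r1 by simp
      show "\<forall>b\<in>K. s \<le> \<phi> (chart_inv c (y + t *\<^sub>R (x' - x))) \<bullet> b"
        using img pt(2)[OF t] by (simp add: less_imp_le)
    qed (use img pt(1)[OF t] s in auto)
  qed simp
  moreover have "y + 1 *\<^sub>R (x' - x) = x' + s *\<^sub>R e" unfolding y_def by simp
  moreover have "norm (x' - x) = dist x x'" by (simp add: dist_norm norm_minus_commute)
  ultimately show ?thesis unfolding y_def by (simp only: scaleR_zero_left add_0_right)
qed

text \<open>Two vertical legs contribute \<open>B * norm e / \<theta>\<close> each, the horizontal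
  leg contributes \<open>B\<close>.\<close>

definition C :: real where "C = B * (2 * norm e / \<theta> + 1)"

lemma C_nonneg: "M < 2 \<Longrightarrow> 0 \<le> C"
  unfolding C_def \<theta>_def using B_nonneg by simp

text \<open>Curves cannot leave the interior, so only interior points occur; but the constant does
  not depend on their distance from the boundary, and the estimate passes to the face. Coinciding
  points are treated apart because the height \<open>s\<close> must be positive.\<close>

lemma Hoelder_bound:
  assumes M: "M < 2" and q: "q \<in> chart_dom c" "q \<in> Xint" "\<phi> q \<in> cball x0 R"
    and q': "q' \<in> chart_dom c" "q' \<in> Xint" "\<phi> q' \<in> cball x0 R"
  shows "Sg.dst q q' \<le> ennreal (C * dist (\<phi> q) (\<phi> q') powr \<theta>)"
proof (cases "q = q'")
  case True
  then show ?thesis using Sg.dst_self[OF q(2)] by simp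
next
  case False
  define x where "x = \<phi> q"
  define x' where "x' = \<phi> q'"
  define s where "s = dist x x'"
  have \<theta>: "0 < \<theta>" using M unfolding \<theta>_def by simp
  have Rr: "cball x0 R \<subseteq> cball x0 r" using R by (intro subset_cball) auto
  have x: "x \<in> cball x0 R" "\<forall>b\<in>K. 0 < x \<bullet> b" using q interior_local Rr unfolding x_def by blast+
  have x': "x' \<in> cball x0 R" "\<forall>b\<in>K. 0 < x' \<bullet> b" using q' interior_local Rr unfolding x'_def by blast+
  have "x \<noteq> x'" using False inj_chart[OF c] q(1) q'(1) unfolding x_def x'_def inj_on_def by blast
  then have s0: "0 < s" unfolding s_def by simp
  have s2: "s \<le> 2 * R" unfolding s_def using dist_triangle[of x x' x0] x(1) x'(1) by (simp add: dist_commute)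
  have qx: "chart_inv c x = q" "chart_inv c x' = q'" unfolding x_def x'_def using c q q' by auto
  have sth: "s powr (- M / 2) * s = s powr \<theta>"
    using s0 powr_add[of s "- M / 2" 1] unfolding \<theta>_def by simp
  have "Sg.dst q q' \<le> Sg.dst q (chart_inv c (x + s *\<^sub>R e)) +
      (Sg.dst (chart_inv c (x + s *\<^sub>R e)) (chart_inv c (x' + s *\<^sub>R e)) + Sg.dst (chart_inv c (x' + s *\<^sub>R e)) q')"
    using Sg.dst_triangle add_left_mono order_trans by meson
  also have "\<dots> \<le> ennreal (B * norm e / \<theta> * s powr \<theta>) + (ennreal (B * s powr (- M / 2) * s) + ennreal (B * norm e / \<theta> * s powr \<theta>))"
    using vertical_bound[OF M x s0 s2] vertical_bound[OF M x' s0 s2] horizontal_bound[OF x x' s0 s2]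
      Sg.dst_sym[of "chart_inv c (x' + s *\<^sub>R e)" q']
    unfolding qx s_def[symmetric] by (intro add_mono) auto
  also have "\<dots> = ennreal (B * norm e / \<theta> * s powr \<theta> + (B * s powr (- M / 2) * s + B * norm e / \<theta> * s powr \<theta>))"
  proof -
    have "0 \<le> B * norm e / \<theta> * s powr \<theta>" "0 \<le> B * s powr (- M / 2) * s" using B_nonneg \<theta> s0 by simp_all
    then show ?thesis by (simp only: ennreal_plus add_nonneg_nonneg)
  qed
  also have "B * norm e / \<theta> * s powr \<theta> + (B * s powr (- M / 2) * s + B * norm e / \<theta> * s powr \<theta>) = C * s powr \<theta>"
    unfolding C_def mult.assoc sth using \<theta> by (simp add: field_simps)
  finally show ?thesis unfolding s_def x_def x'_def .
qed

section \<open>Completion points over the face\<close>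

definition near_points :: "'a \<Rightarrow> real \<Rightarrow> 'a set" where
  "near_points z \<delta> = {q \<in> chart_dom c \<inter> Xint. dist (\<phi> q) (\<phi> z) < \<delta>}"

lemma dst_small:
  assumes M: "M < 2" and z: "z \<in> chart_dom c" "\<phi> z \<in> ball x0 R" and \<epsilon>: "(0::ennreal) < \<epsilon>"
  shows "\<exists>\<delta>>0. \<forall>q\<in>near_points z \<delta>. \<forall>q'\<in>near_points z \<delta>. Sg.dst q q' < \<epsilon>"
proof -
  have \<theta>: "0 < \<theta>" using M unfolding \<theta>_def by simp
  have t0: "((\<lambda>t. 2 * t) \<longlongrightarrow> 2 * (0::real)) (at_right 0)" by (intro tendsto_intros)
  have "((\<lambda>t. (2 * t) powr \<theta>) \<longlongrightarrow> 0) (at_right (0::real))"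
    by (rule tendsto_zero_powrI[of _ _ _ \<theta>])
      (use t0 \<theta> in \<open>auto simp: eventually_at_right_field intro!: exI[of _ 1]\<close>)
  then have "((\<lambda>t. C * (2 * t) powr \<theta>) \<longlongrightarrow> C * 0) (at_right (0::real))" by (intro tendsto_mult tendsto_const)
  then have "((\<lambda>t. ennreal (C * (2 * t) powr \<theta>)) \<longlongrightarrow> ennreal 0) (at_right (0::real))" by (intro tendsto_ennrealI) simp
  then have ev1: "\<forall>\<^sub>F t in at_right (0::real). ennreal (C * (2 * t) powr \<theta>) < \<epsilon>"
    using \<epsilon> by (intro order_tendstoD) auto
  have pos: "0 < R - dist (\<phi> z) x0" using z(2) by (simp add: dist_commute)
  then have ev2: "\<forall>\<^sub>F t in at_right 0. t < R - dist (\<phi> z) x0"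
    unfolding eventually_at_right_field by blast
  have "\<forall>\<^sub>F t in at_right (0::real). ennreal (C * (2 * t) powr \<theta>) < \<epsilon> \<and> 0 < t \<and> t < R - dist (\<phi> z) x0"
    by (intro eventually_conj ev1 ev2 eventually_at_right_less)
  then obtain t where t: "ennreal (C * (2 * t) powr \<theta>) < \<epsilon>" "0 < t" "t < R - dist (\<phi> z) x0"
    using eventually_happens'[OF trivial_limit_at_right_real] by blast
  show ?thesis
  proof (intro exI[of _ t] conjI ballI t(2))
    fix q q' assume "q \<in> near_points z t" "q' \<in> near_points z t"
    then have q: "q \<in> chart_dom c" "q \<in> Xint" "dist (\<phi> q) (\<phi> z) < t"
      and q': "q' \<in> chart_dom c" "q' \<in> Xint" "dist (\<phi> q') (\<phi> z) < t" unfolding near_points_def by auto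
    have cb: "x \<in> cball x0 R" if "dist x (\<phi> z) < t" for x
      using dist_triangle[of x x0 "\<phi> z"] that t(3) by (simp add: dist_commute)
    have "dist (\<phi> q) (\<phi> q') \<le> 2 * t"
      using dist_triangle2[of "\<phi> q" "\<phi> q'" "\<phi> z"] q(3) q'(3) by simp
    then have "dist (\<phi> q) (\<phi> q') powr \<theta> \<le> (2 * t) powr \<theta>" using \<theta> by (intro powr_mono2) auto
    then have "C * dist (\<phi> q) (\<phi> q') powr \<theta> \<le> C * (2 * t) powr \<theta>"
      using C_nonneg[OF M] by (intro mult_left_mono)
    then have "Sg.dst q q' \<le> ennreal (C * (2 * t) powr \<theta>)"
      using Hoelder_bound[OF M q(1,2) cb[OF q(3)] q'(1,2) cb[OF q'(3)]] ennreal_leI order_trans by blast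
    then show "Sg.dst q q' < \<epsilon>" using t(1) by simp
  qed
qed

lemma consistent:
  assumes M: "M < 2" and z: "z \<in> chart_dom c" "\<phi> z \<in> ball x0 R"
  shows "D.consistent_at X z"
proof -
  \<comment> \<open>Two independent indices: with \<open>y = x\<close> this is the Cauchy condition,
    with \<open>m = n\<close> it is the equivalence of \<open>x\<close> and
    \<open>y\<close>.\<close>
  have near: "\<exists>m0. \<forall>m\<ge>m0. \<forall>n\<ge>m0. Sg.dst (x m) (y n) < \<epsilon>"
    if x: "range x \<subseteq> Xint" "limitin X x z sequentially"
      and y: "range y \<subseteq> Xint" "limitin X y z sequentially" and \<epsilon>: "0 < \<epsilon>" for x y \<epsilon>
  proof -
    obtain \<delta> where \<delta>: "0 < \<delta>" "\<forall>q\<in>near_points z \<delta>. \<forall>q'\<in>near_points z \<delta>. Sg.dst q q' < \<epsilon>"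
      using dst_small[OF M z \<epsilon>] by blast
    have "\<exists>m. \<forall>n\<ge>m. x n \<in> near_points z \<delta>" if "range x \<subseteq> Xint" "limitin X x z sequentially" for x
      using chart_nbhd_eventually[OF that(2) z(1) \<delta>(1)] that(1)
      unfolding eventually_sequentially near_points_def by blast
    then obtain m1 m2 where "\<forall>n\<ge>m1. x n \<in> near_points z \<delta>" "\<forall>n\<ge>m2. y n \<in> near_points z \<delta>" using x y by meson
    then show ?thesis using \<delta>(2) by (intro exI[of _ "max m1 m2"]) auto
  qed
  have cauchy: "x \<in> cauchy_seqs (Xint) Sg.dst"
    if x: "range x \<subseteq> Xint" "limitin X x z sequentially" for x
    unfolding cauchy_seqs_def using near[OF x x] x(1) by blast
  have "(\<lambda>n. Sg.dst (x n) (y n)) \<longlonglongrightarrow> 0"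
    if x: "range x \<subseteq> Xint" "limitin X x z sequentially"
      and y: "range y \<subseteq> Xint" "limitin X y z sequentially" for x y
  proof (rule order_tendstoI)
    fix \<epsilon> :: ennreal assume "0 < \<epsilon>"
    then obtain m0 where "\<forall>m\<ge>m0. \<forall>n\<ge>m0. Sg.dst (x m) (y n) < \<epsilon>" using near[OF x y] by blast
    then show "\<forall>\<^sub>F n in sequentially. Sg.dst (x n) (y n) < \<epsilon>" unfolding eventually_sequentially by blast
  qed auto
  then show ?thesis unfolding D.consistent_at_def cauchy_equiv_def using cauchy by blast
qed

text \<open>Heights tending to 0, scaled so that raising a point by \<open>\<tau> n\<close> along
  \<open>e\<close> moves it by at most \<open>R / 2\<close>.\<close>

definition \<tau> :: "nat \<Rightarrow> real" where "\<tau> n = R / 2 / (1 + norm e) * inverse (real (Suc n))"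

lemma \<tau>: "0 < \<tau> n" "\<tau> n * norm e \<le> R / 2" "\<tau> \<longlonglongrightarrow> 0"
proof -
  have ne: "0 < 1 + norm e" using norm_ge_zero[of e] by linarith
  show pos: "0 < \<tau> n" for n unfolding \<tau>_def using R(1) ne by simp
  have "\<tau> n \<le> R / 2 / (1 + norm e) * 1"
    unfolding \<tau>_def using R(1) ne by (intro mult_left_mono) (auto simp: field_simps)
  then have "\<tau> n \<le> R / 2 / (1 + norm e)" by simp
  then have "\<tau> n * (1 + norm e) \<le> R / 2" using pos_le_divide_eq[OF ne] by blast
  then show "\<tau> n * norm e \<le> R / 2" using pos[of n] by (simp add: algebra_simps)
  have "(\<lambda>n. R / 2 / (1 + norm e) * inverse (real (Suc n))) \<longlonglongrightarrow> R / 2 / (1 + norm e) * 0"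
    by (intro tendsto_mult tendsto_const LIMSEQ_inverse_real_of_nat)
  then show "\<tau> \<longlonglongrightarrow> 0" unfolding \<tau>_def by simp
qed

text \<open>An interior sequence converging to \<open>z\<close> when \<open>z\<close> is in
  \<open>V\<close>. The shift is the same vector for all \<open>z\<close>, so the coordinate
  distance between two such sequences does not depend on \<open>n\<close>.\<close>

definition approach :: "'a \<Rightarrow> nat \<Rightarrow> 'a" where
  "approach z n = chart_inv c (\<phi> z + \<tau> n *\<^sub>R e)"

text \<open>The radius \<open>R / 2\<close> leaves room for the approach sequences in the ball of
  radius \<open>R\<close> and bounds coordinate distances in \<open>V\<close> by
  \<open>R\<close>.\<close>

definition V :: "'a set" where
  "V = {q \<in> chart_dom c. \<phi> q \<in> ball x0 (R / 2)} \<inter> F"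

lemma V:
  assumes "z \<in> V"
  shows "z \<in> chart_dom c" "\<phi> z \<in> ball x0 (R / 2)" "\<phi> z \<in> ball x0 R" "\<phi> z \<in> cball x0 r"
    "z \<in> F" "\<forall>b\<in>K. \<phi> z \<bullet> b = 0"
proof -
  show z: "z \<in> chart_dom c" "\<phi> z \<in> ball x0 (R / 2)" "z \<in> F"
    using assms unfolding V_def by auto
  then show "\<phi> z \<in> ball x0 R" "\<phi> z \<in> cball x0 r" using R by auto
  then show "\<forall>b\<in>K. \<phi> z \<bullet> b = 0" using face_local z by blast
qed

lemma approach:
  assumes z: "z \<in> V"
  shows "approach z n \<in> chart_dom c" "\<phi> (approach z n) = \<phi> z + \<tau> n *\<^sub>R e"
    "\<phi> (approach z n) \<in> cball x0 R" "range (approach z) \<subseteq> Xint"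
    "limitin X (approach z) z sequentially"
proof -
  note z = V[OF z]
  have cb: "\<phi> z + \<tau> n *\<^sub>R e \<in> cball x0 R" for n
  proof -
    have "dist x0 (\<phi> z + \<tau> n *\<^sub>R e) \<le> dist x0 (\<phi> z) + norm (\<tau> n *\<^sub>R e)"
      using dist_triangle[of x0 "\<phi> z + \<tau> n *\<^sub>R e" "\<phi> z"] by (simp add: dist_norm)
    then show ?thesis using z(2) \<tau>(1,2)[of n] by simp
  qed
  have pt: "\<phi> z + \<tau> n *\<^sub>R e \<in> img c"
    "approach z n \<in> Xint" for n
  proof -
    have "\<phi> z + \<tau> n *\<^sub>R e \<in> cball x0 r" using cb[of n] R by auto
    moreover have "\<forall>b\<in>K. 0 < (\<phi> z + \<tau> n *\<^sub>R e) \<bullet> b"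
      using z(6) \<tau>(1)[of n] by (auto simp: shift_inner)
    ultimately show "\<phi> z + \<tau> n *\<^sub>R e \<in> img c"
      "approach z n \<in> Xint"
      using interior_point unfolding approach_def by blast+
  qed
  show "approach z n \<in> chart_dom c" "\<phi> (approach z n) = \<phi> z + \<tau> n *\<^sub>R e"
    using pt(1) unfolding approach_def by auto
  then show "\<phi> (approach z n) \<in> cball x0 R" using cb by simp
  show "range (approach z) \<subseteq> Xint" using pt(2) by blast
  have "(\<lambda>n. \<phi> z + \<tau> n *\<^sub>R e) \<longlonglongrightarrow> \<phi> z + 0 *\<^sub>R e"
    by (intro tendsto_intros \<tau>(3))
  then have "limitin (top_of_set (img c)) (\<lambda>n. \<phi> z + \<tau> n *\<^sub>R e) (\<phi> z) sequentially"
    using pt(1) z(1) by (simp add: limitin_subtopology)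
  from continuous_map_limit[OF continuous_chart_inv[OF c] this]
  show "limitin X (approach z) z sequentially" using z(1) c by (simp add: comp_def approach_def[abs_def])
qed

section \<open>Boundary distance and face distance against the coordinate distance\<close>

lemma boundary_dist_limit:
  assumes M: "M < 2" and z: "z \<in> V" and z': "z' \<in> V"
  shows "(\<lambda>n. Sg.dst (approach z n) (approach z' n)) \<longlonglongrightarrow> bdist z z'"
  using D.boundary_dist_lim[OF consistent[OF M V(1,3)[OF z]] approach(4,5)[OF z]
      consistent[OF M V(1,3)[OF z']] approach(4,5)[OF z']] .

lemma boundary_dist_upper:
  assumes M: "M < 2" and z: "z \<in> V" and z': "z' \<in> V"
  shows "bdist z z' \<le> ennreal (C * dist (\<phi> z) (\<phi> z') powr \<theta>)"
proof (rule LIMSEQ_le_const2[OF boundary_dist_limit[OF M z z']], intro exI[of _ 0] allI impI)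
  fix n
  have "Sg.dst (approach z n) (approach z' n)
      \<le> ennreal (C * dist (\<phi> (approach z n)) (\<phi> (approach z' n)) powr \<theta>)"
    using Hoelder_bound[OF M approach(1)[OF z] _ approach(3)[OF z] approach(1)[OF z'] _ approach(3)[OF z']]
      approach(4)[OF z] approach(4)[OF z'] by blast
  then show "Sg.dst (approach z n) (approach z' n) \<le> ennreal (C * dist (\<phi> z) (\<phi> z') powr \<theta>)"
    unfolding approach(2)[OF z] approach(2)[OF z'] by simp
qed

lemma V_dist_le: "z \<in> V \<Longrightarrow> z' \<in> V \<Longrightarrow> dist (\<phi> z) (\<phi> z') \<le> R"
  using dist_triangle2[of "\<phi> z" "\<phi> z'" x0] V(2)[of z] V(2)[of z'] by (simp add: dist_commute)

lemma V_cball_subset: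
  assumes "z \<in> V" "s \<le> R" shows "cball (\<phi> z) s \<subseteq> cball x0 r"
proof
  fix x assume "x \<in> cball (\<phi> z) s"
  then show "x \<in> cball x0 r"
    using dist_triangle[of x0 x "\<phi> z"] V(2)[OF assms(1)] assms(2) R(1,2) by simp
qed

text \<open>With \<open>s\<close> half the coordinate distance, late terms of the sequence for
  \<open>z\<close> lie within \<open>s / 2\<close> of \<open>\<phi> z\<close>, while those for
  \<open>z'\<close> are still outside the ball of radius \<open>s\<close>. The exit bound is then
  independent of \<open>n\<close> and survives the limit.\<close>

lemma boundary_dist_lower:
  assumes M: "M < 2" and z: "z \<in> V" and z': "z' \<in> V"
  shows "ennreal (\<kappa> / 2 * (dist (\<phi> z) (\<phi> z') / 2) powr \<theta>)
    \<le> bdist z z'"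
proof (cases "\<phi> z = \<phi> z'")
  case True
  then show ?thesis by simp
next
  case False
  define y where "y = \<phi> z"
  define s where "s = dist y (\<phi> z') / 2"
  have s: "0 < s" "s \<le> R" using False V_dist_le[OF z z'] R(1) unfolding s_def y_def by auto
  have "(\<lambda>n. \<tau> n * norm e) \<longlonglongrightarrow> 0 * norm e" by (intro tendsto_intros \<tau>(3))
  then have "\<forall>\<^sub>F n in sequentially. \<tau> n * norm e < s / 2" using s by (intro order_tendstoD) auto
  then obtain m where m: "\<And>n. n \<ge> m \<Longrightarrow> \<tau> n * norm e < s / 2" unfolding eventually_sequentially by blast
  have "ennreal (\<kappa> / 2 * s powr \<theta>) \<le> Sg.dst (approach z n) (approach z' n)" if n: "n \<ge> m" for n
  proof -
    have close: "dist x (x + \<tau> n *\<^sub>R e) < s / 2" for x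
      using m[OF n] \<tau>(1)[of n] by (simp add: dist_norm)
    have "ennreal (\<kappa> * s powr (- M / 2) * (s - s / 2)) \<le> Sg.dst (approach z n) (approach z' n)"
    proof (rule Sg_exit[of y])
      show "cball y s \<subseteq> cball x0 r" unfolding y_def by (rule V_cball_subset[OF z s(2)])
      show "\<forall>b\<in>K. y \<bullet> b = 0" unfolding y_def by (rule V(6)[OF z])
      show "dist (\<phi> (approach z n)) y \<le> s / 2"
        unfolding approach(2)[OF z] y_def using close[of "\<phi> z"] by (simp add: dist_commute)
      have "2 * s \<le> dist (\<phi> (approach z' n)) y + dist (\<phi> z') (\<phi> (approach z' n))"
        unfolding s_def using dist_triangle[of y "\<phi> z'" "\<phi> (approach z' n)"] by (simp add: dist_commute)
      then show "\<not> (approach z' n \<in> chart_dom c \<and> dist (\<phi> (approach z' n)) y < s)"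
        using close[of "\<phi> z'"] s(1) unfolding approach(2)[OF z'] by linarith
    qed (use approach(1)[OF z] s in auto)
    moreover have "s powr (- M / 2) * s = s powr \<theta>"
      using s(1) powr_add[of s "- M / 2" 1] unfolding \<theta>_def by simp
    then have "\<kappa> * s powr (- M / 2) * (s - s / 2) = \<kappa> / 2 * s powr \<theta>" by (simp add: algebra_simps)
    ultimately show ?thesis by (simp only:)
  qed
  then have "ennreal (\<kappa> / 2 * s powr \<theta>) \<le> bdist z z'"
    by (intro LIMSEQ_le_const[OF boundary_dist_limit[OF M z z']]) blast
  then show ?thesis unfolding s_def y_def .
qed

text \<open>The exit bound with weight 1 and \<open>\<epsilon> = 0\<close>, as the curve now starts
  at the centre itself. The point \<open>z'\<close> lies on the sphere, which counts as
  outside.\<close>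

lemma face_dist_lower:
  assumes z: "z \<in> V" and z': "z' \<in> V"
  shows "ennreal (r * dist (\<phi> z) (\<phi> z')) \<le> Fc.dst z z'"
proof (cases "\<phi> z = \<phi> z'")
  case True
  then show ?thesis by simp
next
  case False
  define s where "s = dist (\<phi> z) (\<phi> z')"
  have s: "0 < s" "s \<le> R" using False V_dist_le[OF z z'] unfolding s_def by auto
  have "ennreal (r * (s - 0)) \<le> Fc.dst z z'"
  proof (rule Fc.dst_exit_bound[OF c, of "\<phi> z"])
    show "cball (\<phi> z) s \<inter> corner c \<subseteq> img c"
      using V_cball_subset[OF z s(2)] chart_r by blast
    fix q v assume "q \<in> chart_dom c" "\<phi> q \<in> cball (\<phi> z) s"
    then have "q \<in> chart_dom c" "\<phi> q \<in> cball x0 r"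
      using V_cball_subset[OF z s(2)] by blast+
    then show "r * norm v \<le> sqrt (1 * g c q v v)" using metric_r by simp
  qed (use V(1)[OF z] s r0 in \<open>auto simp: s_def dist_commute\<close>)
  then show ?thesis unfolding s_def by simp
qed

text \<open>The face is flat in coordinates, so the straight segment stays in it.\<close>

lemma face_dist_upper:
  assumes z: "z \<in> V" and z': "z' \<in> V"
  shows "Fc.dst z z' \<le> ennreal (dist (\<phi> z) (\<phi> z') / r)"
proof -
  define v where "v = \<phi> z' - \<phi> z"
  have pt: "\<phi> z + t *\<^sub>R v \<in> cball x0 r" "\<forall>b\<in>K. (\<phi> z + t *\<^sub>R v) \<bullet> b = 0" if t: "t \<in> {0..1}" for t
  proof -
    have "\<phi> z + t *\<^sub>R v = (1 - t) *\<^sub>R \<phi> z + t *\<^sub>R \<phi> z'"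
      unfolding v_def by (simp add: algebra_simps)
    then show "\<phi> z + t *\<^sub>R v \<in> cball x0 r"
      using convexD[OF convex_cball V(4)[OF z] V(4)[OF z'], of "1 - t" t] t by simp
    show "\<forall>b\<in>K. (\<phi> z + t *\<^sub>R v) \<bullet> b = 0"
      unfolding v_def using V(6)[OF z] V(6)[OF z'] by (simp add: inner_add_left inner_diff_left)
  qed
  have img: "\<phi> z + t *\<^sub>R v \<in> img c" if "t \<in> {0..1}" for t
    by (rule img_iff[OF pt(1)[OF that]]) (use pt(2)[OF that] in simp)
  have "Fc.dst (chart_inv c (\<phi> z + 0 *\<^sub>R v)) (chart_inv c (\<phi> z + 1 *\<^sub>R v)) \<le> ennreal (norm v / r)"
  proof (rule Fc.dst_segment_le[OF c, of 0 1 _ _ "\<lambda>_. norm v / r"])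
    fix t :: real assume t: "t \<in> {0..1}"
    show "\<phi> z + t *\<^sub>R v \<in> img c" by (rule img[OF t])
    then show "chart_inv c (\<phi> z + t *\<^sub>R v) \<in> F"
      using face_local[of "chart_inv c (\<phi> z + t *\<^sub>R v)"] pt[OF t] by simp
  next
    show "((\<lambda>_. norm v / r) has_integral norm v / r) {0..1::real}"
      using has_integral_const_real[of "norm v / r" 0 1] by simp
  next
    fix t :: real assume "t \<in> {0<..<1}"
    then have t: "t \<in> {0..1}" by simp
    have "chart_inv c (\<phi> z + t *\<^sub>R v) \<in> chart_dom c"
      "\<phi> (chart_inv c (\<phi> z + t *\<^sub>R v)) \<in> cball x0 r"
      using img[OF t] pt(1)[OF t] by simp_all
    then show "sqrt (1 * g c (chart_inv c (\<phi> z + t *\<^sub>R v)) v v) \<le> norm v / r"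
      using metric_r by simp
  qed simp
  then show ?thesis using V(1)[OF z] V(1)[OF z'] c unfolding v_def by (simp add: dist_norm norm_minus_commute)
qed

section \<open>The neighbourhood and the final constants\<close>

lemma V_openin: "openin (subtopology X F) V"
  unfolding V_def by (rule openin_subtopology_Int[OF openin_chart_vimage[OF c open_ball]])

text \<open>The closed ball of radius \<open>R / 2\<close>, cut with the linear equations of the
  face, is compact in coordinates; its image is closed, lies in \<open>F\<close> and contains
  \<open>V\<close>.\<close>

lemma V_closure_compact:
  "compactin (subtopology X F) (subtopology X F closure_of V)"
proof -
  define E where "E = cball x0 (R / 2) \<inter> (\<Inter>b\<in>K. {x. x \<bullet> b = 0})"
  define Q where "Q = chart_inv c ` E"
  have E: "x \<in> img c" "x \<in> cball x0 r" if "x \<in> E" for x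
  proof -
    show "x \<in> cball x0 r" using that R(1,2) unfolding E_def by auto
    then show "x \<in> img c" by (rule img_iff) (use that in \<open>auto simp: E_def\<close>)
  qed
  have "compact E" unfolding E_def
    by (intro compact_Int_closed compact_cball closed_INT ballI closed_Collect_eq continuous_intros)
  then have Q: "compactin X Q" "closedin X Q" unfolding Q_def using closedin_chart_inv[OF c] E by blast+
  have QF: "Q \<subseteq> F"
    unfolding Q_def using face_local E by (auto simp: E_def)
  have "V \<subseteq> Q"
  proof
    fix z assume z: "z \<in> V"
    have "\<phi> z \<in> E" unfolding E_def using V[OF z] by auto
    then show "z \<in> Q" unfolding Q_def using V(1)[OF z] c by (metis chart_inv_map image_eqI)
  qed
  moreover have "closedin (subtopology X F) Q"
    using closedin_subset_topspace[OF Q(2) QF] .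
  ultimately have "subtopology X F closure_of V \<subseteq> Q" by (rule closure_of_minimal)
  moreover have "compactin (subtopology X F) Q" using Q(1) QF by (simp add: compactin_subtopology)
  ultimately show ?thesis using closed_compactin closedin_closure_of by blast
qed

lemma p_in_V: "p \<in> V"
  unfolding V_def using p pF R(1) by (simp add: x0_def)

lemma local_estimate:
  assumes "accessible_point X (Xint) Sg.dst p"
  shows "\<exists>V c C \<eta>. openin (subtopology X F) V \<and> p \<in> V \<and>
      compactin (subtopology X F) (subtopology X F closure_of V) \<and>
      0 < c \<and> c \<le> C \<and> 0 < \<eta> \<and>
      (\<forall>z\<in>V. \<forall>z'\<in>V. Fc.dst z z' < ennreal \<eta> \<longrightarrow>
        ennreal (c * enn2real (Fc.dst z z') powr (1 - M / 2)) \<le> bdist z z' \<and>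
        bdist z z' \<le> ennreal (C * enn2real (Fc.dst z z') powr (1 - M / 2)))"
proof -
  have M: "M < 2" by (rule accessible_imp_M_less[OF assms])
  have \<theta>: "0 < \<theta>" using M unfolding \<theta>_def by simp
  \<comment> \<open>These constants come from \<open>r * s \<le> t \<le> s / r\<close> for the
    coordinate distance \<open>s\<close> and the face distance \<open>t\<close>: the lower bound
    uses \<open>s / 2 \<ge> r / 2 * t\<close>, the upper bound uses
    \<open>s \<le> 1 / r * t\<close>. The maximum secures \<open>c1 \<le> C1\<close>.\<close>
  define c1 where "c1 = \<kappa> / 2 * (r / 2) powr \<theta>"
  define C1 where "C1 = max c1 (C * (1 / r) powr \<theta>)"
  have c1: "0 < c1" unfolding c1_def using \<kappa>_pos r0 by simp
  have bounds: "ennreal (c1 * enn2real (Fc.dst z z') powr \<theta>) \<le> bdist z z' \<and>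
      bdist z z' \<le> ennreal (C1 * enn2real (Fc.dst z z') powr \<theta>)"
    if z: "z \<in> V" and z': "z' \<in> V" for z z'
  proof -
    define s where "s = dist (\<phi> z) (\<phi> z')"
    define t where "t = enn2real (Fc.dst z z')"
    have up: "Fc.dst z z' \<le> ennreal (s / r)" unfolding s_def by (rule face_dist_upper[OF z z'])
    \<comment> \<open>The segment bound makes the face distance finite, so that
      \<open>enn2real\<close> loses nothing.\<close>
    then have fin: "Fc.dst z z' = ennreal t" unfolding t_def
      by (metis ennreal_enn2real ennreal_less_top order_le_less_trans)
    have t0: "0 \<le> t" unfolding t_def by simp
    have s0: "0 \<le> s" unfolding s_def by simp
    have ts: "t \<le> s / r" using up s0 r0 unfolding fin by (simp add: ennreal_le_iff)
    have st: "r * s \<le> t" using face_dist_lower[OF z z'] t0 unfolding fin s_def[symmetric] by (simp add: ennreal_le_iff)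
    have "c1 * t powr \<theta> = \<kappa> / 2 * (r / 2 * t) powr \<theta>" unfolding c1_def using r0 t0 by (simp only: powr_mult mult.assoc)
    also have "\<dots> \<le> \<kappa> / 2 * (s / 2) powr \<theta>"
      using ts r0 t0 \<theta> \<kappa>_pos by (intro mult_left_mono powr_mono2) (auto simp: field_simps)
    finally have lower: "c1 * t powr \<theta> \<le> \<kappa> / 2 * (s / 2) powr \<theta>" .
    have "C * s powr \<theta> \<le> C * (1 / r * t) powr \<theta>"
      using st s0 r0 \<theta> C_nonneg[OF M] by (intro mult_left_mono powr_mono2) (auto simp: field_simps)
    also have "\<dots> = C * (1 / r) powr \<theta> * t powr \<theta>" using r0 t0 by (simp only: powr_mult mult.assoc)
    also have "\<dots> \<le> C1 * t powr \<theta>" unfolding C1_def by (intro mult_right_mono) auto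
    finally have upper: "C * s powr \<theta> \<le> C1 * t powr \<theta>" .
    show ?thesis
      using boundary_dist_lower[OF M z z'] boundary_dist_upper[OF M z z'] ennreal_leI[OF lower] ennreal_leI[OF upper]
      unfolding s_def t_def by (meson order_trans)
  qed
  have "c1 \<le> C1" unfolding C1_def by simp
  \<comment> \<open>The bounds hold for all pairs in \<open>V\<close>, whence the witness 1 for
    \<open>\<eta>\<close>.\<close>
  then show ?thesis
    using V_openin p_in_V V_closure_compact c1 bounds unfolding \<theta>_def
    by (intro exI[of _ V] exI[of _ c1] exI[of _ C1] exI[of _ 1]) simp
qed

end

theorem theorem6p10:
  fixes X :: "'a topology"
    and A :: "('a, 'e::euclidean_space) chart set"
    and N :: nat
    and H :: "nat \<Rightarrow> 'a set"
    and \<rho> :: "nat \<Rightarrow> 'a \<Rightarrow> real"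
    and \<alpha> :: "nat \<Rightarrow> real"
    and g\<^sub>0 :: "('a, 'e) metric_tensor"
    and I :: "nat set"
  defines "X\<^sub>i\<^sub>n\<^sub>t \<equiv> corner_interior X A"
    and "d\<^sub>\<Sigma> \<equiv> riemannian_dist X A (sigma_metric N \<rho> \<alpha> g\<^sub>0) (corner_interior X A)"
    and "F \<equiv> open_face X N H I"
    and "d\<^sub>F \<equiv> riemannian_dist X A g\<^sub>0 (open_face X N H I)"
    and "M \<equiv> Max (\<alpha> ` I)"
  assumes "smooth_manifold_with_corners X A" and "compact_space X"
    and "bij_betw H {1..N} (boundary_hypersurfaces X A)"
    and "\<And>i. i \<in> {1..N} \<Longrightarrow> embedded_hypersurface X A (H i)"
    and "\<And>i. i \<in> {1..N} \<Longrightarrow> boundary_defining_function X A (H i) (\<rho> i)"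
    and "smooth_riemannian_metric A g\<^sub>0"
    and "\<And>i. i \<in> {1..N} \<Longrightarrow> 0 \<le> \<alpha> i"
    and "I \<noteq> {}" and "I \<subseteq> {1..N}"
    and "\<And>p. p \<in> F \<Longrightarrow> accessible_point X X\<^sub>i\<^sub>n\<^sub>t d\<^sub>\<Sigma> p"
  shows "\<forall>p\<in>F. \<exists>V c C \<eta>.
           openin (subtopology X F) V \<and> p \<in> V \<and>
           compactin (subtopology X F) (subtopology X F closure_of V) \<and>
           0 < c \<and> c \<le> C \<and> 0 < \<eta> \<and>
           (\<forall>z\<in>V. \<forall>z'\<in>V. d\<^sub>F z z' < ennreal \<eta> \<longrightarrow>
              ennreal (c * enn2real (d\<^sub>F z z') powr (1 - M / 2)) \<le> boundary_dist X X\<^sub>i\<^sub>n\<^sub>t d\<^sub>\<Sigma> z z' \<and>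
              boundary_dist X X\<^sub>i\<^sub>n\<^sub>t d\<^sub>\<Sigma> z z' \<le> ennreal (C * enn2real (d\<^sub>F z z') powr (1 - M / 2)))"
proof
  fix p assume pF: "p \<in> F"
  interpret sf: sigma_faces X A g\<^sub>0 N H \<rho> \<alpha> I
    by unfold_locales (use assms in auto)
  have "p \<in> topspace X" using pF unfolding F_def open_face_def by blast
  then obtain c where c: "c \<in> A" "p \<in> chart_dom c" using sf.ex_chart by blast
  obtain r where r: "sf.adapted_radius c p r" using sf.adapted_radius_exists[OF c] by blast
  interpret sl: sigma_local X A g\<^sub>0 N H \<rho> \<alpha> I c p r
    by unfold_locales (use c pF r in \<open>auto simp: F_def\<close>)
  show "\<exists>V c C \<eta>.
           openin (subtopology X F) V \<and> p \<in> V \<and>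
           compactin (subtopology X F) (subtopology X F closure_of V) \<and>
           0 < c \<and> c \<le> C \<and> 0 < \<eta> \<and>
           (\<forall>z\<in>V. \<forall>z'\<in>V. d\<^sub>F z z' < ennreal \<eta> \<longrightarrow>
              ennreal (c * enn2real (d\<^sub>F z z') powr (1 - M / 2)) \<le> boundary_dist X X\<^sub>i\<^sub>n\<^sub>t d\<^sub>\<Sigma> z z' \<and>
              boundary_dist X X\<^sub>i\<^sub>n\<^sub>t d\<^sub>\<Sigma> z z' \<le> ennreal (C * enn2real (d\<^sub>F z z') powr (1 - M / 2)))"
    using sl.local_estimate assms(15)[OF pF]
    unfolding sf.Sg_dst sf.Fc_dst sf.M_def F_def d\<^sub>F_def d\<^sub>\<Sigma>_def M_def X\<^sub>i\<^sub>n\<^sub>t_def by blast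
qed

end
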